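(* Let $\lambda/\mu$ be a skew shape such that $G_{\lambda/\mu}$ is connected. Then $I_{\lambda/\mu}$ is unmixed if and only if there exists a sequence of prime unmixed shapes $B_1,\ldots,B_t$ (with each $B_i$ nonsquare if $t>1$) such that $\lambda/\mu=B_1\cup\cdots\cup B_t$ and, for all $i=1,\ldots,t-1$, the shapes $B_i,B_{i+1}$ are of alternating type (one upper triangular, the other lower triangular) and $B_i\cap B_{i+1}$ is an extremal block of both $B_i$ and $B_{i+1}$, namely the bottom-left extremal block of $B_i$ and the top-right extremal block of $B_{i+1}$.
   Context: Let $\mathrm{k}$ be a field. A skew shape $\lambda/\mu$ is a pair of sequences of integers $\lambda=(\lambda_1\ge\cdots\ge\lambda_n)$ and $\mu=(\mu_1\ge\cdots\ge\mu_n)$ with $\lambda_i>\mu_i\ge 0$ for all $i$ and $\mu_n=0$. It is identified with its diagram, the set of boxes $(i,j)$ with $1\le i\le n$, $\mu_i+1\le j\le\lambda_i$ (rows numbered from top to bottom, columns from left to right). Put $m=\lambda_1$. The skew Ferrers ideal is $I_{\lambda/\mu}=(x_iy_j\mid 1\le i\le n,\ \mu_i+1\le j\le\lambda_i)\subset S=\mathrm{k}[x_1,\ldots,x_n,y_1,\ldots,y_m]$, and $G_{\lambda/\mu}$ is the bipartite graph on $\{x_1,\ldots,x_n\}\cup\{y_1,\ldots,y_m\}$ with edges $\{x_i,y_j\}$ for the boxes $(i,j)$. For $\mu=0$ one writes $I_\lambda$. An ideal $I$ is unmixed if $\dim(S/P)=\dim(S/I)$ for every associated prime $P$ of $S/I$.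 A partition $\lambda$ is unmixed if $I_\lambda$ is. Blocks. Let $\lambda=(\lambda_1,\ldots,\lambda_n)$ be a partition with conjugate $\lambda'$. The Ferrers diagram of $\lambda$ is cut by the horizontal lines at depths $\lambda'_j$ and the vertical lines at widths $\lambda_i$ into rectangular regions called the blocks of $\lambda$ (rows are grouped into strips of rows of equal length, columns into strips of columns of equal length, and a block is the intersection of a row strip and a column strip, when contained in the diagram). A corner block is a block having no adjacent block to its right or below it. The extremal blocks are the top-right and the bottom-left corner blocks (they coincide if there is only one block). Prime unmixed shapes. An upper triangular prime unmixed shape is (a translate of) the Ferrers diagram of an unmixed partition. A lower triangular prime unmixed shape is (a translate of) the image of such a diagram under reflection in the diagonal line running from bottom-left to top-right; equivalently, since conjugation preserves unmixedness of partitions, it is the image of the diagram of an unmixed partition under rotation by $180^\circ$ (so it is right-justified with row lengths non-decreasing from top to bottom). Its blocks and its two extremal blocks (top-right and bottom-left) are the images of those of the original diagram. A prime unmixed shape is an upper or a lower triangular prime unmixed shape. A shape is square if it is a $p\times p$ square of boxes for some $p$. *)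

theory Defs
  imports
    "HOL-Algebra.QuotRing"
    "HOL-Library.Poly_Mapping"
    "HOL-Library.Extended_Nat"
    "Graph_Theory.Graph_Theory"
begin

section \<open>Unmixed ideals\<close>

text \<open>The Krull dimension: the supremum of the lengths of the chains
  \<open>P 0 \<subset> P 1 \<subset> \<dots> \<subset> P d\<close> of prime ideals (0 for the zero ring).\<close>

definition krull_dim :: "('a, 'c) ring_scheme \<Rightarrow> enat" where
  "krull_dim R = Sup {enat d | d. \<exists>P :: nat \<Rightarrow> 'a set.
      (\<forall>i\<le>d. primeideal (P i) R) \<and> (\<forall>i<d. P i \<subset> P (Suc i))}"

text \<open>The associated primes of the \<open>R\<close>-module \<open>R/I\<close>: the prime ideals of \<open>R\<close> that are the
  annihilator of an element of \<open>R/I\<close>.\<close>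

definition associated_primes :: "('a, 'c) ring_scheme \<Rightarrow> 'a set \<Rightarrow> 'a set set" where
  "associated_primes R I = {P. primeideal P R \<and>
      (\<exists>u \<in> carrier (R Quot I).
         P = {r \<in> carrier R. (I +>\<^bsub>R\<^esub> r) \<otimes>\<^bsub>R Quot I\<^esub> u = \<zero>\<^bsub>R Quot I\<^esub>})}"

definition unmixed_ideal :: "('a, 'c) ring_scheme \<Rightarrow> 'a set \<Rightarrow> bool" where
  "unmixed_ideal R I \<longleftrightarrow>
     (\<forall>P \<in> associated_primes R I. krull_dim (R Quot P) = krull_dim (R Quot I))"


section \<open>Polynomial rings\<close>

datatype indet = XVar nat | YVar nat

text \<open>Polynomials are finitely supported maps from monomials to coefficients, monomials being
  finitely supported maps from indeterminates to exponents. The ring \<open>k[V]\<close> has as carrier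
  the polynomials in which only indeterminates from \<open>V\<close> occur.\<close>

type_synonym 'k mpoly = "(indet \<Rightarrow>\<^sub>0 nat) \<Rightarrow>\<^sub>0 'k"

definition mvar :: "indet \<Rightarrow> 'k::field mpoly" where
  "mvar v = Poly_Mapping.single (Poly_Mapping.single v 1) 1"

definition mpoly_ring :: "indet set \<Rightarrow> 'k::field mpoly ring" where
  "mpoly_ring V = \<lparr> carrier = {p. \<forall>m \<in> Poly_Mapping.keys p. Poly_Mapping.keys m \<subseteq> V},
     monoid.mult = (*), one = 1, ring.zero = 0, ring.add = (+) \<rparr>"

lemma cring_mpoly_ring: "cring (mpoly_ring V :: 'k::field mpoly ring)"
proof -
  let ?R = "mpoly_ring V :: 'k mpoly ring"
  have [simp]: "monoid.mult ?R = (*)" "one ?R = 1" "ring.zero ?R = 0" "ring.add ?R = (+)"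
    by (simp_all add: mpoly_ring_def)
  have carrier: "p \<in> carrier ?R \<longleftrightarrow>
      (\<forall>m \<in> Poly_Mapping.keys p. Poly_Mapping.keys m \<subseteq> V)" for p
    by (simp add: mpoly_ring_def)
  have zero: "0 \<in> carrier ?R" and one: "1 \<in> carrier ?R"
    by (simp_all add: carrier)
  have add: "p + q \<in> carrier ?R" if "p \<in> carrier ?R" "q \<in> carrier ?R" for p q
    using that Poly_Mapping.keys_add[of p q] unfolding carrier by blast
  have uminus: "- p \<in> carrier ?R" if "p \<in> carrier ?R" for p
    using that by (simp add: carrier)
  have mult: "p * q \<in> carrier ?R" if pq: "p \<in> carrier ?R" "q \<in> carrier ?R" for p q
    unfolding carrier
  proof
    fix m assume "m \<in> Poly_Mapping.keys (p * q)"
    then obtain a b where "a \<in> Poly_Mapping.keys p" "b \<in> Poly_Mapping.keys q" "m = a + b"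
      using Poly_Mapping.keys_mult[of p q] by blast
    then show "Poly_Mapping.keys m \<subseteq> V"
      using pq Poly_Mapping.keys_add[of a b] unfolding carrier by blast
  qed
  have "abelian_group ?R"
  proof (rule abelian_groupI)
    fix p assume "p \<in> carrier ?R"
    then show "\<exists>q\<in>carrier ?R. q \<oplus>\<^bsub>?R\<^esub> p = \<zero>\<^bsub>?R\<^esub>"
      by (intro bexI[of _ "- p"]) (simp_all add: uminus)
  qed (simp_all add: add zero add.assoc add.commute)
  moreover have "Group.comm_monoid ?R"
    by (rule comm_monoidI) (simp_all add: mult one mult.assoc mult.commute)
  ultimately show ?thesis
    by (rule cringI) (simp add: distrib_right)
qed


section \<open>Skew shapes and skew Ferrers ideals\<close>

text \<open>Sequences are lists, so the entry \<open>\<lambda>\<^sub>i\<close> is \<open>lam ! (i - 1)\<close>. Boxes are pairs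
  (row, column); they have integer coordinates, so that diagrams can be moved freely.\<close>

definition skew_shape :: "nat list \<Rightarrow> nat list \<Rightarrow> bool" where
  "skew_shape lam mu \<longleftrightarrow> lam \<noteq> [] \<and> length mu = length lam \<and>
     sorted_wrt (\<ge>) lam \<and> sorted_wrt (\<ge>) mu \<and>
     (\<forall>i<length lam. lam ! i > mu ! i) \<and> last mu = 0"

type_synonym box = "int \<times> int"

definition diagram :: "nat list \<Rightarrow> nat list \<Rightarrow> box set" where
  "diagram lam mu = {(int i, int j) | i j.
     1 \<le> i \<and> i \<le> length lam \<and> mu ! (i - 1) + 1 \<le> j \<and> j \<le> lam ! (i - 1)}"

definition skew_vars :: "nat list \<Rightarrow> indet set" where
  "skew_vars lam = XVar ` {1..length lam} \<union> YVar ` {1..hd lam}"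

definition skew_ferrers_ideal :: "nat list \<Rightarrow> nat list \<Rightarrow> 'k::field mpoly set" where
  "skew_ferrers_ideal lam mu =
     Idl\<^bsub>mpoly_ring (skew_vars lam)\<^esub>
       {mvar (XVar i) * mvar (YVar j) | i j. (int i, int j) \<in> diagram lam mu}"

definition skew_unmixed :: "'k::field itself \<Rightarrow> nat list \<Rightarrow> nat list \<Rightarrow> bool" where
  "skew_unmixed K lam mu \<longleftrightarrow>
     unmixed_ideal (mpoly_ring (skew_vars lam)) (skew_ferrers_ideal lam mu :: 'k mpoly set)"

text \<open>Undirected graphs are represented by symmetric arc relations.\<close>

definition skew_graph :: "nat list \<Rightarrow> nat list \<Rightarrow> indet pair_pre_digraph" where
  "skew_graph lam mu = \<lparr> pverts = skew_vars lam,
     parcs = (\<Union>(i, j) \<in> {(i, j). (int i, int j) \<in> diagram lam mu}.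
                {(XVar i, YVar j), (YVar j, XVar i)}) \<rparr>"

definition skew_connected :: "nat list \<Rightarrow> nat list \<Rightarrow> bool" where
  "skew_connected lam mu \<longleftrightarrow> Digraph_Component.connected (with_proj (skew_graph lam mu))"


section \<open>Blocks of a partition\<close>

definition zeros :: "nat list \<Rightarrow> nat list" where
  "zeros lam = replicate (length lam) 0"

text \<open>Partitions have positive parts.\<close>

definition is_partition :: "nat list \<Rightarrow> bool" where
  "is_partition lam \<longleftrightarrow> skew_shape lam (zeros lam)"

definition unmixed_partition :: "'k::field itself \<Rightarrow> nat list \<Rightarrow> bool" where
  "unmixed_partition K lam \<longleftrightarrow> is_partition lam \<and> skew_unmixed K lam (zeros lam)"

definition ferrers :: "nat list \<Rightarrow> box set" where
  "ferrers lam = diagram lam (zeros lam)"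

definition conjugate_part :: "nat list \<Rightarrow> nat \<Rightarrow> nat" where
  "conjugate_part lam j = card {i. i < length lam \<and> lam ! i \<ge> j}"

text \<open>The row strip of the rows of length \<open>r\<close> intersected with the column strip of the columns
  of length \<open>c\<close>.\<close>

definition strip_meet :: "nat list \<Rightarrow> nat \<Rightarrow> nat \<Rightarrow> box set" where
  "strip_meet lam r c = {(int i, int j) | i j.
     1 \<le> i \<and> i \<le> length lam \<and> lam ! (i - 1) = r \<and>
     1 \<le> j \<and> j \<le> hd lam \<and> conjugate_part lam j = c}"

definition blocks :: "nat list \<Rightarrow> box set set" where
  "blocks lam = {strip_meet lam r c | r c.
     r \<in> set lam \<and> c \<in> conjugate_part lam ` {1..hd lam} \<and> strip_meet lam r c \<subseteq> ferrers lam}"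

definition corner_block :: "nat list \<Rightarrow> box set \<Rightarrow> bool" where
  "corner_block lam C \<longleftrightarrow> C \<in> blocks lam \<and>
     \<not> (\<exists>D \<in> blocks lam. D \<noteq> C \<and> (\<exists>(i, j) \<in> C. (i, j + 1) \<in> D \<or> (i + 1, j) \<in> D))"

text \<open>The top-right corner block is the one that meets the first row, the bottom-left corner
  block the one that meets the first column.\<close>

definition top_right_corner_block :: "nat list \<Rightarrow> box set \<Rightarrow> bool" where
  "top_right_corner_block lam C \<longleftrightarrow> corner_block lam C \<and> (\<exists>j. (1, j) \<in> C)"

definition bottom_left_corner_block :: "nat list \<Rightarrow> box set \<Rightarrow> bool" where
  "bottom_left_corner_block lam C \<longleftrightarrow> corner_block lam C \<and> (\<exists>i. (i, 1) \<in> C)"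


section \<open>Prime unmixed shapes\<close>

definition translate :: "int \<Rightarrow> int \<Rightarrow> box \<Rightarrow> box" where
  "translate a b = (\<lambda>(i, j). (i + a, j + b))"

text \<open>Rows are numbered downwards, so the lines from bottom-left to top-right are the lines
  \<open>i + j = const\<close>. This is the reflection in the one with constant 0; the others
  differ from it by a translation.\<close>

definition reflect :: "box \<Rightarrow> box" where
  "reflect = (\<lambda>(i, j). (- j, - i))"

definition upper_prime_unmixed :: "'k::field itself \<Rightarrow> box set \<Rightarrow> bool" where
  "upper_prime_unmixed K B \<longleftrightarrow>
     (\<exists>lam a b. unmixed_partition K lam \<and> B = translate a b ` ferrers lam)"

definition lower_prime_unmixed :: "'k::field itself \<Rightarrow> box set \<Rightarrow> bool" where
  "lower_prime_unmixed K B \<longleftrightarrow>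
     (\<exists>lam a b. unmixed_partition K lam \<and> B = translate a b ` reflect ` ferrers lam)"

definition prime_unmixed :: "'k::field itself \<Rightarrow> box set \<Rightarrow> bool" where
  "prime_unmixed K B \<longleftrightarrow> upper_prime_unmixed K B \<or> lower_prime_unmixed K B"

text \<open>The extremal blocks of a shape \<open>B\<close>, transported from the partition. The reflection maps top
  to right and left to bottom, so it respects the names of the extremal blocks. A shape of both
  types is a rectangle, whose only block is the whole shape, so there is no ambiguity.\<close>

definition shape_map :: "(box \<Rightarrow> box) \<Rightarrow> bool" where
  "shape_map f \<longleftrightarrow> (\<exists>a b. f = translate a b \<or> f = translate a b \<circ> reflect)"

definition top_right_block :: "box set \<Rightarrow> box set \<Rightarrow> bool" where
  "top_right_block B C \<longleftrightarrow> (\<exists>lam f C'. is_partition lam \<and> shape_map f \<and> B = f ` ferrers lam \<and>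
     top_right_corner_block lam C' \<and> C = f ` C')"

definition bottom_left_block :: "box set \<Rightarrow> box set \<Rightarrow> bool" where
  "bottom_left_block B C \<longleftrightarrow> (\<exists>lam f C'. is_partition lam \<and> shape_map f \<and> B = f ` ferrers lam \<and>
     bottom_left_corner_block lam C' \<and> C = f ` C')"

definition square_shape :: "box set \<Rightarrow> bool" where
  "square_shape B \<longleftrightarrow> (\<exists>a b. \<exists>p::nat. B = {a..<a + int p} \<times> {b..<b + int p})"

definition alternating_type :: "'k::field itself \<Rightarrow> box set \<Rightarrow> box set \<Rightarrow> bool" where
  "alternating_type K B B' \<longleftrightarrow>
     upper_prime_unmixed K B \<and> lower_prime_unmixed K B' \<or>
     lower_prime_unmixed K B \<and> upper_prime_unmixed K B'"

end

theory Submission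
  imports Defs
begin

text \<open>The ideal of a skew shape is the edge ideal of a bipartite graph. The associated primes of the edge
  ideal of a finite graph are generated by the minimal vertex covers
  (\<open>associated_primes_edge_ideal\<close>), and a prime that is generated by \<open>c\<close> of
  the \<open>v\<close> indeterminates has a quotient of dimension \<open>v - c\<close>. Therefore the edge ideal is
  unmixed iff the graph is well-covered, that is, iff all its minimal vertex covers have the
  same size (\<open>unmixed_edge_ideal_iff\<close>). The upper bound for the dimension
  (\<open>prime_chain_length_le\<close>) uses that witnesses for the strictness of a chain of primes
  are algebraically independent, whereas more than \<open>n\<close> polynomials in \<open>n\<close> indeterminates are
  algebraically dependent, since there are not enough monomials of low degree.

  In a well-covered skew shape without empty columns there are as many rows as columns, say \<open>n\<close>,
  and the antidiagonal \<open>i + j = n + 1\<close> belongs to the shape, for otherwise there is a vertex cover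
  with fewer than \<open>n\<close> elements (\<open>well_covered_skew_antidiagonal\<close>). The antidiagonal is a
  perfect matching between rows and columns; identifying matched rows and columns turns the shape into
  a reflexive relation on \<open>1, \<dots>, n\<close>, and the graph is well-covered iff this relation is
  transitive (\<open>well_covered_iff_transitive\<close>). As the rows and columns of a shape are
  intervals, such a preorder is determined by the neighbours \<open>z\<close>, \<open>z + 1\<close> that are not related
  in one or in the other direction: it consists of the pairs that are not separated by such a cut
  (\<open>cut_diagram_of_preorder\<close>). Connectedness says that no position carries cuts in both
  directions.

  The upper triangular prime unmixed shapes are the diagrams with cuts of one kind, the lower triangular
  ones those with cuts of the other kind (\<open>prime_of_type_iff\<close>). The extremal
  blocks are the antidiagonal squares before the first and behind the last cut
  (\<open>extremal_block_iff\<close>, \<open>top_right_part_typed_cut\<close>, \<open>bottom_left_part_typed_cut\<close>). So the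
  decomposition into prime shapes is the decomposition of the sequence of cuts into maximal runs of cuts
  of the same kind, where the shapes of successive runs share the square between the two runs
  (\<open>typed_cut_glue\<close>).\<close>

section \<open>Ideals of polynomial rings\<close>

lemma mpoly_ring_simps [simp]:
  "monoid.mult (mpoly_ring V) = (*)" "one (mpoly_ring V) = 1"
  "ring.zero (mpoly_ring V) = 0" "ring.add (mpoly_ring V) = (+)"
  by (simp_all add: mpoly_ring_def)

lemma mpoly_carrier_iff:
  "p \<in> carrier (mpoly_ring V) \<longleftrightarrow> (\<forall>m \<in> Poly_Mapping.keys p. Poly_Mapping.keys m \<subseteq> V)"
  by (simp add: mpoly_ring_def)

lemma ring_mpoly_ring: "ring (mpoly_ring V :: 'k::field mpoly ring)"
  using cring_mpoly_ring by (rule cring.axioms(1))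

text \<open>An order on the indeterminates makes the monomials a linearly ordered cancellative monoid,
  so that the polynomials form an integral domain.\<close>

fun indet_code :: "indet \<Rightarrow> nat" where
  "indet_code (XVar i) = 2 * i"
| "indet_code (YVar i) = 2 * i + 1"

lemma indet_code_inject: "indet_code u = indet_code v \<longleftrightarrow> u = v"
  by (cases u; cases v) (auto, presburger+)

instantiation indet :: linorder
begin

definition "u \<le> v \<longleftrightarrow> indet_code u \<le> indet_code v"
definition "u < v \<longleftrightarrow> indet_code u < indet_code v"

instance
  by standard (auto simp: less_eq_indet_def less_indet_def indet_code_inject)

end

lemma keys_plus_nat:
  fixes a b :: "'a \<Rightarrow>\<^sub>0 nat"
  shows "Poly_Mapping.keys (a + b) = Poly_Mapping.keys a \<union> Poly_Mapping.keys b"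
  by (auto simp: in_keys_iff lookup_add)

lemma poly_mapping_induct_single [case_names zero add_single]:
  fixes p :: "'a \<Rightarrow>\<^sub>0 'b::monoid_add"
  assumes "P 0"
    and "\<And>m c p. c \<noteq> 0 \<Longrightarrow> m \<notin> Poly_Mapping.keys p \<Longrightarrow> P p \<Longrightarrow> P (Poly_Mapping.single m c + p)"
  shows "P p"
proof (induction p rule: update_induct)
  case const
  then show ?case using assms(1) by simp
next
  case (update f a b)
  have "Poly_Mapping.update a b f = Poly_Mapping.single a b + f"
    using update(1) by (intro poly_mapping_eqI)
      (auto simp: lookup_update lookup_add lookup_single in_keys_iff when_def)
  then show ?case using assms(2)[OF update(2,1,3)] by simp
qed

lemma sum_single_keys:
  fixes p :: "'a \<Rightarrow>\<^sub>0 'b::comm_monoid_add"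
  shows "p = (\<Sum>m\<in>Poly_Mapping.keys p. Poly_Mapping.single m (Poly_Mapping.lookup p m))"
  by (rule poly_mapping_eqI) (auto simp: lookup_sum lookup_single when_def in_keys_iff)

lemma mpoly_uminus_carrier: "p \<in> carrier (mpoly_ring V) \<Longrightarrow> - p \<in> carrier (mpoly_ring V)"
  by (simp add: mpoly_carrier_iff)

lemma mpoly_carrier_closed:
  fixes p q :: "'k::field mpoly"
  assumes "p \<in> carrier (mpoly_ring V)" "q \<in> carrier (mpoly_ring V)"
  shows "p + q \<in> carrier (mpoly_ring V)" "p * q \<in> carrier (mpoly_ring V)"
    "p - q \<in> carrier (mpoly_ring V)"
proof -
  interpret cring "mpoly_ring V :: 'k mpoly ring" by (rule cring_mpoly_ring)
  show "p + q \<in> carrier (mpoly_ring V)" and "p * q \<in> carrier (mpoly_ring V)"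
    using a_closed[OF assms] m_closed[OF assms] by simp_all
  show "p - q \<in> carrier (mpoly_ring V)"
    using a_closed[OF assms(1) mpoly_uminus_carrier[OF assms(2)]] by simp
qed

lemma mpoly_zero_one_carrier [simp]:
  "0 \<in> carrier (mpoly_ring V)" "1 \<in> carrier (mpoly_ring V)"
  by (simp_all add: mpoly_carrier_iff)

lemma mpoly_idealI:
  fixes I :: "'k::field mpoly set"
  assumes "I \<subseteq> carrier (mpoly_ring V)" "0 \<in> I"
    and add: "\<And>p q. p \<in> I \<Longrightarrow> q \<in> I \<Longrightarrow> p + q \<in> I"
    and mult: "\<And>r p. r \<in> carrier (mpoly_ring V) \<Longrightarrow> p \<in> I \<Longrightarrow> r * p \<in> I"
  shows "ideal I (mpoly_ring V)"
proof -
  interpret cring "mpoly_ring V :: 'k mpoly ring" by (rule cring_mpoly_ring)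
  show ?thesis
  proof (rule idealI)
    show "ring (mpoly_ring V :: 'k mpoly ring)" by (rule ring_mpoly_ring)
    show "subgroup I (add_monoid (mpoly_ring V))"
    proof (rule add.subgroupI)
      fix p assume p: "p \<in> I"
      have "\<ominus>\<^bsub>mpoly_ring V\<^esub> p = - p"
        using p assms(1) by (intro minus_equality) (auto intro: mpoly_uminus_carrier)
      moreover have "- p \<in> I"
        using mult[OF mpoly_uminus_carrier[OF mpoly_zero_one_carrier(2)] p] by simp
      ultimately show "\<ominus>\<^bsub>mpoly_ring V\<^esub> p \<in> I" by simp
    qed (use assms in auto)
  next
    fix p r :: "'k mpoly" assume "p \<in> I" "r \<in> carrier (mpoly_ring V)"
    then show "r \<otimes>\<^bsub>mpoly_ring V\<^esub> p \<in> I" "p \<otimes>\<^bsub>mpoly_ring V\<^esub> r \<in> I"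
      using mult[of r p] by (simp_all add: mult.commute[of p])
  qed
qed

lemma mpoly_idealD:
  fixes I :: "'k::field mpoly set"
  assumes "ideal I (mpoly_ring V)"
  shows "p \<in> I \<Longrightarrow> p \<in> carrier (mpoly_ring V)" "0 \<in> I" "p \<in> I \<Longrightarrow> q \<in> I \<Longrightarrow> p + q \<in> I"
    "r \<in> carrier (mpoly_ring V) \<Longrightarrow> p \<in> I \<Longrightarrow> r * p \<in> I"
    "p \<in> I \<Longrightarrow> q \<in> I \<Longrightarrow> p - q \<in> I"
proof -
  interpret ideal I "mpoly_ring V" by fact
  show "p \<in> I \<Longrightarrow> p \<in> carrier (mpoly_ring V)" by (rule Icarr)
  show "0 \<in> I" using additive_subgroup.zero_closed[OF ideal.axioms(1)[OF assms]] by simp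
  show add: "p \<in> I \<Longrightarrow> q \<in> I \<Longrightarrow> p + q \<in> I" for p q
    using additive_subgroup.a_closed[OF ideal.axioms(1)[OF assms], of p q] by simp
  show mult: "r \<in> carrier (mpoly_ring V) \<Longrightarrow> p \<in> I \<Longrightarrow> r * p \<in> I" for r p
    using I_l_closed[of p r] by simp
  show "p \<in> I \<Longrightarrow> q \<in> I \<Longrightarrow> p - q \<in> I"
    using add[of p "- q"] mult[OF mpoly_uminus_carrier[OF mpoly_zero_one_carrier(2)], of q] by simp
qed

lemma mpoly_primeD:
  fixes P :: "'k::field mpoly set"
  assumes "primeideal P (mpoly_ring V)"
  shows "ideal P (mpoly_ring V)" "1 \<notin> P"
    "p \<in> carrier (mpoly_ring V) \<Longrightarrow> q \<in> carrier (mpoly_ring V) \<Longrightarrow> p * q \<in> P \<Longrightarrow> p \<in> P \<or> q \<in> P"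
proof -
  interpret primeideal P "mpoly_ring V" by fact
  show "ideal P (mpoly_ring V)" by (rule ideal_axioms)
  show "1 \<notin> P" using one_imp_carrier I_notcarr by auto
  show "p \<in> carrier (mpoly_ring V) \<Longrightarrow> q \<in> carrier (mpoly_ring V) \<Longrightarrow> p * q \<in> P \<Longrightarrow> p \<in> P \<or> q \<in> P"
    using I_prime[of p q] by simp
qed

section \<open>Prime ideals generated by indeterminates\<close>

text \<open>The part of a polynomial that consists of the terms in which no indeterminate
  from \<open>W\<close> occurs, that is, its image under the substitution of 0 for these indeterminates.\<close>

definition avoiding :: "indet set \<Rightarrow> 'k::field mpoly \<Rightarrow> 'k mpoly" where
  "avoiding W p = Poly_Mapping.mapp (\<lambda>m c. c when Poly_Mapping.keys m \<inter> W = {}) p"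

lemma lookup_avoiding:
  "Poly_Mapping.lookup (avoiding W p) m =
     (if Poly_Mapping.keys m \<inter> W = {} then Poly_Mapping.lookup p m else 0)"
  by (auto simp: avoiding_def lookup_mapp when_def in_keys_iff)

lemma keys_avoiding:
  "Poly_Mapping.keys (avoiding W p) = {m \<in> Poly_Mapping.keys p. Poly_Mapping.keys m \<inter> W = {}}"
proof -
  have "m \<in> Poly_Mapping.keys (avoiding W p) \<longleftrightarrow>
      m \<in> Poly_Mapping.keys p \<and> Poly_Mapping.keys m \<inter> W = {}" for m
    unfolding in_keys_iff[of m] lookup_avoiding by simp
  then show ?thesis by blast
qed

lemma avoiding_add: "avoiding W (p + q) = avoiding W p + avoiding W q"
  by (rule poly_mapping_eqI) (auto simp: lookup_avoiding lookup_add)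

lemma avoiding_zero [simp]: "avoiding W 0 = 0"
  by (rule poly_mapping_eqI) (auto simp: lookup_avoiding)

lemma avoiding_single:
  "avoiding W (Poly_Mapping.single m c) =
     (if Poly_Mapping.keys m \<inter> W = {} then Poly_Mapping.single m c else 0)"
  by (rule poly_mapping_eqI) (auto simp: lookup_avoiding lookup_single when_def)

lemma avoiding_mult:
  fixes p q :: "'k::field mpoly"
  shows "avoiding W (p * q) = avoiding W p * avoiding W q"
proof (induction p rule: poly_mapping_induct_single)
  case (add_single m c p)
  have "avoiding W (Poly_Mapping.single m c * q) = avoiding W (Poly_Mapping.single m c) * avoiding W q"
    by (induction q rule: poly_mapping_induct_single)
      (auto simp: avoiding_add avoiding_single mult_single keys_plus_nat distrib_left)
  then show ?case using add_single by (simp add: distrib_right avoiding_add)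
qed simp

lemma avoiding_carrier:
  "p \<in> carrier (mpoly_ring V) \<Longrightarrow> avoiding W p \<in> carrier (mpoly_ring (V - W))"
  by (auto simp: mpoly_carrier_iff keys_avoiding)

text \<open>The ideal of \<open>k[V]\<close> generated by the indeterminates in \<open>C\<close>.\<close>

definition var_ideal :: "indet set \<Rightarrow> indet set \<Rightarrow> 'k::field mpoly set" where
  "var_ideal V C = {p \<in> carrier (mpoly_ring V). \<forall>m\<in>Poly_Mapping.keys p. Poly_Mapping.keys m \<inter> C \<noteq> {}}"

lemma var_ideal_iff_avoiding:
  "p \<in> var_ideal V C \<longleftrightarrow> p \<in> carrier (mpoly_ring V) \<and> avoiding C p = 0"
proof -
  have "avoiding C p = 0 \<longleftrightarrow> Poly_Mapping.keys (avoiding C p) = {}"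
    by (metis keys_eq_empty)
  then show ?thesis unfolding var_ideal_def keys_avoiding by auto
qed

lemma primeideal_var_ideal: "primeideal (var_ideal V C :: 'k::field mpoly set) (mpoly_ring V)"
proof (rule primeidealI)
  show "cring (mpoly_ring V :: 'k mpoly ring)" by (rule cring_mpoly_ring)
  show "ideal (var_ideal V C :: 'k mpoly set) (mpoly_ring V)"
  proof (rule mpoly_idealI)
    show "(var_ideal V C :: 'k mpoly set) \<subseteq> carrier (mpoly_ring V)" "0 \<in> (var_ideal V C :: 'k mpoly set)"
      by (auto simp: var_ideal_iff_avoiding)
    show "p + q \<in> var_ideal V C" if "p \<in> var_ideal V C" "q \<in> var_ideal V C" for p q :: "'k mpoly"
      using that by (simp add: var_ideal_iff_avoiding avoiding_add mpoly_carrier_closed)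
    show "r * p \<in> var_ideal V C" if "r \<in> carrier (mpoly_ring V)" "p \<in> var_ideal V C" for r p :: "'k mpoly"
      using that by (simp add: var_ideal_iff_avoiding avoiding_mult mpoly_carrier_closed)
  qed
  have "avoiding C (1 :: 'k mpoly) = 1"
    using avoiding_single[of C 0 "1::'k"] by simp
  then have "(1 :: 'k mpoly) \<notin> var_ideal V C"
    by (simp add: var_ideal_iff_avoiding)
  then show "carrier (mpoly_ring V) \<noteq> (var_ideal V C :: 'k mpoly set)"
    by (metis mpoly_zero_one_carrier(2))
  show "p \<in> var_ideal V C \<or> q \<in> var_ideal V C"
    if "p \<in> carrier (mpoly_ring V)" "q \<in> carrier (mpoly_ring V)"
      "p \<otimes>\<^bsub>mpoly_ring V\<^esub> q \<in> var_ideal V C" for p q :: "'k mpoly"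
    using that by (simp add: var_ideal_iff_avoiding avoiding_mult)
qed

lemma mvar_single: "mvar v * mvar w = Poly_Mapping.single (Poly_Mapping.single v 1 + Poly_Mapping.single w 1) 1"
  by (simp add: mvar_def mult_single)

lemma mvar_carrier: "v \<in> V \<Longrightarrow> mvar v \<in> carrier (mpoly_ring V)"
  by (simp add: mvar_def mpoly_carrier_iff)

lemma mvar_in_var_ideal: "v \<in> V \<Longrightarrow> mvar v \<in> var_ideal V C \<longleftrightarrow> v \<in> C"
  by (auto simp: var_ideal_def mvar_carrier) (auto simp: mvar_def)

lemma var_ideal_subset_iff:
  assumes "C \<subseteq> V"
  shows "(var_ideal V C :: 'k::field mpoly set) \<subseteq> var_ideal V D \<longleftrightarrow> C \<subseteq> D"
proof
  assume *: "(var_ideal V C :: 'k mpoly set) \<subseteq> var_ideal V D"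
  show "C \<subseteq> D"
  proof
    fix v assume "v \<in> C"
    with assms have "v \<in> V" by blast
    with \<open>v \<in> C\<close> have "(mvar v :: 'k mpoly) \<in> var_ideal V C" by (simp add: mvar_in_var_ideal)
    with * have "(mvar v :: 'k mpoly) \<in> var_ideal V D" by blast
    with \<open>v \<in> V\<close> show "v \<in> D" by (simp add: mvar_in_var_ideal)
  qed
qed (auto simp: var_ideal_def)

lemma single_plus_mult:
  "Poly_Mapping.single (a + b) (c::'k::field) = Poly_Mapping.single a c * Poly_Mapping.single b 1"
  by (simp add: mult_single)

lemma single_carrier:
  "Poly_Mapping.keys m \<subseteq> V \<Longrightarrow> (Poly_Mapping.single m c :: 'k::field mpoly) \<in> carrier (mpoly_ring V)"
  by (simp add: mpoly_carrier_iff)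

lemma ideal_sum_mem:
  fixes f :: "'a \<Rightarrow> 'k::field mpoly"
  assumes "ideal I (mpoly_ring V)" "\<And>x. x \<in> A \<Longrightarrow> f x \<in> I"
  shows "sum f A \<in> I"
  using assms(2) by (induction A rule: infinite_finite_induct) (auto intro: mpoly_idealD[OF assms(1)])

lemma var_ideal_minimal:
  fixes I :: "'k::field mpoly set"
  assumes I: "ideal I (mpoly_ring V)" and C: "\<And>v. v \<in> C \<Longrightarrow> mvar v \<in> I"
  shows "var_ideal V C \<subseteq> I"
proof
  fix p :: "'k mpoly" assume p: "p \<in> var_ideal V C"
  have "Poly_Mapping.single m (Poly_Mapping.lookup p m) \<in> I" if m: "m \<in> Poly_Mapping.keys p" for m
  proof -
    obtain v where v: "v \<in> C" "v \<in> Poly_Mapping.keys m"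
      using p m by (auto simp: var_ideal_def)
    define m' where "m' = m - Poly_Mapping.single v 1"
    have mm': "m = m' + Poly_Mapping.single v 1"
      using v(2) unfolding m'_def
      by (intro poly_mapping_eqI) (auto simp: lookup_add lookup_minus lookup_single when_def in_keys_iff)
    have "Poly_Mapping.keys m \<subseteq> V" using p m by (auto simp: var_ideal_def mpoly_carrier_iff)
    then have "Poly_Mapping.keys m' \<subseteq> V" unfolding mm' by (simp add: keys_plus_nat)
    then show ?thesis
      unfolding mm' single_plus_mult[of m']
      by (intro mpoly_idealD(4)[OF I] single_carrier) (use C[OF v(1)] in \<open>auto simp: mvar_def\<close>)
  qed
  then have "(\<Sum>m\<in>Poly_Mapping.keys p. Poly_Mapping.single m (Poly_Mapping.lookup p m)) \<in> I"
    by (intro ideal_sum_mem[OF I])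
  then show "p \<in> I" using sum_single_keys[of p] by simp
qed

section \<open>Krull dimension of a quotient\<close>

text \<open>The primes of \<open>R/I\<close> correspond to the primes of \<open>R\<close> that contain \<open>I\<close>.\<close>

lemma krull_dim_quotient:
  assumes "cring R" "ideal I R"
  shows "krull_dim (R Quot I) = Sup {enat d | d. \<exists>P :: nat \<Rightarrow> 'a set.
      (\<forall>i\<le>d. primeideal (P i) R \<and> I \<subseteq> P i) \<and> (\<forall>i<d. P i \<subset> P (Suc i))}"
proof -
  interpret R: cring R by fact
  interpret I: ideal I R by fact
  interpret Q: cring "R Quot I" by (rule I.quotient_is_cring) fact
  have coset: "I +>\<^bsub>R\<^esub> r \<in> carrier (R Quot I)" if "r \<in> carrier R" for r
    using that by (auto simp: FactRing_def A_RCOSETS_def')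
  have cosetE: "\<exists>r\<in>carrier R. x = I +>\<^bsub>R\<^esub> r" if "x \<in> carrier (R Quot I)" for x
    using that by (auto simp: FactRing_def A_RCOSETS_def')
  have mult: "(I +>\<^bsub>R\<^esub> a) \<otimes>\<^bsub>R Quot I\<^esub> (I +>\<^bsub>R\<^esub> b) = I +>\<^bsub>R\<^esub> (a \<otimes>\<^bsub>R\<^esub> b)"
    if "a \<in> carrier R" "b \<in> carrier R" for a b
    using I.rcoset_mult_add[OF that] by (simp add: FactRing_def)
  have down: "primeideal {r \<in> carrier R. I +>\<^bsub>R\<^esub> r \<in> J} R \<and> I \<subseteq> {r \<in> carrier R. I +>\<^bsub>R\<^esub> r \<in> J}"
    if J: "primeideal J (R Quot I)" for J
  proof
    interpret J: primeideal J "R Quot I" by fact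
    show "primeideal {r \<in> carrier R. I +>\<^bsub>R\<^esub> r \<in> J} R"
    proof (rule primeidealI)
      show "ideal {r \<in> carrier R. I +>\<^bsub>R\<^esub> r \<in> J} R"
        by (rule ring_hom_ring.ideal_vimage[OF I.rcos_ring_hom_ring]) (rule J.ideal_axioms)
      show "cring R" by fact
      have "I +>\<^bsub>R\<^esub> \<one>\<^bsub>R\<^esub> \<notin> J"
        using J.one_imp_carrier J.I_notcarr by (auto simp: FactRing_def)
      then show "carrier R \<noteq> {r \<in> carrier R. I +>\<^bsub>R\<^esub> r \<in> J}" by auto
    qed (use J.I_prime coset in \<open>auto simp flip: mult\<close>)
    have "I +>\<^bsub>R\<^esub> r = \<zero>\<^bsub>R Quot I\<^esub>" if "r \<in> I" for r
      using R.a_rcos_zero[OF assms(2) that] by (simp add: FactRing_def)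
    then show "I \<subseteq> {r \<in> carrier R. I +>\<^bsub>R\<^esub> r \<in> J}"
      using J.zero_closed I.a_Hcarr by auto
  qed
  have mem: "I +>\<^bsub>R\<^esub> r \<in> (+>\<^bsub>R\<^esub>) I ` P \<longleftrightarrow> r \<in> P"
    if P: "ideal P R" "I \<subseteq> P" and r: "r \<in> carrier R" for P r
  proof
    interpret P: ideal P R by fact
    assume "I +>\<^bsub>R\<^esub> r \<in> (+>\<^bsub>R\<^esub>) I ` P"
    then obtain p where p: "p \<in> P" "I +>\<^bsub>R\<^esub> r = I +>\<^bsub>R\<^esub> p" by blast
    have "r \<in> I +>\<^bsub>R\<^esub> r" using I.a_rcos_self[OF r] .
    then obtain i where "i \<in> I" "r = i \<oplus>\<^bsub>R\<^esub> p"
      unfolding p(2) by (auto simp: a_r_coset_def')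
    then show "r \<in> P" using P(2) p(1) by auto
  qed auto
  have up: "primeideal ((+>\<^bsub>R\<^esub>) I ` P) (R Quot I)" if P: "primeideal P R" "I \<subseteq> P" for P
  proof (rule primeidealI)
    interpret P: primeideal P R by fact
    show "ideal ((+>\<^bsub>R\<^esub>) I ` P) (R Quot I)"
      using R.ring_ideal_imp_quot_ideal[OF assms(2) P.ideal_axioms] .
    show "cring (R Quot I)" by (rule Q.cring_axioms)
    obtain r where r: "r \<in> carrier R" "r \<notin> P" using P.I_notcarr P.Icarr by blast
    then have "I +>\<^bsub>R\<^esub> r \<notin> (+>\<^bsub>R\<^esub>) I ` P"
      using mem[OF P.ideal_axioms P(2) r(1)] by simp
    then show "carrier (R Quot I) \<noteq> (+>\<^bsub>R\<^esub>) I ` P"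
      using coset[OF r(1)] by metis
    fix a b assume ab: "a \<in> carrier (R Quot I)" "b \<in> carrier (R Quot I)"
      "a \<otimes>\<^bsub>R Quot I\<^esub> b \<in> (+>\<^bsub>R\<^esub>) I ` P"
    obtain r where r: "r \<in> carrier R" "a = I +>\<^bsub>R\<^esub> r"
      using cosetE[OF ab(1)] by (elim bexE)
    obtain s where s: "s \<in> carrier R" "b = I +>\<^bsub>R\<^esub> s"
      using cosetE[OF ab(2)] by (elim bexE)
    have "I +>\<^bsub>R\<^esub> (r \<otimes>\<^bsub>R\<^esub> s) \<in> (+>\<^bsub>R\<^esub>) I ` P"
      using ab(3) unfolding r(2) s(2) mult[OF r(1) s(1)] .
    then have "r \<otimes>\<^bsub>R\<^esub> s \<in> P"
      using mem[OF P.ideal_axioms P(2)] r(1) s(1) by (metis R.m_closed)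
    then have "r \<in> P \<or> s \<in> P"
      by (rule P.I_prime[OF r(1) s(1)])
    then show "a \<in> (+>\<^bsub>R\<^esub>) I ` P \<or> b \<in> (+>\<^bsub>R\<^esub>) I ` P"
      unfolding r(2) s(2) by (elim disjE) (simp_all only: imageI simp_thms)
  qed
  have "(\<exists>P :: nat \<Rightarrow> 'a set set. (\<forall>i\<le>d. primeideal (P i) (R Quot I)) \<and> (\<forall>i<d. P i \<subset> P (Suc i)))
    \<longleftrightarrow> (\<exists>P :: nat \<Rightarrow> 'a set. (\<forall>i\<le>d. primeideal (P i) R \<and> I \<subseteq> P i) \<and> (\<forall>i<d. P i \<subset> P (Suc i)))"
    (is "?l \<longleftrightarrow> ?r") for d
  proof
    assume ?l
    then obtain P where P: "\<And>i. i \<le> d \<Longrightarrow> primeideal (P i) (R Quot I)"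
      "\<And>i. i < d \<Longrightarrow> P i \<subset> P (Suc i)" by blast
    have "{r \<in> carrier R. I +>\<^bsub>R\<^esub> r \<in> P i} \<subset> {r \<in> carrier R. I +>\<^bsub>R\<^esub> r \<in> P (Suc i)}" if i: "i < d" for i
    proof -
      interpret J: primeideal "P (Suc i)" "R Quot I" using P(1) i by simp
      obtain x where x: "x \<in> P (Suc i)" "x \<notin> P i" using P(2)[OF i] by (elim psubsetE) blast
      obtain r where "r \<in> carrier R" "x = I +>\<^bsub>R\<^esub> r"
        using cosetE[OF J.Icarr[OF x(1)]] by (elim bexE)
      then have "r \<in> {r \<in> carrier R. I +>\<^bsub>R\<^esub> r \<in> P (Suc i)}" "r \<notin> {r \<in> carrier R. I +>\<^bsub>R\<^esub> r \<in> P i}"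
        using x by simp_all
      moreover have "{r \<in> carrier R. I +>\<^bsub>R\<^esub> r \<in> P i} \<subseteq> {r \<in> carrier R. I +>\<^bsub>R\<^esub> r \<in> P (Suc i)}"
        using P(2)[OF i] by (intro Collect_mono) (auto dest: psubsetD)
      ultimately show ?thesis by (metis psubsetI)
    qed
    then show ?r using P(1) down
      by (intro exI[of _ "\<lambda>i. {r \<in> carrier R. I +>\<^bsub>R\<^esub> r \<in> P i}"] conjI allI impI) simp_all
  next
    assume ?r
    then obtain P where P: "\<And>i. i \<le> d \<Longrightarrow> primeideal (P i) R" "\<And>i. i \<le> d \<Longrightarrow> I \<subseteq> P i"
      "\<And>i. i < d \<Longrightarrow> P i \<subset> P (Suc i)" by blast
    have "(+>\<^bsub>R\<^esub>) I ` P i \<subset> (+>\<^bsub>R\<^esub>) I ` P (Suc i)" if i: "i < d" for i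
    proof -
      obtain r where r: "r \<in> P (Suc i)" "r \<notin> P i" using P(3)[OF i] by blast
      have "r \<in> carrier R"
        using ideal.Icarr[OF primeideal.axioms(1)[OF P(1)]] r(1) i by (metis Suc_leI)
      then have "I +>\<^bsub>R\<^esub> r \<notin> (+>\<^bsub>R\<^esub>) I ` P i"
        using mem[OF primeideal.axioms(1)[OF P(1)] P(2)] i r(2) by (metis less_imp_le)
      moreover have "I +>\<^bsub>R\<^esub> r \<in> (+>\<^bsub>R\<^esub>) I ` P (Suc i)" using r(1) by (rule imageI)
      moreover have "(+>\<^bsub>R\<^esub>) I ` P i \<subseteq> (+>\<^bsub>R\<^esub>) I ` P (Suc i)"
        using P(3)[OF i] by (intro image_mono) (rule psubset_imp_subset)
      ultimately show ?thesis by (metis psubsetI)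
    qed
    then show ?l using P(1,2) up
      by (intro exI[of _ "\<lambda>i. (+>\<^bsub>R\<^esub>) I ` P i"] conjI allI impI) simp_all
  qed
  then show ?thesis unfolding krull_dim_def by simp
qed

section \<open>Lengths of chains of prime ideals in a polynomial ring\<close>

text \<open>The product \<open>g\<^sub>1^a\<^sub>1 * g\<^sub>2^a\<^sub>2 * \<dots>\<close>, over the common length of the two lists.\<close>

fun power_prod :: "'a::comm_monoid_mult list \<Rightarrow> nat list \<Rightarrow> 'a" where
  "power_prod (g # gs) (a # as) = g ^ a * power_prod gs as"
| "power_prod gs as = 1"

lemma mpoly_power_carrier:
  "g \<in> carrier (mpoly_ring V) \<Longrightarrow> g ^ n \<in> carrier (mpoly_ring V)" for g :: "'k::field mpoly"
  by (induction n) (auto intro: mpoly_carrier_closed)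

lemma power_prod_carrier:
  fixes gs :: "'k::field mpoly list"
  assumes "set gs \<subseteq> carrier (mpoly_ring V)"
  shows "power_prod gs as \<in> carrier (mpoly_ring V)"
  using assms by (induction gs as rule: power_prod.induct)
    (auto intro!: mpoly_carrier_closed mpoly_power_carrier)

lemma mpoly_sum_carrier:
  fixes f :: "'a \<Rightarrow> 'k::field mpoly"
  assumes "\<And>x. x \<in> A \<Longrightarrow> f x \<in> carrier (mpoly_ring V)"
  shows "sum f A \<in> carrier (mpoly_ring V)"
  using assms by (induction A rule: infinite_finite_induct) (auto intro: mpoly_carrier_closed)

lemma prime_power_notin:
  fixes P :: "'k::field mpoly set"
  assumes "primeideal P (mpoly_ring V)" "g \<in> carrier (mpoly_ring V)" "g \<notin> P"
  shows "g ^ n \<notin> P"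
proof (induction n)
  case 0
  then show ?case using mpoly_primeD(2)[OF assms(1)] by simp
next
  case (Suc n)
  then show ?case
    using mpoly_primeD(3)[OF assms(1,2) mpoly_power_carrier[OF assms(2)]] assms(3) by auto
qed

text \<open>Elements that witness the strictness of the inclusions in a chain of primes are algebraically
  independent over \<open>k\<close>, even modulo the smallest prime: in a polynomial relation one can divide
  by the lowest power of the first element, which is not in the first prime but in the second one,
  and obtains a relation between the other elements modulo the second prime.\<close>

lemma chain_witnesses_independent:
  fixes gs :: "'k::field mpoly list"
  assumes "\<And>i. i \<le> length gs \<Longrightarrow> primeideal (P i) (mpoly_ring V)"
    and "\<And>i. i < length gs \<Longrightarrow> P i \<subseteq> P (Suc i) \<and> gs ! i \<in> P (Suc i) - P i"
    and "finite A" "A \<noteq> {}" "\<And>as. as \<in> A \<Longrightarrow> length as = length gs \<and> c as \<noteq> 0"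
  shows "(\<Sum>as\<in>A. Poly_Mapping.single 0 (c as) * power_prod gs as) \<notin> P 0"
  using assms
proof (induction gs arbitrary: P A c)
  case Nil
  then have A: "A = {[]}" by fastforce
  have prime: "primeideal (P 0) (mpoly_ring V)" using Nil.prems(1)[of 0] by simp
  have "c [] \<noteq> 0" using Nil.prems(5)[of "[]"] A by simp
  then have "Poly_Mapping.single 0 (inverse (c [])) * Poly_Mapping.single 0 (c []) = (1 :: 'k mpoly)"
    by (simp add: mult_single)
  moreover have "(Poly_Mapping.single 0 (inverse (c [])) :: 'k mpoly) \<in> carrier (mpoly_ring V)"
    by (rule single_carrier) simp
  ultimately have "Poly_Mapping.single 0 (c []) \<notin> P 0"
    using mpoly_idealD(4)[OF mpoly_primeD(1)[OF prime]] mpoly_primeD(2)[OF prime] by metis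
  then show ?case using A by simp
next
  case (Cons g gs)
  have prime: "primeideal (P 0) (mpoly_ring V)" "primeideal (P (Suc 0)) (mpoly_ring V)"
    using Cons.prems(1)[of 0] Cons.prems(1)[of "Suc 0"] by simp_all
  have g: "P 0 \<subseteq> P (Suc 0)" "g \<in> P (Suc 0)" "g \<notin> P 0"
    using Cons.prems(2)[of 0] by simp_all
  have gcarr: "g \<in> carrier (mpoly_ring V)"
    using mpoly_idealD(1)[OF mpoly_primeD(1)[OF prime(2)] g(2)] .
  have gscarr: "set gs \<subseteq> carrier (mpoly_ring V)"
  proof
    fix h assume "h \<in> set gs"
    then obtain i where i: "i < length gs" "h = gs ! i" by (auto simp: in_set_conv_nth)
    then have "h \<in> P (Suc (Suc i))" using Cons.prems(2)[of "Suc i"] by simp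
    then show "h \<in> carrier (mpoly_ring V)"
      using mpoly_idealD(1)[OF mpoly_primeD(1)[OF Cons.prems(1)[of "Suc (Suc i)"]]] i(1) by simp
  qed
  define m where "m = Min (hd ` A)"
  have m_le: "m \<le> hd as" if "as \<in> A" for as
    unfolding m_def using that Cons.prems(3) by simp
  have "m \<in> hd ` A" unfolding m_def using Cons.prems(3,4) by (intro Min_in) auto
  then obtain as0 where as0: "as0 \<in> A" "hd as0 = m" by blast
  define A1 where "A1 = {as \<in> A. hd as = m}"
  define T where "T = tl ` A1"
  have A_form: "as = hd as # tl as" "length (tl as) = length gs" if "as \<in> A" for as
    using Cons.prems(5)[OF that] by (cases as; simp)+
  define D1 where "D1 = (\<Sum>bs\<in>T. Poly_Mapping.single 0 (c (m # bs)) * power_prod gs bs)"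
  define D2 where "D2 = (\<Sum>as\<in>A - A1. Poly_Mapping.single 0 (c as) *
    (g ^ (hd as - Suc m) * power_prod gs (tl as)))"
  have const: "(Poly_Mapping.single 0 x :: 'k mpoly) \<in> carrier (mpoly_ring V)" for x
    by (rule single_carrier) simp
  have D1carr: "D1 \<in> carrier (mpoly_ring V)" unfolding D1_def
    by (intro mpoly_sum_carrier mpoly_carrier_closed const power_prod_carrier gscarr)
  have D2carr: "D2 \<in> carrier (mpoly_ring V)" unfolding D2_def
    by (intro mpoly_sum_carrier mpoly_carrier_closed mpoly_power_carrier const power_prod_carrier gscarr gcarr)
  have inj: "inj_on tl A1"
    by (rule inj_onI) (metis (mono_tags, lifting) A1_def A_form(1) mem_Collect_eq)
  have "(\<Sum>as\<in>A1. Poly_Mapping.single 0 (c as) * power_prod (g # gs) as)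
      = (\<Sum>as\<in>A1. g ^ m * (Poly_Mapping.single 0 (c (m # tl as)) * power_prod gs (tl as)))"
  proof (rule sum.cong)
    fix as assume "as \<in> A1"
    then have "as = m # tl as" using A_form(1)[of as] by (simp add: A1_def)
    then show "Poly_Mapping.single 0 (c as) * power_prod (g # gs) as =
        g ^ m * (Poly_Mapping.single 0 (c (m # tl as)) * power_prod gs (tl as))"
      by (metis mult.left_commute power_prod.simps(1))
  qed simp
  also have "\<dots> = g ^ m * D1"
    unfolding D1_def T_def sum.reindex[OF inj] by (simp add: sum_distrib_left)
  finally have sum1: "(\<Sum>as\<in>A1. Poly_Mapping.single 0 (c as) * power_prod (g # gs) as) = g ^ m * D1" .
  have "(\<Sum>as\<in>A - A1. Poly_Mapping.single 0 (c as) * power_prod (g # gs) as)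
      = (\<Sum>as\<in>A - A1. g ^ m * (g * (Poly_Mapping.single 0 (c as) *
           (g ^ (hd as - Suc m) * power_prod gs (tl as)))))"
  proof (rule sum.cong)
    fix as assume as: "as \<in> A - A1"
    then have "hd as = m + Suc (hd as - Suc m)" using m_le[of as] by (auto simp: A1_def)
    then have "g ^ hd as = g ^ m * (g * g ^ (hd as - Suc m))"
      by (metis power_add power_Suc)
    moreover have "power_prod (g # gs) as = g ^ hd as * power_prod gs (tl as)"
      using A_form(1)[of as] as by (metis DiffD1 power_prod.simps(1))
    ultimately show "Poly_Mapping.single 0 (c as) * power_prod (g # gs) as =
        g ^ m * (g * (Poly_Mapping.single 0 (c as) * (g ^ (hd as - Suc m) * power_prod gs (tl as))))"
      by (simp only: mult.assoc mult.left_commute mult.commute)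
  qed simp
  also have "\<dots> = g ^ m * (g * D2)"
    unfolding D2_def by (simp add: sum_distrib_left)
  finally have sum2: "(\<Sum>as\<in>A - A1. Poly_Mapping.single 0 (c as) * power_prod (g # gs) as) = g ^ m * (g * D2)" .
  have "A1 \<subseteq> A" by (auto simp: A1_def)
  note sum.subset_diff[OF this Cons.prems(3), of "\<lambda>as. Poly_Mapping.single 0 (c as) * power_prod (g # gs) as"]
  then have sum: "(\<Sum>as\<in>A. Poly_Mapping.single 0 (c as) * power_prod (g # gs) as) = g ^ m * (D1 + g * D2)"
    unfolding sum1 sum2 by (simp only: distrib_left add.commute)
  have "D1 \<notin> P (Suc 0)" unfolding D1_def
  proof (rule Cons.IH[of "\<lambda>i. P (Suc i)"])
    show "primeideal (P (Suc i)) (mpoly_ring V)" if "i \<le> length gs" for i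
      using Cons.prems(1)[of "Suc i"] that by simp
    show "P (Suc i) \<subseteq> P (Suc (Suc i)) \<and> gs ! i \<in> P (Suc (Suc i)) - P (Suc i)" if "i < length gs" for i
      using Cons.prems(2)[of "Suc i"] that by simp
    show "finite T" using Cons.prems(3) by (simp add: T_def A1_def)
    show "T \<noteq> {}" using as0 by (auto simp: T_def A1_def)
    fix bs assume "bs \<in> T"
    then obtain as where as: "as \<in> A" "hd as = m" "bs = tl as" by (auto simp: T_def A1_def)
    then have "m # bs \<in> A" using A_form(1)[of as] by simp
    then show "length bs = length gs \<and> c (m # bs) \<noteq> 0" using Cons.prems(5)[of "m # bs"] by simp
  qed
  then have "D1 + g * D2 \<notin> P (Suc 0)"
    using mpoly_idealD(5)[OF mpoly_primeD(1)[OF prime(2)], of "D1 + g * D2" "g * D2"]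
      mpoly_idealD(4)[OF mpoly_primeD(1)[OF prime(2)] D2carr g(2)] by (auto simp: mult.commute)
  then have "D1 + g * D2 \<notin> P 0" using g(1) by blast
  then have "g ^ m * (D1 + g * D2) \<notin> P 0"
    using mpoly_primeD(3)[OF prime(1) mpoly_power_carrier[OF gcarr]
        mpoly_carrier_closed(1)[OF D1carr mpoly_carrier_closed(2)[OF gcarr D2carr]]]
      prime_power_notin[OF prime(1) gcarr g(3)] by blast
  then show ?case unfolding sum .
qed

text \<open>The monomials in the indeterminates \<open>Z\<close> with all exponents at most \<open>D\<close>, and the polynomials
  that are composed of them.\<close>

definition bounded_monomials :: "indet set \<Rightarrow> nat \<Rightarrow> (indet \<Rightarrow>\<^sub>0 nat) set" where
  "bounded_monomials Z D = {m. Poly_Mapping.keys m \<subseteq> Z \<and> (\<forall>v. Poly_Mapping.lookup m v \<le> D)}"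

lemma card_bounded_monomials:
  assumes "finite Z"
  shows "finite (bounded_monomials Z D)" "card (bounded_monomials Z D) \<le> Suc D ^ card Z"
proof -
  let ?f = "\<lambda>m. restrict (Poly_Mapping.lookup m) Z"
  have inj: "inj_on ?f (bounded_monomials Z D)"
  proof (rule inj_onI)
    fix m m' :: "indet \<Rightarrow>\<^sub>0 nat"
    assume m: "m \<in> bounded_monomials Z D" "m' \<in> bounded_monomials Z D" and eq: "?f m = ?f m'"
    show "m = m'"
    proof (rule poly_mapping_eqI)
      fix v show "Poly_Mapping.lookup m v = Poly_Mapping.lookup m' v"
      proof (cases "v \<in> Z")
        case True
        then show ?thesis using fun_cong[OF eq, of v] by simp
      next
        case False
        then have "v \<notin> Poly_Mapping.keys m" "v \<notin> Poly_Mapping.keys m'"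
          using m by (auto simp: bounded_monomials_def)
        then show ?thesis by (simp add: in_keys_iff)
      qed
    qed
  qed
  have sub: "?f ` bounded_monomials Z D \<subseteq> (\<Pi>\<^sub>E v\<in>Z. {..D})"
    by (auto simp: bounded_monomials_def)
  have fin: "finite (\<Pi>\<^sub>E v\<in>Z. {..D})" using assms by (intro finite_PiE) auto
  show "finite (bounded_monomials Z D)" using inj_on_finite[OF inj sub fin] .
  have "card (bounded_monomials Z D) \<le> card (\<Pi>\<^sub>E v\<in>Z. {..D})"
    using card_inj_on_le[OF inj sub fin] .
  then show "card (bounded_monomials Z D) \<le> Suc D ^ card Z"
    using assms by (simp add: card_PiE)
qed

definition bounded_poly :: "indet set \<Rightarrow> nat \<Rightarrow> 'k::field mpoly \<Rightarrow> bool" where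
  "bounded_poly Z D p \<longleftrightarrow> Poly_Mapping.keys p \<subseteq> bounded_monomials Z D"

lemma bounded_poly_mono: "bounded_poly Z D p \<Longrightarrow> D \<le> D' \<Longrightarrow> bounded_poly Z D' p"
  unfolding bounded_poly_def bounded_monomials_def by (auto intro: order_trans)

lemma bounded_poly_mult:
  fixes p q :: "'k::field mpoly"
  assumes "bounded_poly Z D p" "bounded_poly Z D' q"
  shows "bounded_poly Z (D + D') (p * q)"
  unfolding bounded_poly_def
proof
  fix m assume "m \<in> Poly_Mapping.keys (p * q)"
  then obtain a b where ab: "a \<in> Poly_Mapping.keys p" "b \<in> Poly_Mapping.keys q" "m = a + b"
    using Poly_Mapping.keys_mult[of p q] by blast
  then have "a \<in> bounded_monomials Z D" "b \<in> bounded_monomials Z D'"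
    using assms by (auto simp: bounded_poly_def)
  then show "m \<in> bounded_monomials Z (D + D')"
    unfolding ab(3) bounded_monomials_def by (auto simp: keys_plus_nat lookup_add intro: add_mono)
qed

lemma bounded_poly_one: "bounded_poly Z D (1 :: 'k::field mpoly)"
  by (simp add: bounded_poly_def bounded_monomials_def)

lemma bounded_poly_power:
  fixes p :: "'k::field mpoly"
  shows "bounded_poly Z D p \<Longrightarrow> bounded_poly Z (a * D) (p ^ a)"
  by (induction a) (auto intro: bounded_poly_mult bounded_poly_one)

lemma bounded_poly_power_prod:
  fixes gs :: "'k::field mpoly list"
  assumes "\<And>g. g \<in> set gs \<Longrightarrow> bounded_poly Z D g" "\<And>a. a \<in> set as \<Longrightarrow> a \<le> N"
  shows "bounded_poly Z (length gs * (N * D)) (power_prod gs as)"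
  using assms
proof (induction gs as rule: power_prod.induct)
  case (1 g gs a as)
  have "bounded_poly Z (a * D) (g ^ a)" using 1 by (intro bounded_poly_power) simp
  then have "bounded_poly Z (N * D) (g ^ a)" using 1(3)[of a] by (elim bounded_poly_mono) simp
  moreover have "bounded_poly Z (length gs * (N * D)) (power_prod gs as)" using 1 by simp
  ultimately show ?case using bounded_poly_mult[of Z "N * D" "g ^ a"] by fastforce
qed (auto intro: bounded_poly_one)

lemma bounded_poly_exists:
  fixes p :: "'k::field mpoly"
  assumes "p \<in> carrier (mpoly_ring Z)"
  shows "\<exists>D. bounded_poly Z D p"
proof
  define D where "D = (\<Sum>m\<in>Poly_Mapping.keys p. \<Sum>v\<in>Poly_Mapping.keys m. Poly_Mapping.lookup m v)"
  have "Poly_Mapping.lookup m v \<le> D" if m: "m \<in> Poly_Mapping.keys p" for m v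
  proof (cases "v \<in> Poly_Mapping.keys m")
    case True
    then have "Poly_Mapping.lookup m v \<le> (\<Sum>v\<in>Poly_Mapping.keys m. Poly_Mapping.lookup m v)"
      by (intro member_le_sum) auto
    also have "\<dots> \<le> D" unfolding D_def
      by (rule member_le_sum[OF m, of "\<lambda>m. \<Sum>v\<in>Poly_Mapping.keys m. Poly_Mapping.lookup m v"]) auto
    finally show ?thesis .
  qed (simp add: in_keys_iff)
  then show "bounded_poly Z D p"
    using assms by (auto simp: bounded_poly_def bounded_monomials_def mpoly_carrier_iff)
qed

lemma bounded_poly_list_exists:
  fixes gs :: "'k::field mpoly list"
  assumes "set gs \<subseteq> carrier (mpoly_ring Z)"
  shows "\<exists>D. \<forall>g\<in>set gs. bounded_poly Z D g"
  using assms
proof (induction gs)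
  case (Cons g gs)
  then obtain D where D: "\<forall>h\<in>set gs. bounded_poly Z D h" by auto
  obtain D' where "bounded_poly Z D' g" using bounded_poly_exists[of g Z] Cons.prems by auto
  then have "\<forall>h\<in>set (g # gs). bounded_poly Z (max D D') h"
    using D by (auto intro: bounded_poly_mono)
  then show ?case by blast
qed simp

lemma vector_space_mpoly:
  "vector_space (\<lambda>(c::'k::field) (p::'k mpoly). Poly_Mapping.single 0 c * p)"
  by unfold_locales (auto simp: distrib_left distrib_right single_add mult.assoc[symmetric] mult_single)

text \<open>Counting monomials: the power products of more than \<open>|Z|\<close> polynomials in the indeterminates
  \<open>Z\<close> are linearly dependent, because there are more of them than monomials of
  comparable degree.\<close>

lemma power_prod_dependent:
  fixes gs :: "'k::field mpoly list"
  assumes Z: "finite Z" and len: "card Z < length gs" and gs: "set gs \<subseteq> carrier (mpoly_ring Z)"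
  obtains A c where "finite A" "A \<noteq> {}" "\<And>as. as \<in> A \<Longrightarrow> length as = length gs \<and> c as \<noteq> 0"
    "(\<Sum>as\<in>A. Poly_Mapping.single 0 (c as) * power_prod gs as) = 0"
proof -
  interpret vs: vector_space "\<lambda>(c::'k) (p::'k mpoly). Poly_Mapping.single 0 c * p"
    by (rule vector_space_mpoly)
  define n where "n = card Z"
  obtain D where D: "\<And>g. g \<in> set gs \<Longrightarrow> bounded_poly Z D g"
    using bounded_poly_list_exists[OF gs] by blast
  \<comment> \<open>Exponents up to \<open>N\<close> give monomials with exponents up to \<open>E\<close>, which is less than
      \<open>(N + 1) * K\<close>; the choice of \<open>N\<close> makes \<open>(N + 1)^(n + 1)\<close> exceed \<open>((N + 1) * K)^n\<close>.\<close>
  define K where "K = length gs * D + 1"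
  define N where "N = K ^ n"
  define E where "E = length gs * (N * D)"
  define L where "L = {as. set as \<subseteq> {..N} \<and> length as = length gs}"
  define S where "S = power_prod gs ` L"
  define B where "B = (\<lambda>m. Poly_Mapping.single m (1::'k)) ` bounded_monomials Z E"
  have finB: "finite B" and cardB: "card B \<le> Suc E ^ n"
    unfolding B_def n_def using card_bounded_monomials[OF Z, of E] card_image_le le_trans by blast+
  have finL: "finite L" and cardL: "card L = Suc N ^ length gs"
    unfolding L_def using finite_lists_length_eq[of "{..N}"] card_lists_length_eq[of "{..N}"] by simp_all
  have "Suc E \<le> Suc N * K"
    by (simp add: E_def K_def algebra_simps)
  then have "Suc E ^ n \<le> (Suc N * K) ^ n" by (rule power_mono) simp
  also have "\<dots> = Suc N ^ n * N" by (simp only: power_mult_distrib N_def)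
  also have "\<dots> < Suc N ^ n * Suc N" by simp
  also have "\<dots> = Suc N ^ Suc n" by simp
  also have "\<dots> \<le> Suc N ^ length gs" using len by (intro power_increasing) (auto simp: n_def)
  finally have more: "card B < card L" using cardB cardL by linarith
  have span: "S \<subseteq> vs.span B"
  proof
    fix p assume "p \<in> S"
    then obtain as where as: "as \<in> L" "p = power_prod gs as" by (auto simp: S_def)
    have "bounded_poly Z E p"
      unfolding as(2) E_def using as(1) by (intro bounded_poly_power_prod D) (auto simp: L_def)
    then have mon: "Poly_Mapping.single m 1 \<in> B" if "m \<in> Poly_Mapping.keys p" for m
      using that by (auto simp: bounded_poly_def B_def)
    have "p = (\<Sum>m\<in>Poly_Mapping.keys p. Poly_Mapping.single 0 (Poly_Mapping.lookup p m) * Poly_Mapping.single m 1)"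
      using sum_single_keys[of p] by (simp add: mult_single)
    also have "\<dots> \<in> vs.span B"
      by (intro vs.span_sum vs.span_scale vs.span_base mon)
    finally show "p \<in> vs.span B" .
  qed
  show thesis
  proof (cases "inj_on (power_prod gs) L")
    case False
    then obtain as bs where ab: "as \<in> L" "bs \<in> L" "as \<noteq> bs" "power_prod gs as = power_prod gs bs"
      by (auto simp: inj_on_def)
    show thesis
      by (rule that[of "{as, bs}" "\<lambda>xs. if xs = as then 1 else - 1"])
        (use ab in \<open>auto simp: L_def single_uminus\<close>)
  next
    case True
    have "card S = card L" unfolding S_def by (rule card_image[OF True])
    then have "\<not> vs.independent S"
      using vs.independent_span_bound[OF finB _ span] more by auto
    then obtain S' u v where S': "S' \<subseteq> S" "finite S'"
      "(\<Sum>v\<in>S'. Poly_Mapping.single 0 (u v) * v) = 0" and v: "v \<in> S'" "u v \<noteq> 0"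
      unfolding vs.independent_explicit_finite_subsets by blast
    define A where "A = {as \<in> L. power_prod gs as \<in> S' \<and> u (power_prod gs as) \<noteq> 0}"
    show thesis
    proof (rule that[of A "\<lambda>as. u (power_prod gs as)"])
      show "finite A" using finL by (simp add: A_def)
      show "A \<noteq> {}" using v S'(1) by (auto simp: A_def S_def)
      show "length as = length gs \<and> u (power_prod gs as) \<noteq> 0" if "as \<in> A" for as
        using that by (simp add: A_def L_def)
      have inj: "inj_on (power_prod gs) A" using True by (auto simp: A_def inj_on_def)
      have "(\<Sum>as\<in>A. Poly_Mapping.single 0 (u (power_prod gs as)) * power_prod gs as)
          = (\<Sum>v\<in>power_prod gs ` A. Poly_Mapping.single 0 (u v) * v)"
        by (simp add: sum.reindex[OF inj])
      also have "\<dots> = (\<Sum>v\<in>S'. Poly_Mapping.single 0 (u v) * v)"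
      proof (rule sum.mono_neutral_left[OF S'(2)])
        show "power_prod gs ` A \<subseteq> S'" by (auto simp: A_def)
        show "\<forall>v\<in>S' - power_prod gs ` A. Poly_Mapping.single 0 (u v) * v = 0"
        proof
          fix v assume v: "v \<in> S' - power_prod gs ` A"
          then obtain as where "as \<in> L" "v = power_prod gs as" using S'(1) by (auto simp: S_def)
          then have "u v = 0" using v by (auto simp: A_def)
          then show "Poly_Mapping.single 0 (u v) * v = 0" by simp
        qed
      qed
      finally show "(\<Sum>as\<in>A. Poly_Mapping.single 0 (u (power_prod gs as)) * power_prod gs as) = 0"
        using S'(3) by simp
    qed
  qed
qed

lemma prime_chain_length_le:
  fixes P :: "nat \<Rightarrow> 'k::field mpoly set"
  assumes V: "finite V" and prime: "\<And>i. i \<le> d \<Longrightarrow> primeideal (P i) (mpoly_ring V)"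
    and strict: "\<And>i. i < d \<Longrightarrow> P i \<subset> P (Suc i)"
  shows "d \<le> card (V - {v \<in> V. mvar v \<in> P 0})"
proof (rule ccontr)
  define W where "W = {v \<in> V. mvar v \<in> P 0}"
  define n where "n = card (V - W)"
  assume "\<not> ?thesis"
  then have d: "n < d" by (simp add: n_def W_def)
  obtain f where f: "\<And>i. i < d \<Longrightarrow> f i \<in> P (Suc i) - P i"
  proof (rule that)
    show "(SOME x. x \<in> P (Suc i) - P i) \<in> P (Suc i) - P i" if "i < d" for i
      using psubset_imp_ex_mem[OF strict[OF that]] by (rule someI_ex)
  qed
  have carr: "f i \<in> carrier (mpoly_ring V)" if "i < d" for i
    using mpoly_idealD(1)[OF mpoly_primeD(1)[OF prime[of "Suc i"]]] f[OF that] that by auto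
  have P0: "P 0 \<subseteq> P i" if "i \<le> d" for i
    using that
  proof (induction i)
    case (Suc i)
    then show ?case using strict[of i] by auto
  qed simp
  have "var_ideal V W \<subseteq> P 0"
    by (rule var_ideal_minimal[OF mpoly_primeD(1)[OF prime]]) (auto simp: W_def)
  moreover have "f i - avoiding W (f i) \<in> var_ideal V W" if "i < d" for i
  proof -
    have "avoiding W (f i) \<in> carrier (mpoly_ring V)"
      using avoiding_carrier[OF carr[OF that]] by (auto simp: mpoly_carrier_iff)
    moreover have "avoiding W (f i - avoiding W (f i)) = 0"
      by (rule poly_mapping_eqI) (auto simp: lookup_avoiding lookup_minus)
    ultimately show ?thesis
      using carr[OF that] by (simp add: var_ideal_iff_avoiding mpoly_carrier_closed)
  qed
  ultimately have diff: "f i - avoiding W (f i) \<in> P j" if "i < d" "j \<le> d" for i j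
    using that P0 by blast
  have g: "avoiding W (f i) \<in> P (Suc i) - P i" if i: "i < d" for i
  proof -
    have "f i \<in> P (Suc i)" "f i - avoiding W (f i) \<in> P (Suc i)"
      using f[OF i] diff[OF i, of "Suc i"] i by auto
    then have "f i - (f i - avoiding W (f i)) \<in> P (Suc i)"
      by (rule mpoly_idealD(5)[OF mpoly_primeD(1)[OF prime[OF Suc_leI[OF i]]]])
    moreover have "avoiding W (f i) \<notin> P i"
    proof
      assume "avoiding W (f i) \<in> P i"
      then have "avoiding W (f i) + (f i - avoiding W (f i)) \<in> P i"
        using diff[OF i, of i] i by (intro mpoly_idealD(3)[OF mpoly_primeD(1)[OF prime[of i]]]) auto
      then show False using f[OF i] by simp
    qed
    ultimately show ?thesis by (simp only: diff_diff_eq2 add_diff_cancel_left' Diff_iff) simp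
  qed
  define gs where "gs = map (\<lambda>i. avoiding W (f i)) [0..<Suc n]"
  have len: "length gs = Suc n" by (simp add: gs_def)
  have nth: "gs ! i = avoiding W (f i)" if "i < Suc n" for i
    using that by (simp add: gs_def del: upt_Suc)
  have "set gs \<subseteq> carrier (mpoly_ring (V - W))"
    unfolding gs_def using d avoiding_carrier[OF carr] by auto
  then obtain A c where A: "finite A" "A \<noteq> {}" "\<And>as. as \<in> A \<Longrightarrow> length as = length gs \<and> c as \<noteq> 0"
    and zero: "(\<Sum>as\<in>A. Poly_Mapping.single 0 (c as) * power_prod gs as) = 0"
    using power_prod_dependent[of "V - W" gs] V len by (auto simp: n_def)
  have "(\<Sum>as\<in>A. Poly_Mapping.single 0 (c as) * power_prod gs as) \<notin> P 0"
  proof (rule chain_witnesses_independent[of gs P V, OF _ _ A])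
    show "primeideal (P i) (mpoly_ring V)" if "i \<le> length gs" for i
      using prime d that len by simp
    show "P i \<subseteq> P (Suc i) \<and> gs ! i \<in> P (Suc i) - P i" if "i < length gs" for i
      using strict[of i] g[of i] nth[of i] that d len by auto
  qed
  then show False
    using zero mpoly_idealD(2)[OF mpoly_primeD(1)[OF prime[of 0]]] by simp
qed

section \<open>Edge ideals and vertex covers\<close>

text \<open>A graph on the set \<open>V\<close> of indeterminates is given by a set \<open>E\<close> of edges, each with an arbitrary
  orientation.\<close>

definition edge_ideal :: "indet set \<Rightarrow> (indet \<times> indet) set \<Rightarrow> 'k::field mpoly set" where
  "edge_ideal V E = Idl\<^bsub>mpoly_ring V\<^esub> {mvar u * mvar v | u v. (u, v) \<in> E}"

text \<open>A cover is a set of vertices that contains an end of every edge; minimality refers to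
  inclusion.\<close>

definition vertex_cover :: "'a set \<Rightarrow> ('a \<times> 'a) set \<Rightarrow> 'a set \<Rightarrow> bool" where
  "vertex_cover V E C \<longleftrightarrow> C \<subseteq> V \<and> (\<forall>(u, v)\<in>E. u \<in> C \<or> v \<in> C)"

definition min_vertex_cover :: "'a set \<Rightarrow> ('a \<times> 'a) set \<Rightarrow> 'a set \<Rightarrow> bool" where
  "min_vertex_cover V E C \<longleftrightarrow> vertex_cover V E C \<and> (\<forall>D. vertex_cover V E D \<longrightarrow> D \<subseteq> C \<longrightarrow> D = C)"

text \<open>All minimal vertex covers have the same size. For finite \<open>V\<close> this means that all maximal
  independent sets have the same size, which is the usual definition of well-covered graphs.\<close>

definition well_covered :: "'a set \<Rightarrow> ('a \<times> 'a) set \<Rightarrow> bool" where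
  "well_covered V E \<longleftrightarrow>
     (\<forall>C D. min_vertex_cover V E C \<longrightarrow> min_vertex_cover V E D \<longrightarrow> card C = card D)"

lemma vertex_cover_contains_minimal:
  assumes "finite V" "vertex_cover V E C"
  obtains D where "min_vertex_cover V E D" "D \<subseteq> C"
proof -
  have "{D. vertex_cover V E D \<and> D \<subseteq> C} \<subseteq> Pow V" by (auto simp: vertex_cover_def)
  then have "finite {D. vertex_cover V E D \<and> D \<subseteq> C}"
    using assms(1) by (simp add: finite_subset)
  then obtain D where "D \<in> {D. vertex_cover V E D \<and> D \<subseteq> C}"
    "\<forall>D'\<in>{D. vertex_cover V E D \<and> D \<subseteq> C}. D' \<subseteq> D \<longrightarrow> D = D'"
    using assms(2) finite_has_minimal[of "{D. vertex_cover V E D \<and> D \<subseteq> C}"] by auto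
  then show thesis
    by (intro that[of D]) (auto simp: min_vertex_cover_def)
qed

lemma edge_divides_monomial:
  fixes m :: "indet \<Rightarrow>\<^sub>0 nat"
  assumes "u \<noteq> v" "u \<in> Poly_Mapping.keys m" "v \<in> Poly_Mapping.keys m"
  obtains m' where "m = m' + (Poly_Mapping.single u 1 + Poly_Mapping.single v 1)"
proof
  show "m = (m - (Poly_Mapping.single u 1 + Poly_Mapping.single v 1)) +
      (Poly_Mapping.single u 1 + Poly_Mapping.single v 1)"
    using assms by (intro poly_mapping_eqI)
      (auto simp: lookup_add lookup_minus lookup_single when_def in_keys_iff)
qed

lemma edge_ideal_iff:
  fixes p :: "'k::field mpoly"
  assumes E: "E \<subseteq> V \<times> V" "\<forall>(u, v)\<in>E. u \<noteq> v"
  shows "p \<in> edge_ideal V E \<longleftrightarrow> p \<in> carrier (mpoly_ring V) \<and>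
    (\<forall>m\<in>Poly_Mapping.keys p. \<exists>(u, v)\<in>E. u \<in> Poly_Mapping.keys m \<and> v \<in> Poly_Mapping.keys m)"
    (is "_ \<longleftrightarrow> p \<in> _ \<and> (\<forall>m\<in>_. ?div m)")
proof -
  interpret ring "mpoly_ring V :: 'k mpoly ring" by (rule ring_mpoly_ring)
  let ?G = "{mvar u * mvar v :: 'k mpoly | u v. (u, v) \<in> E}"
  have "mvar u * mvar v \<in> carrier (mpoly_ring V)" if "(u, v) \<in> E" for u v
    using E(1) that by (intro mpoly_carrier_closed mvar_carrier) auto
  then have gens: "?G \<subseteq> carrier (mpoly_ring V)" by blast
  have I: "ideal (edge_ideal V E :: 'k mpoly set) (mpoly_ring V)"
    unfolding edge_ideal_def by (rule genideal_ideal[OF gens])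
  let ?M = "{p :: 'k mpoly. p \<in> carrier (mpoly_ring V) \<and> (\<forall>m\<in>Poly_Mapping.keys p. ?div m)}"
  have "edge_ideal V E \<subseteq> ?M" unfolding edge_ideal_def
  proof (rule genideal_minimal)
    show "ideal ?M (mpoly_ring V)"
    proof (rule mpoly_idealI)
      fix p q :: "'k mpoly" assume "p \<in> ?M" "q \<in> ?M"
      then show "p + q \<in> ?M"
        using Poly_Mapping.keys_add[of p q] by (auto simp: mpoly_carrier_closed)
    next
      fix r p :: "'k mpoly" assume r: "r \<in> carrier (mpoly_ring V)" and p: "p \<in> ?M"
      have "?div m" if m: "m \<in> Poly_Mapping.keys (r * p)" for m
      proof -
        obtain a b where ab: "b \<in> Poly_Mapping.keys p" "m = a + b"
          using m Poly_Mapping.keys_mult[of r p] by blast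
        then have "?div b" using p by simp
        then show ?thesis unfolding ab(2) keys_plus_nat by blast
      qed
      then show "r * p \<in> ?M" using r p by (simp add: mpoly_carrier_closed)
    qed auto
    have "?div m" if "(u, v) \<in> E" "m \<in> Poly_Mapping.keys (mvar u * mvar v :: 'k mpoly)" for u v m
      using that by (intro bexI[of _ "(u, v)"]) (auto simp: mvar_single keys_plus_nat)
    then show "?G \<subseteq> ?M"
      using gens by blast
  qed
  moreover have "?M \<subseteq> edge_ideal V E"
  proof
    fix p assume p: "p \<in> ?M"
    have "Poly_Mapping.single m (Poly_Mapping.lookup p m) \<in> (edge_ideal V E :: 'k mpoly set)"
      if m: "m \<in> Poly_Mapping.keys p" for m
    proof -
      have "?div m" using p m by simp
      then obtain u v where uv: "(u, v) \<in> E" "u \<in> Poly_Mapping.keys m" "v \<in> Poly_Mapping.keys m"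
        by blast
      have "u \<noteq> v" using E(2) uv(1) by blast
      then obtain m' where m': "m = m' + (Poly_Mapping.single u 1 + Poly_Mapping.single v 1)"
        using edge_divides_monomial uv(2,3) by blast
      have "Poly_Mapping.keys m \<subseteq> V" using p m by (auto simp: mpoly_carrier_iff)
      then have "Poly_Mapping.keys m' \<subseteq> V" unfolding m' by (simp add: keys_plus_nat)
      moreover have "mvar u * mvar v \<in> (edge_ideal V E :: 'k mpoly set)"
        unfolding edge_ideal_def using genideal_self[OF gens] uv(1) by blast
      ultimately show ?thesis
        unfolding m' single_plus_mult[of m'] mvar_single by (intro mpoly_idealD(4)[OF I] single_carrier)
    qed
    then have "(\<Sum>m\<in>Poly_Mapping.keys p. Poly_Mapping.single m (Poly_Mapping.lookup p m)) \<in> (edge_ideal V E :: 'k mpoly set)"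
      by (intro ideal_sum_mem[OF I])
    then show "p \<in> edge_ideal V E" using sum_single_keys[of p] by simp
  qed
  ultimately show ?thesis by blast
qed

lemma ideal_edge_ideal:
  assumes "E \<subseteq> V \<times> V"
  shows "ideal (edge_ideal V E :: 'k::field mpoly set) (mpoly_ring V)"
proof -
  interpret ring "mpoly_ring V :: 'k mpoly ring" by (rule ring_mpoly_ring)
  show ?thesis unfolding edge_ideal_def
    using assms by (intro genideal_ideal) (auto intro!: mpoly_carrier_closed mvar_carrier)
qed

text \<open>The edge ideal is the intersection of the prime ideals of the vertex covers: the indeterminates
  of a monomial that contains no edge form an independent set, whose complement is a cover.\<close>

lemma edge_ideal_iff_covers:
  fixes p :: "'k::field mpoly"
  assumes E: "E \<subseteq> V \<times> V" "\<forall>(u, v)\<in>E. u \<noteq> v"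
  shows "p \<in> edge_ideal V E \<longleftrightarrow>
    p \<in> carrier (mpoly_ring V) \<and> (\<forall>C. vertex_cover V E C \<longrightarrow> p \<in> var_ideal V C)"
    (is "?l \<longleftrightarrow> ?r")
proof
  assume ?l
  then have p: "p \<in> carrier (mpoly_ring V)" and
    dvd: "\<And>m. m \<in> Poly_Mapping.keys p \<Longrightarrow>
      \<exists>(u, v)\<in>E. u \<in> Poly_Mapping.keys m \<and> v \<in> Poly_Mapping.keys m"
    using edge_ideal_iff[OF E] by blast+
  have "p \<in> var_ideal V C" if C: "vertex_cover V E C" for C
    unfolding var_ideal_def using p dvd C by (fastforce simp: vertex_cover_def)
  then show ?r using p by blast
next
  assume r: ?r
  have "\<exists>(u, v)\<in>E. u \<in> Poly_Mapping.keys m \<and> v \<in> Poly_Mapping.keys m"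
    if m: "m \<in> Poly_Mapping.keys p" for m
  proof (rule ccontr)
    assume no: "\<not> ?thesis"
    then have "vertex_cover V E (V - Poly_Mapping.keys m)"
      using E(1) by (auto simp: vertex_cover_def)
    then have "p \<in> var_ideal V (V - Poly_Mapping.keys m)" using r by blast
    then show False using m by (auto simp: var_ideal_def)
  qed
  then show ?l using r edge_ideal_iff[OF E] by blast
qed

lemma prod_mvar:
  assumes "finite A"
  shows "\<exists>m. Poly_Mapping.keys m = A \<and> (\<Prod>v\<in>A. mvar v) = (Poly_Mapping.single m 1 :: 'k::field mpoly)"
  using assms
proof (induction A)
  case empty
  show ?case by (rule exI[of _ 0]) simp
next
  case (insert v A)
  then obtain m where "Poly_Mapping.keys m = A" "(\<Prod>v\<in>A. mvar v) = (Poly_Mapping.single m 1 :: 'k mpoly)"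
    by blast
  then show ?case using insert
    by (intro exI[of _ "Poly_Mapping.single v 1 + m"]) (auto simp: keys_plus_nat mvar_def mult_single)
qed

lemma prod_mvar_in_var_ideal:
  assumes "finite A" "A \<subseteq> V"
  shows "(\<Prod>v\<in>A. mvar v :: 'k::field mpoly) \<in> var_ideal V C \<longleftrightarrow> A \<inter> C \<noteq> {}"
    "(\<Prod>v\<in>A. mvar v :: 'k mpoly) \<in> carrier (mpoly_ring V)"
proof -
  obtain m where "Poly_Mapping.keys m = A" "(\<Prod>v\<in>A. mvar v) = (Poly_Mapping.single m 1 :: 'k mpoly)"
    using prod_mvar[OF assms(1)] by blast
  then show "(\<Prod>v\<in>A. mvar v :: 'k mpoly) \<in> var_ideal V C \<longleftrightarrow> A \<inter> C \<noteq> {}"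
    "(\<Prod>v\<in>A. mvar v :: 'k mpoly) \<in> carrier (mpoly_ring V)"
    using assms(2) by (simp_all add: var_ideal_def mpoly_carrier_iff)
qed

lemma prod_mvar_notin_prime:
  fixes P :: "'k::field mpoly set"
  assumes P: "primeideal P (mpoly_ring V)" and A: "finite A" "A \<subseteq> V" "\<And>v. v \<in> A \<Longrightarrow> mvar v \<notin> P"
  shows "(\<Prod>v\<in>A. mvar v) \<notin> P"
  using A
proof (induction A)
  case empty
  then show ?case using mpoly_primeD(2)[OF P] by simp
next
  case (insert v A)
  then show ?case
    using mpoly_primeD(3)[OF P mvar_carrier[of v] prod_mvar_in_var_ideal(2)[of A V]] by auto
qed

section \<open>Associated primes of edge ideals\<close>

lemma associated_primes_iff_colon:
  assumes "cring R" "ideal I R"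
  shows "P \<in> associated_primes R I \<longleftrightarrow> primeideal P R \<and>
    (\<exists>f\<in>carrier R. P = {r \<in> carrier R. r \<otimes>\<^bsub>R\<^esub> f \<in> I})"
proof -
  interpret R: cring R by fact
  interpret I: ideal I R by fact
  have mult: "(I +>\<^bsub>R\<^esub> r) \<otimes>\<^bsub>R Quot I\<^esub> (I +>\<^bsub>R\<^esub> f) = I +>\<^bsub>R\<^esub> (r \<otimes>\<^bsub>R\<^esub> f)"
    if "r \<in> carrier R" "f \<in> carrier R" for r f
    using I.rcoset_mult_add[OF that] by (simp add: FactRing_def)
  have zero: "I +>\<^bsub>R\<^esub> x = \<zero>\<^bsub>R Quot I\<^esub> \<longleftrightarrow> x \<in> I" if "x \<in> carrier R" for x
    using I.rcos_const_imp_mem[OF that] R.a_rcos_zero[OF assms(2), of x]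
    unfolding FactRing_def ring_record_simps by (rule iffI)
  have *: "{r \<in> carrier R. (I +>\<^bsub>R\<^esub> r) \<otimes>\<^bsub>R Quot I\<^esub> (I +>\<^bsub>R\<^esub> f) = \<zero>\<^bsub>R Quot I\<^esub>} =
      {r \<in> carrier R. r \<otimes>\<^bsub>R\<^esub> f \<in> I}" if f: "f \<in> carrier R" for f
    using mult[OF _ f] zero[OF R.m_closed[OF _ f]] by (intro Collect_cong conj_cong refl) simp
  have "carrier (R Quot I) = (+>\<^bsub>R\<^esub>) I ` carrier R"
    unfolding FactRing_def A_RCOSETS_def' ring_record_simps partial_object.simps by (rule UNION_singleton_eq_range)
  then have "(\<exists>u\<in>carrier (R Quot I). P = {r \<in> carrier R. (I +>\<^bsub>R\<^esub> r) \<otimes>\<^bsub>R Quot I\<^esub> u = \<zero>\<^bsub>R Quot I\<^esub>})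
      \<longleftrightarrow> (\<exists>f\<in>carrier R. P = {r \<in> carrier R. r \<otimes>\<^bsub>R\<^esub> f \<in> I})"
    using * by (simp only: bex_simps) (intro bex_cong refl, simp)
  then show ?thesis unfolding associated_primes_def by simp
qed

text \<open>An associated prime \<open>I : f\<close> is the intersection of the primes of the covers that do not contain
  \<open>f\<close>, hence equal to one of them. The prime of a minimal cover is obtained with the product of the
  indeterminates outside the cover as \<open>f\<close>.\<close>

lemma associated_primes_edge_ideal:
  assumes V: "finite V" and E: "E \<subseteq> V \<times> V" "\<forall>(u, v)\<in>E. u \<noteq> v"
  shows "associated_primes (mpoly_ring V) (edge_ideal V E :: 'k::field mpoly set) =
    var_ideal V ` {C. min_vertex_cover V E C}"
proof -
  let ?R = "mpoly_ring V :: 'k mpoly ring"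
  let ?I = "edge_ideal V E :: 'k mpoly set"
  note prime_var = primeideal_var_ideal[of V, where 'k = 'k]
  have colon: "{r \<in> carrier ?R. r * f \<in> ?I} =
      {r \<in> carrier ?R. \<forall>C. vertex_cover V E C \<longrightarrow> f \<notin> var_ideal V C \<longrightarrow> r \<in> var_ideal V C}"
    if f: "f \<in> carrier ?R" for f
  proof -
    have "r * f \<in> var_ideal V C \<longleftrightarrow> r \<in> var_ideal V C \<or> f \<in> var_ideal V C"
      if "r \<in> carrier ?R" for r C
      using that f by (simp add: var_ideal_iff_avoiding avoiding_mult mpoly_carrier_closed)
    then show ?thesis
      unfolding edge_ideal_iff_covers[OF E] using f by (auto simp: mpoly_carrier_closed)
  qed
  note assoc = associated_primes_iff_colon[OF cring_mpoly_ring ideal_edge_ideal[OF E(1)],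
      unfolded mpoly_ring_simps]
  show ?thesis
  proof (intro equalityI subsetI)
    fix P assume "P \<in> associated_primes ?R ?I"
    then obtain f where P: "primeideal P ?R" and f: "f \<in> carrier ?R" and
      P_eq: "P = {r \<in> carrier ?R. \<forall>C. vertex_cover V E C \<longrightarrow> f \<notin> var_ideal V C \<longrightarrow> r \<in> var_ideal V C}"
      unfolding assoc using colon by blast
    define W where "W = {v \<in> V. mvar v \<in> P}"
    have "W \<subseteq> V" by (auto simp: W_def)
    have W_le: "W \<subseteq> C" if "vertex_cover V E C" "f \<notin> var_ideal V C" for C
    proof
      fix v assume v: "v \<in> W"
      then have "(mvar v :: 'k mpoly) \<in> var_ideal V C" using that P_eq by (auto simp: W_def)
      then show "v \<in> C" using v by (simp add: W_def mvar_in_var_ideal)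
    qed
    \<comment> \<open>This product singles out a cover that contains no indeterminate outside \<open>P\<close>.\<close>
    have "(\<Prod>v\<in>V - W. mvar v) \<notin> P"
      by (rule prod_mvar_notin_prime[OF P]) (use V in \<open>auto simp: W_def\<close>)
    then obtain C where C: "vertex_cover V E C" "f \<notin> var_ideal V C"
      "(\<Prod>v\<in>V - W. mvar v :: 'k mpoly) \<notin> var_ideal V C"
      using P_eq prod_mvar_in_var_ideal(2)[of "V - W" V, where 'k = 'k] V by auto
    then have "(V - W) \<inter> C = {}"
      using prod_mvar_in_var_ideal(1)[of "V - W" V C, where 'k = 'k] V by auto
    then have "C = W" using W_le[OF C(1,2)] C(1) by (auto simp: vertex_cover_def)
    have "P \<subseteq> var_ideal V W" using P_eq C \<open>C = W\<close> by blast
    moreover have "var_ideal V W \<subseteq> P"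
      by (rule var_ideal_minimal[OF mpoly_primeD(1)[OF P]]) (simp add: W_def)
    moreover have "min_vertex_cover V E W"
      unfolding min_vertex_cover_def
    proof (intro conjI allI impI)
      show "vertex_cover V E W" using C(1) \<open>C = W\<close> by simp
      fix D assume D: "vertex_cover V E D" "D \<subseteq> W"
      have "(var_ideal V D :: 'k mpoly set) \<subseteq> var_ideal V W"
        using D by (subst var_ideal_subset_iff) (auto simp: vertex_cover_def)
      then have "f \<notin> var_ideal V D" using C(2) \<open>C = W\<close> by blast
      then show "D = W" using W_le[OF D(1)] D(2) by blast
    qed
    ultimately show "P \<in> var_ideal V ` {C. min_vertex_cover V E C}" by blast
  next
    fix P assume "P \<in> (var_ideal V ` {C. min_vertex_cover V E C} :: 'k mpoly set set)"
    then obtain C where C: "min_vertex_cover V E C" and P: "P = var_ideal V C" by blast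
    define f where "f = (\<Prod>v\<in>V - C. mvar v :: 'k mpoly)"
    have f: "f \<in> carrier ?R" "\<And>D. f \<in> var_ideal V D \<longleftrightarrow> (V - C) \<inter> D \<noteq> {}"
      unfolding f_def using prod_mvar_in_var_ideal[of "V - C" V, where 'k = 'k] V by auto
    have only: "D = C" if "vertex_cover V E D" "f \<notin> var_ideal V D" for D
    proof -
      have "D \<subseteq> C" using that f(2)[of D] by (auto simp: vertex_cover_def)
      then show ?thesis using C that(1) by (auto simp: min_vertex_cover_def)
    qed
    have C': "vertex_cover V E C" "f \<notin> var_ideal V C"
      using C f(2)[of C] by (auto simp: min_vertex_cover_def)
    have "P = {r \<in> carrier ?R. r * f \<in> ?I}"
      unfolding colon[OF f(1)] P
    proof (intro equalityI subsetI)
      fix r :: "'k mpoly" assume r: "r \<in> var_ideal V C"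
      then have "r \<in> carrier ?R" by (simp add: var_ideal_def)
      moreover have "r \<in> var_ideal V D" if "vertex_cover V E D" "f \<notin> var_ideal V D" for D
        using only[OF that] r by simp
      ultimately show "r \<in> {r \<in> carrier ?R. \<forall>D. vertex_cover V E D \<longrightarrow> f \<notin> var_ideal V D \<longrightarrow> r \<in> var_ideal V D}"
        by simp
    qed (use C' in simp)
    then show "P \<in> associated_primes ?R ?I"
      unfolding assoc using f(1) prime_var[of C] P by (intro conjI bexI[of _ f]) simp_all
  qed
qed

section \<open>Dimensions and unmixedness of edge ideals\<close>

text \<open>The dimension is attained by a chain that starts at the prime of \<open>C\<close> and adjoins one indeterminate
  after the other.\<close>

lemma krull_dim_quotient_eq:
  fixes I :: "'k::field mpoly set"
  assumes V: "finite V" and I: "ideal I (mpoly_ring V)"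
    and C: "C \<subseteq> V" "I \<subseteq> var_ideal V C"
    and min: "\<And>P. primeideal P (mpoly_ring V) \<Longrightarrow> I \<subseteq> P \<Longrightarrow> card C \<le> card {v \<in> V. mvar v \<in> P}"
  shows "krull_dim (mpoly_ring V Quot I) = enat (card V - card C)"
proof -
  let ?n = "card V - card C"
  let ?S = "{enat d | d. \<exists>P :: nat \<Rightarrow> 'k mpoly set.
      (\<forall>i\<le>d. primeideal (P i) (mpoly_ring V) \<and> I \<subseteq> P i) \<and> (\<forall>i<d. P i \<subset> P (Suc i))}"
  obtain xs where xs: "set xs = V - C" "distinct xs"
    using finite_distinct_list[of "V - C"] V by auto
  have len: "length xs = ?n"
    using distinct_card[OF xs(2)] xs(1) card_Diff_subset[OF finite_subset[OF C(1) V] C(1)] by simp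
  let ?P = "\<lambda>i. var_ideal V (C \<union> set (take i xs)) :: 'k mpoly set"
  have sub: "C \<union> set (take i xs) \<subseteq> V" for i
    using C(1) xs(1) set_take_subset[of i xs] by blast
  have "?P i \<subset> ?P (Suc i)" if i: "i < ?n" for i
  proof -
    have i': "i < length xs" using i len by simp
    have "xs ! i \<notin> set (take i xs)"
      using xs(2) i' by (auto simp: distinct_conv_nth in_set_conv_nth)
    moreover have "xs ! i \<notin> C" using i' xs(1) nth_mem by blast
    ultimately have "C \<union> set (take i xs) \<subset> C \<union> set (take (Suc i) xs)"
      using i' by (auto simp: take_Suc_conv_app_nth)
    then show ?thesis
      unfolding less_le_not_le var_ideal_subset_iff[OF sub] .
  qed
  moreover have "I \<subseteq> ?P i" for i
  proof -
    have "(var_ideal V C :: 'k mpoly set) \<subseteq> ?P i" unfolding var_ideal_subset_iff[OF C(1)] by simp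
    with C(2) show ?thesis by (rule subset_trans)
  qed
  ultimately have "\<exists>P :: nat \<Rightarrow> 'k mpoly set.
      (\<forall>i\<le>?n. primeideal (P i) (mpoly_ring V) \<and> I \<subseteq> P i) \<and> (\<forall>i<?n. P i \<subset> P (Suc i))"
    by (intro exI[of _ ?P]) (simp add: primeideal_var_ideal)
  then have "enat ?n \<in> ?S" by blast
  then have lower: "enat ?n \<le> Sup ?S" by (rule Sup_upper)
  have "Sup ?S \<le> enat ?n"
  proof (rule Sup_least)
    fix e assume "e \<in> ?S"
    then obtain d P where e: "e = enat d" and P: "\<And>i. i \<le> d \<Longrightarrow> primeideal (P i) (mpoly_ring V)"
      "\<And>i. i \<le> d \<Longrightarrow> I \<subseteq> (P i :: 'k mpoly set)" "\<And>i. i < d \<Longrightarrow> P i \<subset> P (Suc i)"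
      by blast
    have "d \<le> card (V - {v \<in> V. mvar v \<in> P 0})"
      by (rule prime_chain_length_le[OF V]) (simp_all add: P)
    also have "\<dots> = card V - card {v \<in> V. mvar v \<in> P 0}"
      using V by (intro card_Diff_subset) auto
    also have "\<dots> \<le> ?n"
      using min[OF P(1,2)[of 0]] by simp
    finally show "e \<le> enat ?n" unfolding e by simp
  qed
  then show ?thesis
    unfolding krull_dim_quotient[OF cring_mpoly_ring I] using lower by (rule antisym)
qed

theorem unmixed_edge_ideal_iff:
  assumes V: "finite V" and E: "E \<subseteq> V \<times> V" "\<forall>(u, v)\<in>E. u \<noteq> v"
  shows "unmixed_ideal (mpoly_ring V) (edge_ideal V E :: 'k::field mpoly set) \<longleftrightarrow> well_covered V E"
proof -
  let ?R = "mpoly_ring V :: 'k mpoly ring"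
  let ?I = "edge_ideal V E :: 'k mpoly set"
  have cover_V: "vertex_cover V E V" using E(1) by (auto simp: vertex_cover_def)
  obtain C0 where C0: "vertex_cover V E C0" "\<And>C. vertex_cover V E C \<Longrightarrow> card C0 \<le> card C"
    using ex_has_least_nat[of "vertex_cover V E" V card] cover_V by blast
  have card_le: "card C \<le> card V" if "vertex_cover V E C" for C
    using that V by (auto simp: vertex_cover_def intro: card_mono)
  have "min_vertex_cover V E C0"
    unfolding min_vertex_cover_def
  proof (intro conjI allI impI)
    fix D assume D: "vertex_cover V E D" "D \<subseteq> C0"
    have "finite C0" using C0(1) V by (auto simp: vertex_cover_def intro: finite_subset)
    then show "D = C0" using C0(2)[OF D(1)] D(2) by (intro card_seteq)
  qed (rule C0(1))
  have dimI: "krull_dim (?R Quot ?I) = enat (card V - card C0)"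
  proof (rule krull_dim_quotient_eq[OF V ideal_edge_ideal[OF E(1)]])
    show "C0 \<subseteq> V" using C0(1) by (simp add: vertex_cover_def)
    show "?I \<subseteq> var_ideal V C0"
      using edge_ideal_iff_covers[OF E] C0(1) by blast
    fix P :: "'k mpoly set" assume P: "primeideal P (mpoly_ring V)" "?I \<subseteq> P"
    show "card C0 \<le> card {v \<in> V. mvar v \<in> P}"
    proof (rule C0(2))
      have "mvar u \<in> P \<or> mvar v \<in> P" if uv: "(u, v) \<in> E" for u v
      proof (rule mpoly_primeD(3)[OF P(1)])
        show "mvar u \<in> carrier ?R" "mvar v \<in> carrier ?R" using uv E(1) by (auto intro: mvar_carrier)
        then have "mvar u * mvar v \<in> carrier ?R" by (rule mpoly_carrier_closed(2))
        moreover have "\<exists>(u', v')\<in>E. u' \<in> Poly_Mapping.keys m \<and> v' \<in> Poly_Mapping.keys m"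
          if "m \<in> Poly_Mapping.keys (mvar u * mvar v :: 'k mpoly)" for m
          using that uv by (intro bexI[of _ "(u, v)"]) (auto simp: mvar_single keys_plus_nat)
        ultimately have "mvar u * mvar v \<in> ?I"
          by (simp add: edge_ideal_iff[OF E])
        then show "mvar u * mvar v \<in> P" using P(2) by blast
      qed
      then show "vertex_cover V E {v \<in> V. mvar v \<in> P}"
        using E(1) by (auto simp: vertex_cover_def)
    qed
  qed
  have dimC: "krull_dim (?R Quot var_ideal V C) = enat (card V - card C)" if C: "vertex_cover V E C" for C
  proof (rule krull_dim_quotient_eq[OF V mpoly_primeD(1)[OF primeideal_var_ideal]])
    show "C \<subseteq> V" using C by (simp add: vertex_cover_def)
    fix P :: "'k mpoly set" assume P: "var_ideal V C \<subseteq> P"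
    have "mvar v \<in> P" if "v \<in> C" for v
    proof -
      have "(mvar v :: 'k mpoly) \<in> var_ideal V C" using that \<open>C \<subseteq> V\<close> by (subst mvar_in_var_ideal) auto
      then show ?thesis using P by blast
    qed
    then show "card C \<le> card {v \<in> V. mvar v \<in> P}"
      using \<open>C \<subseteq> V\<close> V by (intro card_mono) auto
  qed simp
  have "unmixed_ideal ?R ?I \<longleftrightarrow> (\<forall>C. min_vertex_cover V E C \<longrightarrow> card V - card C = card V - card C0)"
    unfolding unmixed_ideal_def associated_primes_edge_ideal[OF V E] dimI
    using dimC by (auto simp: min_vertex_cover_def)
  also have "\<dots> \<longleftrightarrow> (\<forall>C. min_vertex_cover V E C \<longrightarrow> card C = card C0)"
    using card_le C0(1) by (metis diff_diff_cancel min_vertex_cover_def)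
  also have "\<dots> \<longleftrightarrow> well_covered V E"
    unfolding well_covered_def using \<open>min_vertex_cover V E C0\<close> by metis
  finally show ?thesis .
qed

section \<open>Unmixed bipartite graphs\<close>

text \<open>Consider a bipartite graph with a perfect matching that joins \<open>x k\<close> to \<open>y k\<close>. Every cover contains
  one end of each matching edge, so its size is the number of matching edges plus the
  number of matching edges that it contains entirely. A minimal cover contains no matching edge
  entirely if adjacency is transitive; conversely, a failure of transitivity yields a cover that has to
  contain one.\<close>

lemma well_covered_iff_transitive:
  fixes x y :: "'i \<Rightarrow> 'a"
  assumes I: "finite I" and inj: "inj_on x I" "inj_on y I" and disj: "x ` I \<inter> y ` I = {}"
    and refl: "\<And>k. k \<in> I \<Longrightarrow> R k k"
  defines "V \<equiv> x ` I \<union> y ` I" and "E \<equiv> {(x k, y l) | k l. k \<in> I \<and> l \<in> I \<and> R k l}"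
  shows "well_covered V E \<longleftrightarrow> (\<forall>k\<in>I. \<forall>l\<in>I. \<forall>s\<in>I. R k l \<longrightarrow> R l s \<longrightarrow> R k s)"
proof -
  have cover_iff: "vertex_cover V E C \<longleftrightarrow>
      C \<subseteq> V \<and> (\<forall>k\<in>I. \<forall>l\<in>I. R k l \<longrightarrow> x k \<in> C \<or> y l \<in> C)" for C
    unfolding vertex_cover_def E_def by fastforce
  have card: "card C = card I + card {k \<in> I. x k \<in> C \<and> y k \<in> C}" if C: "vertex_cover V E C" for C
  proof -
    let ?A = "{k \<in> I. x k \<in> C}" and ?B = "{k \<in> I. y k \<in> C}"
    have "C \<subseteq> x ` I \<union> y ` I" using C unfolding cover_iff unfolding V_def by blast
    then have "C = x ` ?A \<union> y ` ?B" by blast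
    then have "card C = card (x ` ?A) + card (y ` ?B)"
      using I disj card_Un_disjoint[of "x ` ?A" "y ` ?B"] by auto
    also have "\<dots> = card ?A + card ?B"
      using inj by (simp add: card_image inj_on_subset[of _ I])
    also have "\<dots> = card (?A \<union> ?B) + card (?A \<inter> ?B)"
      using I by (intro card_Un_Int) auto
    also have "?A \<union> ?B = I" using C refl by (auto simp: cover_iff)
    also have "?A \<inter> ?B = {k \<in> I. x k \<in> C \<and> y k \<in> C}" by auto
    finally show ?thesis .
  qed
  show ?thesis
  proof
    assume trans: "\<forall>k\<in>I. \<forall>l\<in>I. \<forall>s\<in>I. R k l \<longrightarrow> R l s \<longrightarrow> R k s"
    have "card C = card I" if C: "min_vertex_cover V E C" for C
    proof -
      have cover: "vertex_cover V E C" and min: "\<And>D. vertex_cover V E D \<Longrightarrow> D \<subseteq> C \<Longrightarrow> D = C"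
        using C by (auto simp: min_vertex_cover_def)
      have False if k: "k \<in> I" "x k \<in> C" "y k \<in> C" for k
      proof -
        have C': "C \<subseteq> V" "\<And>k l. k \<in> I \<Longrightarrow> l \<in> I \<Longrightarrow> R k l \<Longrightarrow> x k \<in> C \<or> y l \<in> C"
          using cover by (auto simp: cover_iff)
        have "\<not> vertex_cover V E (C - {x k})" using min[of "C - {x k}"] k by auto
        then obtain k' l where l: "k' \<in> I" "l \<in> I" "R k' l" "x k' \<notin> C - {x k}" "y l \<notin> C - {x k}"
          unfolding cover_iff using C'(1) by blast
        have "y l \<noteq> x k" using disj l(2) k(1) by blast
        then have "y l \<notin> C" using l(5) by simp
        moreover from this have "x k' = x k" using C'(2)[OF l(1-3)] l(4) by simp
        then have "k' = k" by (rule inj_onD[OF inj(1) _ l(1) k(1)])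
        ultimately have l: "l \<in> I" "R k l" "y l \<notin> C" using l by simp_all
        have "\<not> vertex_cover V E (C - {y k})" using min[of "C - {y k}"] k by auto
        then obtain s k' where s: "s \<in> I" "k' \<in> I" "R s k'" "x s \<notin> C - {y k}" "y k' \<notin> C - {y k}"
          unfolding cover_iff using C'(1) by blast
        have "x s \<noteq> y k" using disj s(1) k(1) by blast
        then have "x s \<notin> C" using s(4) by simp
        moreover from this have "y k' = y k" using C'(2)[OF s(1-3)] s(5) by simp
        then have "k' = k" by (rule inj_onD[OF inj(2) _ s(2) k(1)])
        ultimately have s: "s \<in> I" "R s k" "x s \<notin> C" using s by simp_all
        have "R s l" using trans s l k(1) by blast
        then show False using C'(2)[OF s(1) l(1)] s(3) l(3) by blast
      qed
      then have "{k \<in> I. x k \<in> C \<and> y k \<in> C} = {}" by blast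
      then show ?thesis using card[OF cover] by (simp only: card.empty add_0_right)
    qed
    then show "well_covered V E" by (simp add: well_covered_def)
  next
    assume wc: "well_covered V E"
    have minX: "min_vertex_cover V E (x ` I)"
      unfolding min_vertex_cover_def
    proof (intro conjI allI impI)
      show "vertex_cover V E (x ` I)" unfolding cover_iff unfolding V_def by blast
      fix D assume D: "vertex_cover V E D" "D \<subseteq> x ` I"
      have "x k \<in> D" if "k \<in> I" for k
      proof -
        have "x k \<in> D \<or> y k \<in> D" using D(1) refl that by (auto simp: cover_iff)
        moreover have "y k \<notin> D" using D(2) disj that by blast
        ultimately show ?thesis by blast
      qed
      then show "D = x ` I" using D(2) by blast
    qed
    have size: "card C = card I" if "min_vertex_cover V E C" for C
    proof -
      have "card C = card (x ` I)" using wc that minX unfolding well_covered_def by blast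
      then show ?thesis using card_image[OF inj(1)] by simp
    qed
    show "\<forall>k\<in>I. \<forall>l\<in>I. \<forall>s\<in>I. R k l \<longrightarrow> R l s \<longrightarrow> R k s"
    proof (intro ballI impI, rule ccontr)
      fix k l s assume kls: "k \<in> I" "l \<in> I" "s \<in> I" "R k l" "R l s" "\<not> R k s"
      have "vertex_cover V E (V - {x k, y s})"
        unfolding cover_iff
      proof (intro conjI ballI impI)
        fix k' l' assume kl: "k' \<in> I" "l' \<in> I" "R k' l'"
        have "x k' \<in> V" "y l' \<in> V" "x k' \<noteq> y s" "y l' \<noteq> x k"
          using kl kls disj by (auto simp: V_def)
        moreover have "\<not> (x k' = x k \<and> y l' = y s)"
          using kl kls inj_onD[OF inj(1), of k' k] inj_onD[OF inj(2), of l' s] by blast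
        ultimately show "x k' \<in> V - {x k, y s} \<or> y l' \<in> V - {x k, y s}" by blast
      qed blast
      then obtain C where C: "min_vertex_cover V E C" "C \<subseteq> V - {x k, y s}"
        using vertex_cover_contains_minimal[of V] I by (auto simp: V_def)
      then have cover: "vertex_cover V E C" by (simp add: min_vertex_cover_def)
      have "y l \<in> C" "x l \<in> C" using cover kls C(2) unfolding cover_iff by blast+
      then have "{l} \<subseteq> {k \<in> I. x k \<in> C \<and> y k \<in> C}" using kls by blast
      then have "card {k \<in> I. x k \<in> C \<and> y k \<in> C} \<noteq> 0"
        using I by auto
      then show False using size[OF C(1)] card[OF cover] by simp
    qed
  qed
qed

section \<open>Diagrams cut along an antidiagonal\<close>

text \<open>The part of the square with rows \<open>a, \<dots>, q\<close> and antidiagonal \<open>i + j = c\<close> that is left when some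
  of its blocks are cut off. A box in row \<open>k\<close> is written \<open>(k, c - l)\<close>, so that the
  boxes with \<open>k = l\<close> form the antidiagonal. An element \<open>z\<close> of \<open>U\<close> removes
  the boxes with \<open>l \<le> z < k\<close>, which is a rectangle below the antidiagonal, and an element
  \<open>z\<close> of \<open>L\<close> the rectangle \<open>k \<le> z < l\<close> above it.\<close>

definition cut_diagram :: "int \<Rightarrow> int \<Rightarrow> int \<Rightarrow> int set \<Rightarrow> int set \<Rightarrow> box set" where
  "cut_diagram c a q U L = {(k, j). a \<le> k \<and> k \<le> q \<and> a \<le> c - j \<and> c - j \<le> q \<and>
     (\<forall>z\<in>U. \<not> (c - j \<le> z \<and> z < k)) \<and> (\<forall>z\<in>L. \<not> (k \<le> z \<and> z < c - j))}"

lemma cut_diagram_iff: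
  "(k, j) \<in> cut_diagram c a q U L \<longleftrightarrow> a \<le> k \<and> k \<le> q \<and> a \<le> c - j \<and> c - j \<le> q \<and>
     (\<forall>z\<in>U. \<not> (c - j \<le> z \<and> z < k)) \<and> (\<forall>z\<in>L. \<not> (k \<le> z \<and> z < c - j))"
  by (simp add: cut_diagram_def)

lemma cut_diagram_refl: "a \<le> k \<Longrightarrow> k \<le> q \<Longrightarrow> (k, c - k) \<in> cut_diagram c a q U L"
  by (auto simp: cut_diagram_iff)

lemma cut_diagram_trans:
  assumes "(k, c - l) \<in> cut_diagram c a q U L" "(l, c - s) \<in> cut_diagram c a q U L"
  shows "(k, c - s) \<in> cut_diagram c a q U L"
  using assms unfolding cut_diagram_iff by (auto; smt (verit))

text \<open>A reflexive and transitive relation with convex rows and columns is determined by the pairs of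
  neighbours that it does not contain.\<close>

lemma cut_diagram_of_preorder:
  fixes D :: "box set"
  assumes range: "\<And>k j. (k, j) \<in> D \<Longrightarrow> a \<le> k \<and> k \<le> q \<and> a \<le> c - j \<and> c - j \<le> q"
    and refl: "\<And>k. a \<le> k \<Longrightarrow> k \<le> q \<Longrightarrow> (k, c - k) \<in> D"
    and trans: "\<And>k l s. (k, c - l) \<in> D \<Longrightarrow> (l, c - s) \<in> D \<Longrightarrow> (k, c - s) \<in> D"
    and row: "\<And>k j j' j''. (k, j) \<in> D \<Longrightarrow> (k, j'') \<in> D \<Longrightarrow> j \<le> j' \<Longrightarrow> j' \<le> j'' \<Longrightarrow> (k, j') \<in> D"
    and col: "\<And>j k k' k''. (k, j) \<in> D \<Longrightarrow> (k'', j) \<in> D \<Longrightarrow> k \<le> k' \<Longrightarrow> k' \<le> k'' \<Longrightarrow> (k', j) \<in> D"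
  shows "D = cut_diagram c a q {z \<in> {a..<q}. (z + 1, c - z) \<notin> D} {z \<in> {a..<q}. (z, c - (z + 1)) \<notin> D}"
    (is "D = cut_diagram c a q ?U ?L")
proof -
  let ?C = "cut_diagram c a q ?U ?L"
  have mem: "(k, c - l) \<in> D \<longleftrightarrow> (k, c - l) \<in> ?C" if kl: "a \<le> k" "k \<le> q" "a \<le> l" "l \<le> q" for k l
  proof -
    consider "k = l" | "k < l" | "l < k" by linarith
    then show ?thesis
    proof cases
      case 1
      then show ?thesis using refl kl by (simp add: cut_diagram_refl)
    next
      case 2
      have "(z, c - (z + 1)) \<in> D" if D: "(k, c - l) \<in> D" and z: "k \<le> z" "z < l" for z
      proof -
        have "(k, c - (z + 1)) \<in> D"
          using row[OF D refl[OF kl(1,2)], of "c - (z + 1)"] z by simp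
        then show ?thesis
          using col[of k "c - (z + 1)" "z + 1" z] refl[of "z + 1"] z kl by simp
      qed
      moreover have "(k, c - l) \<in> D" if z: "\<And>z. k \<le> z \<Longrightarrow> z < l \<Longrightarrow> (z, c - (z + 1)) \<in> D"
      proof -
        have "(k, c - l') \<in> D" if "k \<le> l'" "l' \<le> l" for l'
          using that
        proof (induction l' rule: int_ge_induct)
          case base
          then show ?case using refl kl by simp
        next
          case (step i)
          then show ?case using trans[of k i "i + 1"] z[of i] by simp
        qed
        then show ?thesis using 2 by simp
      qed
      ultimately have "(k, c - l) \<in> D \<longleftrightarrow> (\<forall>z. k \<le> z \<and> z < l \<longrightarrow> (z, c - (z + 1)) \<in> D)" by blast
      moreover have "z \<in> {a..<q}" if "k \<le> z" "z < l" for z using that kl by simp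
      then have "(\<forall>z. k \<le> z \<and> z < l \<longrightarrow> (z, c - (z + 1)) \<in> D) \<longleftrightarrow> (\<forall>z\<in>?L. \<not> (k \<le> z \<and> z < l))"
        by blast
      moreover have "\<forall>z\<in>?U. \<not> (l \<le> z \<and> z < k)" using 2 by auto
      ultimately show ?thesis using kl by (simp add: cut_diagram_iff)
    next
      case 3
      have "(z + 1, c - z) \<in> D" if D: "(k, c - l) \<in> D" and z: "l \<le> z" "z < k" for z
      proof -
        have "(k, c - z) \<in> D"
          using row[OF refl[OF kl(1,2)] D, of "c - z"] z by simp
        then show ?thesis
          using col[of z "c - z" k "z + 1"] refl[of z] z kl by simp
      qed
      moreover have "(k, c - l) \<in> D" if z: "\<And>z. l \<le> z \<Longrightarrow> z < k \<Longrightarrow> (z + 1, c - z) \<in> D"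
      proof -
        have "(k', c - l) \<in> D" if "l \<le> k'" "k' \<le> k" for k'
          using that
        proof (induction k' rule: int_ge_induct)
          case base
          then show ?case using refl kl by simp
        next
          case (step i)
          then show ?case using trans[of "i + 1" i l] z[of i] by simp
        qed
        then show ?thesis using 3 by simp
      qed
      ultimately have "(k, c - l) \<in> D \<longleftrightarrow> (\<forall>z. l \<le> z \<and> z < k \<longrightarrow> (z + 1, c - z) \<in> D)" by blast
      moreover have "z \<in> {a..<q}" if "l \<le> z" "z < k" for z using that kl by simp
      then have "(\<forall>z. l \<le> z \<and> z < k \<longrightarrow> (z + 1, c - z) \<in> D) \<longleftrightarrow> (\<forall>z\<in>?U. \<not> (l \<le> z \<and> z < k))"
        by blast
      moreover have "\<forall>z\<in>?L. \<not> (k \<le> z \<and> z < l)" using 3 by auto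
      ultimately show ?thesis using kl by (simp add: cut_diagram_iff)
    qed
  qed
  have iff: "(k, j) \<in> D \<longleftrightarrow> (k, j) \<in> ?C" for k j
    using range[of k j] mem[of k "c - j"] by (auto simp: cut_diagram_iff)
  show ?thesis
    by (intro equalityI subrelI) (erule iffD1[OF iff], erule iffD2[OF iff])
qed

section \<open>Unmixed skew shapes\<close>

lemma diagram_iff:
  "(i, j) \<in> diagram lam mu \<longleftrightarrow> 1 \<le> i \<and> i \<le> int (length lam) \<and>
     int (mu ! nat (i - 1)) < j \<and> j \<le> int (lam ! nat (i - 1))"
proof
  assume "1 \<le> i \<and> i \<le> int (length lam) \<and> int (mu ! nat (i - 1)) < j \<and> j \<le> int (lam ! nat (i - 1))"
  then have "i = int (nat i)" "j = int (nat j)" "1 \<le> nat i" "nat i \<le> length lam"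
    "mu ! (nat i - 1) + 1 \<le> nat j" "nat j \<le> lam ! (nat i - 1)"
    by (auto simp: nat_diff_distrib)
  then show "(i, j) \<in> diagram lam mu" unfolding diagram_def by blast
qed (auto simp: diagram_def nat_diff_distrib)

lemma skew_shapeD:
  assumes "skew_shape lam mu"
  shows "0 < length lam" "length mu = length lam"
    "i \<le> k \<Longrightarrow> k < length lam \<Longrightarrow> lam ! k \<le> lam ! i"
    "i \<le> k \<Longrightarrow> k < length lam \<Longrightarrow> mu ! k \<le> mu ! i"
    "i < length lam \<Longrightarrow> mu ! i < lam ! i" "mu ! (length lam - 1) = 0"
proof -
  show "0 < length lam" "length mu = length lam" "i < length lam \<Longrightarrow> mu ! i < lam ! i"
    using assms by (auto simp: skew_shape_def)
  have "mu \<noteq> []" using assms by (auto simp: skew_shape_def)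
  then show "mu ! (length lam - 1) = 0"
    using assms last_conv_nth[of mu] by (metis skew_shape_def)
  show "i \<le> k \<Longrightarrow> k < length lam \<Longrightarrow> lam ! k \<le> lam ! i"
    using assms by (cases "i = k") (auto simp: skew_shape_def sorted_wrt_iff_nth_less)
  show "i \<le> k \<Longrightarrow> k < length lam \<Longrightarrow> mu ! k \<le> mu ! i"
    using assms by (cases "i = k") (auto simp: skew_shape_def sorted_wrt_iff_nth_less)
qed

lemma diagram_bounds:
  assumes "skew_shape lam mu" "(i, j) \<in> diagram lam mu"
  shows "1 \<le> i" "i \<le> int (length lam)" "1 \<le> j" "j \<le> int (hd lam)"
proof -
  show i: "1 \<le> i" "i \<le> int (length lam)" "1 \<le> j" using assms(2) by (auto simp: diagram_iff)
  have "lam ! nat (i - 1) \<le> lam ! 0" using skew_shapeD(3)[OF assms(1), of 0 "nat (i - 1)"] i by simp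
  moreover have "hd lam = lam ! 0" using skew_shapeD(1)[OF assms(1)] by (simp add: hd_conv_nth)
  ultimately show "j \<le> int (hd lam)" using assms(2) by (simp add: diagram_iff)
qed

lemma diagram_row_convex:
  assumes "(i, j) \<in> diagram lam mu" "(i, j'') \<in> diagram lam mu" "j \<le> j'" "j' \<le> j''"
  shows "(i, j') \<in> diagram lam mu"
  using assms by (auto simp: diagram_iff)

lemma diagram_column_convex:
  assumes "skew_shape lam mu" "(i, j) \<in> diagram lam mu" "(i'', j) \<in> diagram lam mu" "i \<le> i'" "i' \<le> i''"
  shows "(i', j) \<in> diagram lam mu"
proof -
  have "lam ! nat (i'' - 1) \<le> lam ! nat (i' - 1)" "mu ! nat (i' - 1) \<le> mu ! nat (i - 1)"
    using assms(2-) by (auto simp: diagram_iff nat_less_iff intro!: skew_shapeD(3,4)[OF assms(1)])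
  then show ?thesis using assms(2-) by (auto simp: diagram_iff)
qed

text \<open>The boxes as edges, each directed from its row to its column.\<close>

definition skew_edges :: "nat list \<Rightarrow> nat list \<Rightarrow> (indet \<times> indet) set" where
  "skew_edges lam mu = {(XVar i, YVar j) | i j. (int i, int j) \<in> diagram lam mu}"

lemma skew_unmixed_iff:
  assumes "skew_shape lam mu"
  shows "skew_unmixed (K :: 'k::field itself) lam mu \<longleftrightarrow> well_covered (skew_vars lam) (skew_edges lam mu)"
proof -
  have ideal: "skew_ferrers_ideal lam mu = (edge_ideal (skew_vars lam) (skew_edges lam mu) :: 'k mpoly set)"
    unfolding skew_ferrers_ideal_def edge_ideal_def skew_edges_def
    by (rule arg_cong[where f = "genideal _"]) auto
  have "skew_edges lam mu \<subseteq> skew_vars lam \<times> skew_vars lam"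
    using diagram_bounds[OF assms] by (fastforce simp: skew_edges_def skew_vars_def)
  then show ?thesis
    unfolding skew_unmixed_def ideal
    by (intro unmixed_edge_ideal_iff) (auto simp: skew_vars_def skew_edges_def)
qed

text \<open>The matching is given by the antidiagonal: row \<open>k\<close> is matched with column \<open>c - k\<close>.\<close>

lemma well_covered_skew_iff_transitive:
  assumes shape: "skew_shape lam mu" and square: "hd lam = length lam"
    and anti: "\<And>k. 1 \<le> k \<Longrightarrow> k \<le> int (length lam) \<Longrightarrow> (k, int (length lam) + 1 - k) \<in> diagram lam mu"
  defines "c \<equiv> int (length lam) + 1"
  shows "well_covered (skew_vars lam) (skew_edges lam mu) \<longleftrightarrow>
    (\<forall>k l s. (k, c - l) \<in> diagram lam mu \<longrightarrow> (l, c - s) \<in> diagram lam mu \<longrightarrow> (k, c - s) \<in> diagram lam mu)"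
proof -
  define n where "n = length lam"
  let ?I = "{1..int n}" and ?x = "\<lambda>k. XVar (nat k)" and ?y = "\<lambda>l. YVar (nat (c - l))"
  let ?R = "\<lambda>k l. (k, c - l) \<in> diagram lam mu"
  have "well_covered (?x ` ?I \<union> ?y ` ?I) {(?x k, ?y l) | k l. k \<in> ?I \<and> l \<in> ?I \<and> ?R k l} \<longleftrightarrow>
      (\<forall>k\<in>?I. \<forall>l\<in>?I. \<forall>s\<in>?I. ?R k l \<longrightarrow> ?R l s \<longrightarrow> ?R k s)"
  proof (rule well_covered_iff_transitive)
    show "inj_on ?x ?I" by (auto simp: inj_on_def)
    show "inj_on ?y ?I" by (auto simp: inj_on_def c_def n_def)
  qed (use anti in \<open>auto simp: c_def n_def\<close>)
  also have "?x ` ?I \<union> ?y ` ?I = skew_vars lam"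
  proof -
    have "?x ` ?I = XVar ` {1..n}"
    proof -
      have "nat ` ?I = {1..n}"
        by (auto simp: image_iff) (metis atLeastAtMost_iff nat_int of_nat_1 of_nat_le_iff One_nat_def)
      then show ?thesis by (metis image_image)
    qed
    moreover have "?y ` ?I = YVar ` {1..n}"
    proof -
      have "(\<lambda>l. nat (c - l)) ` ?I = {1..n}"
      proof (intro equalityI subsetI)
        fix j assume "j \<in> {1..n}"
        then have "j = nat (c - (c - int j))" "c - int j \<in> ?I" by (auto simp: c_def n_def)
        then show "j \<in> (\<lambda>l. nat (c - l)) ` ?I" by blast
      qed (auto simp: c_def n_def)
      then show ?thesis by (metis image_image)
    qed
    ultimately show ?thesis using square by (simp add: skew_vars_def n_def)
  qed
  also have "{(?x k, ?y l) | k l. k \<in> ?I \<and> l \<in> ?I \<and> ?R k l} = skew_edges lam mu"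
  proof (intro equalityI subsetI)
    fix e assume "e \<in> {(?x k, ?y l) | k l. k \<in> ?I \<and> l \<in> ?I \<and> ?R k l}"
    then obtain k l where kl: "k \<in> ?I" "l \<in> ?I" "?R k l" "e = (?x k, ?y l)" by blast
    then have "(int (nat k), int (nat (c - l))) \<in> diagram lam mu" by (simp add: c_def n_def)
    then show "e \<in> skew_edges lam mu" using kl(4) unfolding skew_edges_def by blast
  next
    fix e assume "e \<in> skew_edges lam mu"
    then obtain i j where ij: "e = (XVar i, YVar j)" "(int i, int j) \<in> diagram lam mu"
      by (auto simp: skew_edges_def)
    have "int i \<in> ?I" "c - int j \<in> ?I"
      using diagram_bounds[OF shape ij(2)] square by (auto simp: n_def c_def)
    moreover have "e = (?x (int i), ?y (c - int j))" "?R (int i) (c - int j)" using ij by auto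
    ultimately show "e \<in> {(?x k, ?y l) | k l. k \<in> ?I \<and> l \<in> ?I \<and> ?R k l}" by blast
  qed
  also have "(\<forall>k\<in>?I. \<forall>l\<in>?I. \<forall>s\<in>?I. ?R k l \<longrightarrow> ?R l s \<longrightarrow> ?R k s) \<longleftrightarrow>
      (\<forall>k l s. ?R k l \<longrightarrow> ?R l s \<longrightarrow> ?R k s)"
  proof -
    have "k \<in> ?I \<and> l \<in> ?I" if "?R k l" for k l
      using diagram_bounds[OF shape that] square by (auto simp: n_def c_def)
    then show ?thesis by blast
  qed
  finally show ?thesis .
qed

text \<open>In a well-covered shape without empty columns the rows and the columns are minimal covers, so the
  shape fits into a square. A box missing on the antidiagonal would leave a cover by rows above
  and columns to the left of it, or by rows below and columns to the right of it,
  that is too small.\<close>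

lemma well_covered_skew_antidiagonal:
  assumes shape: "skew_shape lam mu"
    and cols: "\<forall>j. 1 \<le> j \<longrightarrow> j \<le> hd lam \<longrightarrow> (\<exists>i. (i, int j) \<in> diagram lam mu)"
    and wc: "well_covered (skew_vars lam) (skew_edges lam mu)"
  shows "hd lam = length lam"
    and "1 \<le> k \<Longrightarrow> k \<le> int (length lam) \<Longrightarrow> (k, int (length lam) + 1 - k) \<in> diagram lam mu"
proof -
  define n where "n = length lam"
  let ?V = "skew_vars lam" and ?E = "skew_edges lam mu"
  have cover_iff: "vertex_cover ?V ?E C \<longleftrightarrow> C \<subseteq> ?V \<and>
      (\<forall>i j. (int i, int j) \<in> diagram lam mu \<longrightarrow> XVar i \<in> C \<or> YVar j \<in> C)" for C
    unfolding vertex_cover_def skew_edges_def by fastforce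
  have bounds: "1 \<le> i \<and> i \<le> n \<and> 1 \<le> j \<and> j \<le> hd lam" if "(int i, int j) \<in> diagram lam mu" for i j
    using diagram_bounds[OF shape that] by (auto simp: n_def)
  have rows: "(int i, int (lam ! (i - 1))) \<in> diagram lam mu" if "1 \<le> i" "i \<le> n" for i
    using that skew_shapeD(5)[OF shape, of "i - 1"] by (simp add: diagram_iff n_def nat_diff_distrib)
  have X: "min_vertex_cover ?V ?E (XVar ` {1..n})"
    unfolding min_vertex_cover_def
  proof (intro conjI allI impI)
    show "vertex_cover ?V ?E (XVar ` {1..n})"
      unfolding cover_iff using bounds by (auto simp: skew_vars_def n_def)
    fix D assume D: "vertex_cover ?V ?E D" "D \<subseteq> XVar ` {1..n}"
    have "XVar i \<in> D" if "i \<in> {1..n}" for i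
    proof -
      have "YVar (lam ! (i - 1)) \<notin> D" using D(2) by auto
      then show ?thesis using D(1) rows[of i] that unfolding cover_iff by auto
    qed
    then show "D = XVar ` {1..n}" using D(2) by blast
  qed
  have Y: "min_vertex_cover ?V ?E (YVar ` {1..hd lam})"
    unfolding min_vertex_cover_def
  proof (intro conjI allI impI)
    show "vertex_cover ?V ?E (YVar ` {1..hd lam})"
      unfolding cover_iff using bounds by (auto simp: skew_vars_def)
    fix D assume D: "vertex_cover ?V ?E D" "D \<subseteq> YVar ` {1..hd lam}"
    have "YVar j \<in> D" if j: "j \<in> {1..hd lam}" for j
    proof -
      obtain i where i: "(i, int j) \<in> diagram lam mu" using cols j by (metis atLeastAtMost_iff)
      have "(int (nat i), int j) \<in> diagram lam mu" using i diagram_bounds(1)[OF shape i] by simp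
      moreover have "XVar (nat i) \<notin> D" using D(2) by auto
      ultimately show ?thesis using D(1) unfolding cover_iff by blast
    qed
    then show "D = YVar ` {1..hd lam}" using D(2) by blast
  qed
  have cardX: "card (XVar ` A) = card A" and cardY: "card (YVar ` A) = card A" for A
    by (simp_all add: card_image inj_on_def)
  show square: "hd lam = length lam"
    using wc X Y unfolding well_covered_def n_def by (metis cardX cardY card_atLeastAtMost diff_Suc_1)
  have large: "n \<le> card C" if C: "vertex_cover ?V ?E C" for C
  proof -
    have fin: "finite ?V" by (simp add: skew_vars_def)
    obtain D where D: "min_vertex_cover ?V ?E D" "D \<subseteq> C"
      using vertex_cover_contains_minimal[OF fin C] .
    have "card D = card (XVar ` {1..n})" using wc X D(1) unfolding well_covered_def by blast
    then have "n = card D" by (simp add: cardX)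
    also have "\<dots> \<le> card C"
      using D(2) C fin by (intro card_mono) (auto simp: vertex_cover_def intro: finite_subset)
    finally show ?thesis .
  qed
  have card2: "card (XVar ` A \<union> YVar ` B) \<le> card A + card B" for A B
    using card_Un_le[of "XVar ` A" "YVar ` B"] cardX cardY by simp
  assume k: "1 \<le> k" "k \<le> int (length lam)"
  define i where "i = nat k"
  have i: "1 \<le> i" "i \<le> n" "k = int i" using k by (auto simp: i_def n_def)
  have "n + 1 - i \<le> lam ! (i - 1)"
  proof -
    let ?C = "XVar ` {1..i - 1} \<union> YVar ` {1..lam ! (i - 1)}"
    have "vertex_cover ?V ?E ?C" unfolding cover_iff
    proof (intro conjI allI impI)
      have "lam ! (i - 1) \<le> lam ! 0" using i by (intro skew_shapeD(3)[OF shape]) (auto simp: n_def)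
      then show "?C \<subseteq> ?V" using i skew_shapeD(1)[OF shape]
        by (auto simp: skew_vars_def n_def hd_conv_nth)
      fix i' j' assume ij: "(int i', int j') \<in> diagram lam mu"
      show "XVar i' \<in> ?C \<or> YVar j' \<in> ?C"
      proof (cases "i' < i")
        case False
        then have "lam ! (i' - 1) \<le> lam ! (i - 1)"
          using bounds[OF ij] by (intro skew_shapeD(3)[OF shape]) (auto simp: n_def)
        then show ?thesis using ij bounds[OF ij] by (auto simp: diagram_iff nat_diff_distrib)
      qed (use bounds[OF ij] in auto)
    qed
    then have "n \<le> card {1..i - 1} + card {1..lam ! (i - 1)}"
      using large card2 order_trans by blast
    then show ?thesis using i by simp
  qed
  moreover have "mu ! (i - 1) < n + 1 - i"
  proof (rule ccontr)
    assume contra: "\<not> ?thesis"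
    let ?C = "XVar ` {i + 1..n} \<union> YVar ` {mu ! (i - 1) + 1..n}"
    have "vertex_cover ?V ?E ?C" unfolding cover_iff
    proof (intro conjI allI impI)
      show "?C \<subseteq> ?V" using i square by (auto simp: skew_vars_def n_def)
      fix i' j' assume ij: "(int i', int j') \<in> diagram lam mu"
      show "XVar i' \<in> ?C \<or> YVar j' \<in> ?C"
      proof (cases "i < i'")
        case False
        then have "mu ! (i - 1) \<le> mu ! (i' - 1)"
          using i bounds[OF ij] by (intro skew_shapeD(4)[OF shape]) (auto simp: n_def)
        then show ?thesis using ij bounds[OF ij] square by (auto simp: diagram_iff n_def nat_diff_distrib)
      qed (use bounds[OF ij] in auto)
    qed
    then have "n \<le> card {i + 1..n} + card {mu ! (i - 1) + 1..n}"
      using large card2 order_trans by blast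
    then show False using i contra by simp
  qed
  ultimately show "(k, int (length lam) + 1 - k) \<in> diagram lam mu"
    using i by (auto simp: diagram_iff n_def nat_diff_distrib)
qed

lemma well_covered_imp_cut_diagram:
  assumes shape: "skew_shape lam mu"
    and cols: "\<forall>j. 1 \<le> j \<longrightarrow> j \<le> hd lam \<longrightarrow> (\<exists>i. (i, int j) \<in> diagram lam mu)"
    and wc: "well_covered (skew_vars lam) (skew_edges lam mu)"
  defines "n \<equiv> int (length lam)"
  shows "diagram lam mu = cut_diagram (n + 1) 1 n
    {z \<in> {1..<n}. (z + 1, n + 1 - z) \<notin> diagram lam mu} {z \<in> {1..<n}. (z, n - z) \<notin> diagram lam mu}"
proof -
  note square = well_covered_skew_antidiagonal(1)[OF shape cols wc]
  note anti = well_covered_skew_antidiagonal(2)[OF shape cols wc]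
  have trans: "(k, n + 1 - s) \<in> diagram lam mu"
    if "(k, n + 1 - l) \<in> diagram lam mu" "(l, n + 1 - s) \<in> diagram lam mu" for k l s
    using well_covered_skew_iff_transitive[OF shape square anti] wc that unfolding n_def by blast
  have "diagram lam mu = cut_diagram (n + 1) 1 n
    {z \<in> {1..<n}. (z + 1, n + 1 - z) \<notin> diagram lam mu} {z \<in> {1..<n}. (z, n + 1 - (z + 1)) \<notin> diagram lam mu}"
  proof (rule cut_diagram_of_preorder)
    show "1 \<le> k \<and> k \<le> n \<and> 1 \<le> n + 1 - j \<and> n + 1 - j \<le> n" if "(k, j) \<in> diagram lam mu" for k j
      using diagram_bounds[OF shape that] square by (simp add: n_def)
    show "(k, n + 1 - k) \<in> diagram lam mu" if "1 \<le> k" "k \<le> n" for k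
      using anti that by (simp add: n_def)
  qed (use trans diagram_row_convex diagram_column_convex[OF shape] in blast)+
  then show ?thesis by simp
qed

lemma cut_diagram_imp_well_covered:
  assumes shape: "skew_shape lam mu" and eq: "diagram lam mu = cut_diagram c a q U L"
  shows "well_covered (skew_vars lam) (skew_edges lam mu)"
    and "c = int (length lam) + 1" "a = 1" "q = int (length lam)"
proof -
  define n where "n = int (length lam)"
  have n: "1 \<le> n" using skew_shapeD(1)[OF shape] unfolding n_def by linarith
  have row: "\<exists>j. (i, j) \<in> diagram lam mu" if "1 \<le> i" "i \<le> n" for i
    using that skew_shapeD(5)[OF shape, of "nat (i - 1)"]
    by (intro exI[of _ "int (lam ! nat (i - 1))"]) (auto simp: diagram_iff n_def)
  have sub: "a \<le> k \<and> k \<le> q" if "1 \<le> k" "k \<le> n" for k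
    using row[OF that] unfolding eq cut_diagram_iff by blast
  have sup: "1 \<le> k \<and> k \<le> n" if "a \<le> k" "k \<le> q" for k
    using cut_diagram_refl[OF that, of c U L] diagram_bounds(1,2)[OF shape, of k "c - k"]
    unfolding eq n_def by simp
  show a: "a = 1" and q: "q = int (length lam)"
    using sub[of 1] sub[of n] sup[of a] sup[of q] n by (auto simp: n_def)
  have "nat (n - 1) = length lam - 1" by (simp add: n_def)
  then have "(n, 1) \<in> diagram lam mu"
    using n skew_shapeD(1)[OF shape] skew_shapeD(5)[OF shape, of "length lam - 1"] skew_shapeD(6)[OF shape]
    by (simp add: diagram_iff n_def[symmetric])
  then have "c - 1 \<le> q" unfolding eq cut_diagram_iff by simp
  moreover have "1 \<le> c - q"
    using cut_diagram_refl[of a q q c U L] diagram_bounds(3)[OF shape, of q "c - q"] a q n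
    unfolding eq n_def by simp
  ultimately show c: "c = int (length lam) + 1" using q by simp
  have "(1, int (hd lam)) \<in> diagram lam mu"
    using skew_shapeD(1)[OF shape] skew_shapeD(5)[OF shape, of 0]
    by (simp add: diagram_iff hd_conv_nth Suc_le_eq)
  then have "int (hd lam) \<le> int (length lam)" unfolding eq cut_diagram_iff using a c by simp
  moreover have "int (length lam) \<le> int (hd lam)"
    using cut_diagram_refl[of a 1 q c U L] diagram_bounds(4)[OF shape, of 1 "c - 1"] a c q n
    unfolding eq n_def by simp
  ultimately have square: "hd lam = length lam" by simp
  show "well_covered (skew_vars lam) (skew_edges lam mu)"
  proof (subst well_covered_skew_iff_transitive[OF shape square])
    show "(k, int (length lam) + 1 - k) \<in> diagram lam mu" if "1 \<le> k" "k \<le> int (length lam)" for k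
      using cut_diagram_refl[of a k q c U L] that unfolding eq a q c by simp
    show "\<forall>k l s. (k, int (length lam) + 1 - l) \<in> diagram lam mu \<longrightarrow>
        (l, int (length lam) + 1 - s) \<in> diagram lam mu \<longrightarrow> (k, int (length lam) + 1 - s) \<in> diagram lam mu"
      unfolding eq c using cut_diagram_trans by blast
  qed
qed

section \<open>Connected skew shapes\<close>

text \<open>A set of vertices that is closed under adjacency and not empty contains all vertices.\<close>

lemma skew_connected_closed:
  assumes conn: "skew_connected lam mu" and u: "u \<in> skew_vars lam" "u \<in> A" and v: "v \<in> skew_vars lam"
    and closed: "\<And>i j. (int i, int j) \<in> diagram lam mu \<Longrightarrow> XVar i \<in> A \<longleftrightarrow> YVar j \<in> A"
  shows "v \<in> A"
proof -
  let ?G = "with_proj (skew_graph lam mu)"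
  let ?H = "mk_symmetric ?G"
  have sym: "arcs_ends ?G = parcs (skew_graph lam mu)" by (auto simp: arcs_ends_def arc_to_ends_def)
  have ends: "fst e \<in> A \<longleftrightarrow> snd e \<in> A" if "e \<in> arcs_ends ?H" for e
  proof -
    have "e \<in> arcs_ends ?G \<union> (arcs_ends ?G)\<inverse>"
      using that unfolding mk_symmetric_def by (auto simp: arcs_ends_def arc_to_ends_def)
    then show ?thesis
      unfolding sym using closed by (auto simp: skew_graph_def)
  qed
  have "(u, v) \<in> rtrancl_on (verts ?H) (arcs_ends ?H)"
    using conn u(1) v unfolding skew_connected_def Digraph_Component.connected_def
      strongly_connected_def reachable_def by (auto simp: skew_graph_def mk_symmetric_def)
  then show ?thesis using u(2)
  proof (induction rule: rtrancl_on_induct)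
    case (step y z)
    then show ?case using ends[of "(y, z)"] by simp
  qed
qed

lemma connected_columns:
  assumes shape: "skew_shape lam mu" and conn: "skew_connected lam mu" and j: "1 \<le> j" "j \<le> hd lam"
  shows "\<exists>i. (i, int j) \<in> diagram lam mu"
proof (rule ccontr)
  assume no: "\<not> ?thesis"
  have "XVar 1 \<in> {YVar j}"
  proof (rule skew_connected_closed[OF conn])
    show "YVar j \<in> skew_vars lam" "XVar 1 \<in> skew_vars lam"
      using j skew_shapeD(1)[OF shape] by (auto simp: skew_vars_def Suc_le_eq)
    show "XVar i \<in> {YVar j} \<longleftrightarrow> YVar j' \<in> {YVar j}" if "(int i, int j') \<in> diagram lam mu" for i j'
      using that no by auto
  qed simp
  then show False by simp
qed

lemma connected_rows_overlap:
  assumes shape: "skew_shape lam mu" and conn: "skew_connected lam mu"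
    and z: "1 \<le> z" "z < int (length lam)"
  shows "\<exists>j. (z, j) \<in> diagram lam mu \<and> (z + 1, j) \<in> diagram lam mu"
proof (rule ccontr)
  assume no: "\<not> ?thesis"
  define i where "i = nat z"
  have i: "1 \<le> i" "i < length lam" "z = int i" using z by (auto simp: i_def)
  have gap: "lam ! i \<le> mu ! (i - 1)"
  proof (rule ccontr)
    assume "\<not> ?thesis"
    moreover have "mu ! i \<le> mu ! (i - 1)" "lam ! i \<le> lam ! (i - 1)"
      using i by (auto intro: skew_shapeD(3,4)[OF shape])
    ultimately have "(z, int (lam ! i)) \<in> diagram lam mu \<and> (z + 1, int (lam ! i)) \<in> diagram lam mu"
      using i skew_shapeD(5)[OF shape, of i] by (auto simp: diagram_iff nat_diff_distrib)
    then show False using no by blast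
  qed
  let ?A = "XVar ` {..i} \<union> YVar ` {mu ! (i - 1)<..}"
  have "XVar (Suc i) \<in> ?A"
  proof (rule skew_connected_closed[OF conn])
    show "XVar 1 \<in> skew_vars lam" "XVar (Suc i) \<in> skew_vars lam" "XVar 1 \<in> ?A"
      using i by (auto simp: skew_vars_def)
    fix i' j' assume ij: "(int i', int j') \<in> diagram lam mu"
    then have ij': "1 \<le> i'" "i' \<le> length lam" "mu ! (i' - 1) < j'" "j' \<le> lam ! (i' - 1)"
      by (auto simp: diagram_iff nat_diff_distrib)
    have "i' \<le> i \<longleftrightarrow> mu ! (i - 1) < j'"
    proof (cases "i' \<le> i")
      case True
      then have "mu ! (i - 1) \<le> mu ! (i' - 1)" using i by (intro skew_shapeD(4)[OF shape]) auto
      then show ?thesis using True ij' by simp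
    next
      case False
      then have "lam ! (i' - 1) \<le> lam ! i" using ij' by (intro skew_shapeD(3)[OF shape]) auto
      then show ?thesis using False ij' gap by simp
    qed
    then show "XVar i' \<in> ?A \<longleftrightarrow> YVar j' \<in> ?A" by auto
  qed
  then show False by auto
qed

section \<open>Prime unmixed shapes\<close>

lemma translate_mem_iff: "(k, j) \<in> translate s t ` B \<longleftrightarrow> (k - s, j - t) \<in> B"
  by (force simp: translate_def image_iff)

lemma reflect_mem_iff: "(k, j) \<in> reflect ` B \<longleftrightarrow> (- j, - k) \<in> B"
  by (force simp: reflect_def image_iff)

lemma translate_cut_diagram:
  "translate s t ` cut_diagram c a q U L =
    cut_diagram (c + s + t) (a + s) (q + s) ((\<lambda>z. z + s) ` U) ((\<lambda>z. z + s) ` L)"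
proof -
  have "(k, j) \<in> translate s t ` cut_diagram c a q U L \<longleftrightarrow>
      (k, j) \<in> cut_diagram (c + s + t) (a + s) (q + s) ((\<lambda>z. z + s) ` U) ((\<lambda>z. z + s) ` L)" for k j
    unfolding translate_mem_iff cut_diagram_iff by (auto simp: algebra_simps)
  then show ?thesis by (intro equalityI subrelI) blast+
qed

lemma reflect_cut_diagram:
  "reflect ` cut_diagram c a q U L =
    cut_diagram (- c) (a - c) (q - c) ((\<lambda>z. z - c) ` L) ((\<lambda>z. z - c) ` U)"
proof -
  have "(k, j) \<in> reflect ` cut_diagram c a q U L \<longleftrightarrow>
      (k, j) \<in> cut_diagram (- c) (a - c) (q - c) ((\<lambda>z. z - c) ` L) ((\<lambda>z. z - c) ` U)" for k j
    unfolding reflect_mem_iff cut_diagram_iff by (auto simp: algebra_simps)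
  then show ?thesis by (intro equalityI subrelI) blast+
qed

lemma is_partitionD:
  assumes "is_partition lam"
  shows "skew_shape lam (zeros lam)" "0 < length lam"
    "i \<le> k \<Longrightarrow> k < length lam \<Longrightarrow> lam ! k \<le> lam ! i" "i < length lam \<Longrightarrow> 0 < lam ! i"
proof -
  show shape: "skew_shape lam (zeros lam)" using assms by (simp add: is_partition_def)
  note D = skew_shapeD[OF shape]
  show "0 < length lam" "i \<le> k \<Longrightarrow> k < length lam \<Longrightarrow> lam ! k \<le> lam ! i" using D(1,3) by auto
  show "i < length lam \<Longrightarrow> 0 < lam ! i" using D(5)[of i] by (simp add: zeros_def)
qed

lemma ferrers_iff:
  "(i, j) \<in> ferrers lam \<longleftrightarrow> 1 \<le> i \<and> i \<le> int (length lam) \<and> 1 \<le> j \<and> j \<le> int (lam ! nat (i - 1))"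
  by (auto simp: ferrers_def diagram_iff zeros_def)

lemma unmixed_partition_imp_cut_diagram:
  assumes "unmixed_partition (K :: 'k::field itself) lam"
  obtains U where "0 < length lam" "ferrers lam = cut_diagram (int (length lam) + 1) 1 (int (length lam)) U {}"
proof -
  define n where "n = int (length lam)"
  have part: "is_partition lam" and unm: "skew_unmixed K lam (zeros lam)"
    using assms by (auto simp: unmixed_partition_def)
  note shape = is_partitionD(1)[OF part]
  have len: "0 < length lam" by (rule is_partitionD(2)[OF part])
  then have hd: "hd lam = lam ! 0" by (simp add: hd_conv_nth)
  have wc: "well_covered (skew_vars lam) (skew_edges lam (zeros lam))"
    using unm skew_unmixed_iff[OF shape] by blast
  have "(1, int j) \<in> diagram lam (zeros lam)" if "1 \<le> j" "j \<le> hd lam" for j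
    using that len hd by (auto simp: diagram_iff zeros_def Suc_le_eq)
  then have cols: "\<forall>j. 1 \<le> j \<longrightarrow> j \<le> hd lam \<longrightarrow> (\<exists>i. (i, int j) \<in> diagram lam (zeros lam))" by blast
  have "(z, n - z) \<in> diagram lam (zeros lam)" if z: "1 \<le> z" "z < n" for z
  proof -
    have "(z, n + 1 - z) \<in> diagram lam (zeros lam)"
      using well_covered_skew_antidiagonal(2)[OF shape cols wc, of z] z by (simp add: n_def)
    then show ?thesis using z by (auto simp: ferrers_iff simp flip: ferrers_def)
  qed
  then have empty: "{z \<in> {1..<n}. (z, n - z) \<notin> diagram lam (zeros lam)} = {}" by auto
  have "ferrers lam = cut_diagram (n + 1) 1 n
      {z \<in> {1..<n}. (z + 1, n + 1 - z) \<notin> diagram lam (zeros lam)} {}"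
    using well_covered_imp_cut_diagram[OF shape cols wc, folded n_def]
    unfolding empty ferrers_def .
  then show thesis using that len unfolding n_def by simp
qed

lemma down_closed_nat:
  fixes S :: "nat set"
  assumes "finite S" "0 \<notin> S" "\<And>i j. j \<in> S \<Longrightarrow> 1 \<le> i \<Longrightarrow> i \<le> j \<Longrightarrow> i \<in> S"
  shows "S = {1..card S}"
proof (cases "S = {}")
  case False
  have "S = {1..Max S}"
  proof (intro equalityI subsetI)
    fix i assume "i \<in> S"
    then show "i \<in> {1..Max S}" using assms(1,2) by (cases i) auto
  next
    fix i assume "i \<in> {1..Max S}"
    then show "i \<in> S" using assms(3)[OF Max_in[OF assms(1) False], of i] by simp
  qed
  then show ?thesis by (metis card_atLeastAtMost diff_Suc_1)
qed simp

text \<open>A diagram that is cut below the antidiagonal only is the Ferrers diagram of the partition formed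
  by its row lengths.\<close>

lemma cut_diagram_is_unmixed_ferrers:
  assumes "1 \<le> n"
  obtains lam where "unmixed_partition (K :: 'k::field itself) lam" "length lam = n"
    "ferrers lam = cut_diagram (int n + 1) 1 (int n) U {}"
proof -
  define D where "D = cut_diagram (int n + 1) 1 (int n) U {}"
  define S where "S i = {j \<in> {1..n}. (int i, int j) \<in> D}" for i
  define lam where "lam = map (\<lambda>i. card (S (Suc i))) [0..<n]"
  have len: "length lam = n" by (simp add: lam_def)
  have nth: "lam ! i = card (S (Suc i))" if "i < n" for i using that by (simp add: lam_def)
  have left: "(k, j') \<in> D" if "(k, j) \<in> D" "1 \<le> j'" "j' \<le> j" for k j j'
    using that unfolding D_def cut_diagram_iff by (auto; smt (verit))
  have up: "(k', j) \<in> D" if "(k, j) \<in> D" "1 \<le> k'" "k' \<le> k" for k k' j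
    using that unfolding D_def cut_diagram_iff by (auto; smt (verit))
  have bounds: "1 \<le> k \<and> k \<le> int n \<and> 1 \<le> j \<and> j \<le> int n" if "(k, j) \<in> D" for k j
    using that unfolding D_def cut_diagram_iff by auto
  have S: "S i = {1..card (S i)}" for i
  proof (rule down_closed_nat)
    show "i' \<in> S i" if "j \<in> S i" "1 \<le> i'" "i' \<le> j" for i' j
      using that left[of "int i" "int j" "int i'"] by (auto simp: S_def)
  qed (auto simp: S_def)
  have row: "(int i, int j) \<in> D \<longleftrightarrow> 1 \<le> j \<and> j \<le> card (S i)" for i j
  proof -
    have "(int i, int j) \<in> D \<longleftrightarrow> j \<in> S i" using bounds[of "int i" "int j"] by (auto simp: S_def)
    also have "\<dots> \<longleftrightarrow> 1 \<le> j \<and> j \<le> card (S i)" by (subst S) simp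
    finally show ?thesis .
  qed
  have mono: "card (S i') \<le> card (S i)" if "1 \<le> i" "i \<le> i'" for i i'
  proof -
    have "S i' \<subseteq> S i" using that up[of "int i'" _ "int i"] by (auto simp: S_def)
    then show ?thesis by (intro card_mono) (auto simp: S_def)
  qed
  have pos: "0 < card (S i)" if "1 \<le> i" "i \<le> n" for i
  proof -
    have "(int i, int n + 1 - int i) \<in> D"
      unfolding D_def using that by (intro cut_diagram_refl) auto
    then have "(int i, 1) \<in> D" using left[of "int i" "int n + 1 - int i" 1] that by simp
    then show ?thesis using row[of i 1] by simp
  qed
  have ferrers: "ferrers lam = D"
  proof -
    have "(k, j) \<in> ferrers lam \<longleftrightarrow> (k, j) \<in> D" for k j
    proof (cases "1 \<le> k \<and> k \<le> int n \<and> 1 \<le> j")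
      case True
      then have "lam ! nat (k - 1) = card (S (nat k))"
        using nth[of "nat (k - 1)"] by (simp add: nat_less_iff Suc_nat_eq_nat_zadd1)
      then show ?thesis using True row[of "nat k" "nat j"] by (auto simp: ferrers_iff len)
    next
      case False
      then show ?thesis using bounds[of k j] by (auto simp: ferrers_iff len)
    qed
    then show ?thesis by (intro equalityI subrelI) blast+
  qed
  have "skew_shape lam (zeros lam)"
    unfolding skew_shape_def
  proof (intro conjI)
    show ne: "lam \<noteq> []" using len assms by auto
    show "length (zeros lam) = length lam" by (simp add: zeros_def)
    show "sorted_wrt (\<ge>) lam"
      using mono by (auto simp: sorted_wrt_iff_nth_less len nth)
    show "sorted_wrt (\<ge>) (zeros lam)"
      by (simp add: sorted_wrt_iff_nth_less zeros_def)
    show "\<forall>i<length lam. zeros lam ! i < lam ! i"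
      using pos by (simp add: len nth zeros_def)
    show "last (zeros lam) = 0" using ne by (simp add: zeros_def)
  qed
  then have "is_partition lam" "skew_unmixed K lam (zeros lam)"
    using cut_diagram_imp_well_covered(1)[of lam "zeros lam"] skew_unmixed_iff[of lam "zeros lam"] ferrers
    unfolding is_partition_def ferrers_def D_def by blast+
  then show thesis
    using that[of lam] len ferrers unfolding unmixed_partition_def D_def by blast
qed

lemma upper_prime_unmixed_iff:
  "upper_prime_unmixed (K :: 'k::field itself) B \<longleftrightarrow>
     (\<exists>c a q U. a \<le> q \<and> B = cut_diagram c a q U {})"
proof
  assume "upper_prime_unmixed K B"
  then obtain lam s t where "unmixed_partition K lam" "B = translate s t ` ferrers lam"
    by (auto simp: upper_prime_unmixed_def)
  moreover from this(1) obtain U where "0 < length lam"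
    "ferrers lam = cut_diagram (int (length lam) + 1) 1 (int (length lam)) U {}"
    by (rule unmixed_partition_imp_cut_diagram)
  ultimately have "1 + s \<le> int (length lam) + s" "B = cut_diagram (int (length lam) + 1 + s + t) (1 + s)
      (int (length lam) + s) ((\<lambda>z. z + s) ` U) {}"
    by (simp_all add: translate_cut_diagram Suc_le_eq)
  then show "\<exists>c a q U. a \<le> q \<and> B = cut_diagram c a q U {}" by blast
next
  assume "\<exists>c a q U. a \<le> q \<and> B = cut_diagram c a q U {}"
  then obtain c a q U where B: "a \<le> q" "B = cut_diagram c a q U {}" by blast
  define n where "n = nat (q - a + 1)"
  have n: "int n = q - a + 1" "1 \<le> n" using B(1) by (auto simp: n_def)
  obtain lam where lam: "unmixed_partition K lam" "length lam = n" "ferrers lam =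
      cut_diagram (int n + 1) 1 (int n) ((\<lambda>z. z - (a - 1)) ` U) {}"
    by (rule cut_diagram_is_unmixed_ferrers[OF n(2)])
  have "B = translate (a - 1) (c - q - 1) ` ferrers lam"
    unfolding lam(3) translate_cut_diagram B(2) by (simp add: image_image n(1))
  then show "upper_prime_unmixed K B" using lam(1) unfolding upper_prime_unmixed_def by blast
qed

lemma lower_prime_unmixed_iff:
  "lower_prime_unmixed (K :: 'k::field itself) B \<longleftrightarrow>
     (\<exists>c a q L. a \<le> q \<and> B = cut_diagram c a q {} L)"
proof
  assume "lower_prime_unmixed K B"
  then obtain lam s t where "unmixed_partition K lam" "B = translate s t ` reflect ` ferrers lam"
    by (auto simp: lower_prime_unmixed_def)
  moreover from this(1) obtain U where "0 < length lam"
    "ferrers lam = cut_diagram (int (length lam) + 1) 1 (int (length lam)) U {}"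
    by (rule unmixed_partition_imp_cut_diagram)
  ultimately have "B = cut_diagram (- (int (length lam) + 1) + s + t) (1 - (int (length lam) + 1) + s)
      (int (length lam) - (int (length lam) + 1) + s) {} ((\<lambda>z. z + s) ` (\<lambda>z. z - (int (length lam) + 1)) ` U)"
    and "1 - (int (length lam) + 1) + s \<le> int (length lam) - (int (length lam) + 1) + s"
    by (simp_all add: translate_cut_diagram reflect_cut_diagram Suc_le_eq)
  then show "\<exists>c a q L. a \<le> q \<and> B = cut_diagram c a q {} L" by blast
next
  assume "\<exists>c a q L. a \<le> q \<and> B = cut_diagram c a q {} L"
  then obtain c a q L where B: "a \<le> q" "B = cut_diagram c a q {} L" by blast
  define n where "n = nat (q - a + 1)"
  have n: "int n = q - a + 1" "1 \<le> n" using B(1) by (auto simp: n_def)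
  obtain lam where lam: "unmixed_partition K lam" "length lam = n" "ferrers lam =
      cut_diagram (int n + 1) 1 (int n) ((\<lambda>z. z - q + (int n)) ` L) {}"
    by (rule cut_diagram_is_unmixed_ferrers[OF n(2)])
  have "B = translate (q + 1) (c - a + 1) ` reflect ` ferrers lam"
    unfolding lam(3) translate_cut_diagram reflect_cut_diagram B(2) using B(1)
    by (simp add: image_image n(1))
  then show "lower_prime_unmixed K B" using lam(1) unfolding lower_prime_unmixed_def by blast
qed

text \<open>To treat the two types of shapes alike, the kinds of cuts are exchanged depending on a type \<open>ty\<close>,
  which is \<open>True\<close> for upper triangular shapes: the shapes of type \<open>ty\<close> are those with cuts in
  \<open>X\<close> only.\<close>

definition typed_cut :: "bool \<Rightarrow> int \<Rightarrow> int \<Rightarrow> int \<Rightarrow> int set \<Rightarrow> int set \<Rightarrow> box set" where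
  "typed_cut ty c a q X Y = (if ty then cut_diagram c a q X Y else cut_diagram c a q Y X)"

text \<open>The prime unmixed shapes that are upper triangular (\<open>True\<close>) or lower triangular
  (\<open>False\<close>).\<close>

definition prime_of_type :: "'k::field itself \<Rightarrow> bool \<Rightarrow> box set \<Rightarrow> bool" where
  "prime_of_type K ty B \<longleftrightarrow> (if ty then upper_prime_unmixed K B else lower_prime_unmixed K B)"

lemma typed_cut_iff:
  "(k, j) \<in> typed_cut ty c a q X Y \<longleftrightarrow> a \<le> k \<and> k \<le> q \<and> a \<le> c - j \<and> c - j \<le> q \<and>
     (\<forall>z\<in>if ty then X else Y. \<not> (c - j \<le> z \<and> z < k)) \<and>
     (\<forall>z\<in>if ty then Y else X. \<not> (k \<le> z \<and> z < c - j))"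
  by (simp add: typed_cut_def cut_diagram_iff)

lemma typed_cut_not: "typed_cut (\<not> ty) c a q X Y = typed_cut ty c a q Y X"
  by (simp add: typed_cut_def)

lemma typed_cut_empty: "typed_cut ty c a q {} {} = {a..q} \<times> {c - q..c - a}"
  by (auto simp: typed_cut_iff)

text \<open>Only cuts inside the range matter.\<close>

lemma typed_cut_restrict:
  "typed_cut ty c a q X Y = typed_cut ty c a q (X \<inter> {a..<q}) (Y \<inter> {a..<q})"
proof -
  have "(k, j) \<in> typed_cut ty c a q X Y \<longleftrightarrow>
      (k, j) \<in> typed_cut ty c a q (X \<inter> {a..<q}) (Y \<inter> {a..<q})" for k j
    unfolding typed_cut_iff by auto
  then show ?thesis by (intro equalityI subrelI) blast+
qed

lemma prime_of_type_iff:
  "prime_of_type (K :: 'k::field itself) ty B \<longleftrightarrow>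
     (\<exists>c a q X. a \<le> q \<and> X \<subseteq> {a..<q} \<and> B = typed_cut ty c a q X {})"
proof -
  have "prime_of_type K ty B \<longleftrightarrow> (\<exists>c a q X. a \<le> q \<and> B = typed_cut ty c a q X {})"
    by (simp add: prime_of_type_def upper_prime_unmixed_iff lower_prime_unmixed_iff typed_cut_def)
  moreover have "\<exists>X'. X' \<subseteq> {a..<q} \<and> typed_cut ty c a q X {} = typed_cut ty c a q X' {}" for c a q X
    using typed_cut_restrict[of ty c a q X "{}"] by (intro exI[of _ "X \<inter> {a..<q}"]) simp
  ultimately show ?thesis by metis
qed

lemma prime_unmixed_iff_type: "prime_unmixed (K :: 'k::field itself) B \<longleftrightarrow> (\<exists>ty. prime_of_type K ty B)"
  by (auto simp: prime_unmixed_def prime_of_type_def split: if_splits)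

lemma alternating_type_iff:
  "alternating_type (K :: 'k::field itself) B B' \<longleftrightarrow> (\<exists>ty. prime_of_type K ty B \<and> prime_of_type K (\<not> ty) B')"
  by (auto simp: alternating_type_def prime_of_type_def split: if_splits)

lemma square_typed_cut_iff:
  assumes "a \<le> q" "X \<subseteq> {a..<q}"
  shows "square_shape (typed_cut ty c a q X {}) \<longleftrightarrow> X = {}"
proof
  assume "X = {}"
  then have "typed_cut ty c a q X {} = {a..<a + int (nat (q - a + 1))} \<times> {c - q..<c - q + int (nat (q - a + 1))}"
    using assms(1) by (auto simp: typed_cut_empty)
  then show "square_shape (typed_cut ty c a q X {})" unfolding square_shape_def by blast
next
  assume "square_shape (typed_cut ty c a q X {})"
  then obtain x y p where sq: "typed_cut ty c a q X {} = {x..<x + int p} \<times> {y..<y + int p}"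
    unfolding square_shape_def by blast
  show "X = {}"
  proof (rule ccontr)
    assume "X \<noteq> {}"
    then obtain z where "z \<in> X" by blast
    then have z: "z \<in> X" "a \<le> z" "z < q" using assms(2) by auto
    then have "(z, c - z) \<in> typed_cut ty c a q X {}" "(z + 1, c - (z + 1)) \<in> typed_cut ty c a q X {}"
      by (auto simp: typed_cut_iff)
    then have "(z + 1, c - z) \<in> typed_cut ty c a q X {}" "(z, c - (z + 1)) \<in> typed_cut ty c a q X {}"
      unfolding sq by auto
    then show False using z by (auto simp: typed_cut_iff split: if_splits)
  qed
qed

text \<open>The antidiagonal, and with it the parameters of a diagram, can be read off the corners.\<close>

lemma typed_cut_params_unique:
  assumes eq: "typed_cut ty c a q X Y = typed_cut ty' c' a' q' X' Y'" and "a \<le> q" "a' \<le> q'"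
  shows "c = c'" "a = a'" "q = q'"
proof -
  have *: "(k, c - k) \<in> typed_cut ty c a q X Y \<longleftrightarrow> a \<le> k \<and> k \<le> q" for ty c a q X Y k
    by (auto simp: typed_cut_iff)
  have sub: "a \<le> a' \<and> q' \<le> q \<and> a \<le> c - (c' - a') \<and> c - (c' - q') \<le> q"
    if "typed_cut ty c a q X Y = typed_cut ty' c' a' q' X' Y'" "a' \<le> q'"
    for ty c a q X Y ty' c' a' q' X' Y'
  proof -
    have "(a', c' - a') \<in> typed_cut ty c a q X Y" "(q', c' - q') \<in> typed_cut ty c a q X Y"
      unfolding that(1) * using that(2) by auto
    then show ?thesis by (auto simp: typed_cut_iff)
  qed
  have "c = c' \<and> a = a' \<and> q = q'"
    using sub[OF eq assms(3)] sub[OF eq[symmetric] assms(2)] by auto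
  then show "c = c'" "a = a'" "q = q'" by simp_all
qed

text \<open>Only squares are both upper and lower triangular.\<close>

lemma prime_type_unique:
  assumes "prime_of_type (K :: 'k::field itself) ty B" "prime_of_type K (\<not> ty) B"
  shows "square_shape B"
proof -
  obtain c a q X where B: "a \<le> q" "X \<subseteq> {a..<q}" "B = typed_cut ty c a q X {}"
    using assms(1) unfolding prime_of_type_iff by blast
  obtain c' a' q' X' where B': "a' \<le> q'" "X' \<subseteq> {a'..<q'}" "B = typed_cut (\<not> ty) c' a' q' X' {}"
    using assms(2) unfolding prime_of_type_iff by blast
  note params = typed_cut_params_unique[OF B(3)[symmetric, unfolded B'(3)] B(1) B'(1)]
  have "X = {}"
  proof (rule ccontr)
    assume "X \<noteq> {}"
    then obtain z where "z \<in> X" by blast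
    then have z: "z \<in> X" "a \<le> z" "z < q" using B(2) by auto
    show False
    proof (cases ty)
      case True
      have "(z + 1, c - z) \<in> B" unfolding B'(3) using z True params by (auto simp: typed_cut_iff)
      then show False unfolding B(3) using z True by (auto simp: typed_cut_iff)
    next
      case False
      have "(z, c - (z + 1)) \<in> B" unfolding B'(3) using z False params by (auto simp: typed_cut_iff)
      then show False unfolding B(3) using z False by (auto simp: typed_cut_iff)
    qed
  qed
  then show ?thesis unfolding B(3) using square_typed_cut_iff[OF B(1,2)] by blast
qed

section \<open>Extremal blocks\<close>

text \<open>Descriptions of the extremal blocks in terms of the shape alone: the boxes whose row has the same columns
  as all rows above it and whose column has the same rows as all columns to the right of it,
  and the same with below and left. They make sense for upper and for lower triangular shapes.\<close>

definition top_right_part :: "box set \<Rightarrow> box set" where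
  "top_right_part B = {(i, j). (i, j) \<in> B \<and>
     (\<forall>p s. (p, s) \<in> B \<longrightarrow> p \<le> i \<longrightarrow> (\<forall>u. (p, u) \<in> B \<longleftrightarrow> (i, u) \<in> B)) \<and>
     (\<forall>p s. (p, s) \<in> B \<longrightarrow> j \<le> s \<longrightarrow> (\<forall>u. (u, s) \<in> B \<longleftrightarrow> (u, j) \<in> B))}"

definition bottom_left_part :: "box set \<Rightarrow> box set" where
  "bottom_left_part B = {(i, j). (i, j) \<in> B \<and>
     (\<forall>p s. (p, s) \<in> B \<longrightarrow> i \<le> p \<longrightarrow> (\<forall>u. (p, u) \<in> B \<longleftrightarrow> (i, u) \<in> B)) \<and>
     (\<forall>p s. (p, s) \<in> B \<longrightarrow> s \<le> j \<longrightarrow> (\<forall>u. (u, s) \<in> B \<longleftrightarrow> (u, j) \<in> B))}"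

lemma top_right_partI:
  assumes "(i, j) \<in> B"
    and "\<And>p s u. (p, s) \<in> B \<Longrightarrow> p \<le> i \<Longrightarrow> (p, u) \<in> B \<longleftrightarrow> (i, u) \<in> B"
    and "\<And>p s u. (p, s) \<in> B \<Longrightarrow> j \<le> s \<Longrightarrow> (u, s) \<in> B \<longleftrightarrow> (u, j) \<in> B"
  shows "(i, j) \<in> top_right_part B"
  unfolding top_right_part_def mem_Collect_eq case_prod_conv
  by (intro conjI allI impI) (erule (1) assms | rule assms(1))+

lemma top_right_partD:
  assumes "(i, j) \<in> top_right_part B"
  shows "(i, j) \<in> B"
    "(p, s) \<in> B \<Longrightarrow> p \<le> i \<Longrightarrow> (p, u) \<in> B \<longleftrightarrow> (i, u) \<in> B"
    "(p, s) \<in> B \<Longrightarrow> j \<le> s \<Longrightarrow> (u, s) \<in> B \<longleftrightarrow> (u, j) \<in> B"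
  using assms unfolding top_right_part_def mem_Collect_eq case_prod_conv by blast+

lemma bottom_left_partI:
  assumes "(i, j) \<in> B"
    and "\<And>p s u. (p, s) \<in> B \<Longrightarrow> i \<le> p \<Longrightarrow> (p, u) \<in> B \<longleftrightarrow> (i, u) \<in> B"
    and "\<And>p s u. (p, s) \<in> B \<Longrightarrow> s \<le> j \<Longrightarrow> (u, s) \<in> B \<longleftrightarrow> (u, j) \<in> B"
  shows "(i, j) \<in> bottom_left_part B"
  unfolding bottom_left_part_def mem_Collect_eq case_prod_conv
  by (intro conjI allI impI) (erule (1) assms | rule assms(1))+

lemma bottom_left_partD:
  assumes "(i, j) \<in> bottom_left_part B"
  shows "(i, j) \<in> B"
    "(p, s) \<in> B \<Longrightarrow> i \<le> p \<Longrightarrow> (p, u) \<in> B \<longleftrightarrow> (i, u) \<in> B"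
    "(p, s) \<in> B \<Longrightarrow> s \<le> j \<Longrightarrow> (u, s) \<in> B \<longleftrightarrow> (u, j) \<in> B"
  using assms unfolding bottom_left_part_def mem_Collect_eq case_prod_conv by blast+

lemma translate_parts_subset:
  "translate s t ` top_right_part B \<subseteq> top_right_part (translate s t ` B)"
  "translate s t ` bottom_left_part B \<subseteq> bottom_left_part (translate s t ` B)"
proof -
  show "translate s t ` top_right_part B \<subseteq> top_right_part (translate s t ` B)"
  proof (intro subrelI)
    fix i j assume "(i, j) \<in> translate s t ` top_right_part B"
    then have "(i - s, j - t) \<in> top_right_part B" by (simp only: translate_mem_iff)
    note D = top_right_partD[OF this]
    show "(i, j) \<in> top_right_part (translate s t ` B)"
      by (rule top_right_partI; unfold translate_mem_iff) (rule D; simp)+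
  qed
  show "translate s t ` bottom_left_part B \<subseteq> bottom_left_part (translate s t ` B)"
  proof (intro subrelI)
    fix i j assume "(i, j) \<in> translate s t ` bottom_left_part B"
    then have "(i - s, j - t) \<in> bottom_left_part B" by (simp only: translate_mem_iff)
    note D = bottom_left_partD[OF this]
    show "(i, j) \<in> bottom_left_part (translate s t ` B)"
      by (rule bottom_left_partI; unfold translate_mem_iff) (rule D; simp)+
  qed
qed

lemma reflect_parts_subset:
  "reflect ` top_right_part B \<subseteq> top_right_part (reflect ` B)"
  "reflect ` bottom_left_part B \<subseteq> bottom_left_part (reflect ` B)"
proof -
  show "reflect ` top_right_part B \<subseteq> top_right_part (reflect ` B)"
  proof (intro subrelI)
    fix i j assume "(i, j) \<in> reflect ` top_right_part B"
    then have "(- j, - i) \<in> top_right_part B" by (simp only: reflect_mem_iff)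
    note D = top_right_partD[OF this]
    show "(i, j) \<in> top_right_part (reflect ` B)"
      by (rule top_right_partI; unfold reflect_mem_iff) (rule D(1), erule D(3), simp, erule D(2), simp)
  qed
  show "reflect ` bottom_left_part B \<subseteq> bottom_left_part (reflect ` B)"
  proof (intro subrelI)
    fix i j assume "(i, j) \<in> reflect ` bottom_left_part B"
    then have "(- j, - i) \<in> bottom_left_part B" by (simp only: reflect_mem_iff)
    note D = bottom_left_partD[OF this]
    show "(i, j) \<in> bottom_left_part (reflect ` B)"
      by (rule bottom_left_partI; unfold reflect_mem_iff) (rule D(1), erule D(3), simp, erule D(2), simp)
  qed
qed

lemma translate_translate: "translate (- s) (- t) ` translate s t ` B = B"
  "translate s t ` translate (- s) (- t) ` B = B"
  by (force simp: translate_def image_iff)+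

lemma reflect_reflect: "reflect ` reflect ` B = B"
  by (force simp: reflect_def image_iff)

lemma shape_map_parts:
  assumes "shape_map f"
  shows "top_right_part (f ` B) = f ` top_right_part B"
    "bottom_left_part (f ` B) = f ` bottom_left_part B"
proof -
  have tr: "P (translate s t ` B) = translate s t ` P B"
    if "\<And>s t B. translate s t ` P B \<subseteq> P (translate s t ` B)" for P s t B
  proof
    have "translate (- s) (- t) ` P (translate s t ` B) \<subseteq> P B"
      using that[of "- s" "- t" "translate s t ` B"] by (simp only: translate_translate)
    then have "translate s t ` translate (- s) (- t) ` P (translate s t ` B) \<subseteq> translate s t ` P B"
      by (rule image_mono)
    then show "P (translate s t ` B) \<subseteq> translate s t ` P B" by (simp only: translate_translate)
  qed (rule that)
  have re: "P (reflect ` B) = reflect ` P B"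
    if "\<And>B. reflect ` P B \<subseteq> P (reflect ` B)" for P B
  proof
    have "reflect ` P (reflect ` B) \<subseteq> P B"
      using that[of "reflect ` B"] by (simp only: reflect_reflect)
    then have "reflect ` reflect ` P (reflect ` B) \<subseteq> reflect ` P B"
      by (rule image_mono)
    then show "P (reflect ` B) \<subseteq> reflect ` P B" by (simp only: reflect_reflect)
  qed (rule that)
  obtain a b where "f = translate a b \<or> f = translate a b \<circ> reflect"
    using assms by (auto simp: shape_map_def)
  note f = this
  note commute = tr[of top_right_part, OF translate_parts_subset(1)] re[of top_right_part, OF reflect_parts_subset(1)]
    tr[of bottom_left_part, OF translate_parts_subset(2)] re[of bottom_left_part, OF reflect_parts_subset(2)]
  from f show "top_right_part (f ` B) = f ` top_right_part B"
    "bottom_left_part (f ` B) = f ` bottom_left_part B"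
    by (elim disjE; simp only: commute image_comp[symmetric])+
qed

lemma less_conjugate_part_iff:
  assumes "is_partition lam" "i < length lam"
  shows "i < conjugate_part lam j \<longleftrightarrow> j \<le> lam ! i"
proof -
  let ?A = "{i. i < length lam \<and> j \<le> lam ! i}"
  note mono = is_partitionD(3)[OF assms(1)]
  show ?thesis
  proof
    assume "j \<le> lam ! i"
    then have "{..i} \<subseteq> ?A" using assms(2) mono by (auto intro: le_trans)
    then have "card {..i} \<le> card ?A" by (intro card_mono) auto
    then show "i < conjugate_part lam j" by (simp add: conjugate_part_def)
  next
    assume *: "i < conjugate_part lam j"
    show "j \<le> lam ! i"
    proof (rule ccontr)
      assume ji: "\<not> j \<le> lam ! i"
      have "?A \<subseteq> {..<i}"
      proof
        fix k assume k: "k \<in> ?A"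
        then have "\<not> i \<le> k" using mono[of i k] ji by auto
        then show "k \<in> {..<i}" by simp
      qed
      then have "card ?A \<le> card {..<i}" by (intro card_mono) auto
      then show False using * by (simp add: conjugate_part_def)
    qed
  qed
qed

lemma conjugate_part_le: "conjugate_part lam j \<le> length lam"
proof -
  have "card {i. i < length lam \<and> j \<le> lam ! i} \<le> card {..<length lam}" by (intro card_mono) auto
  then show ?thesis by (simp add: conjugate_part_def)
qed

lemma strip_meet_iff:
  "(i, j) \<in> strip_meet lam r c \<longleftrightarrow> 1 \<le> i \<and> i \<le> int (length lam) \<and> lam ! nat (i - 1) = r \<and>
     1 \<le> j \<and> j \<le> int (hd lam) \<and> conjugate_part lam (nat j) = c"
proof
  assume "1 \<le> i \<and> i \<le> int (length lam) \<and> lam ! nat (i - 1) = r \<and>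
     1 \<le> j \<and> j \<le> int (hd lam) \<and> conjugate_part lam (nat j) = c"
  then have "i = int (nat i)" "j = int (nat j)" "1 \<le> nat i" "nat i \<le> length lam"
    "lam ! (nat i - 1) = r" "1 \<le> nat j" "nat j \<le> hd lam" "conjugate_part lam (nat j) = c"
    by (auto simp: nat_diff_distrib)
  then show "(i, j) \<in> strip_meet lam r c" unfolding strip_meet_def by blast
qed (auto simp: strip_meet_def nat_diff_distrib)

lemma ferrers_column_iff:
  assumes "is_partition lam" "1 \<le> i" "1 \<le> j"
  shows "(i, j) \<in> ferrers lam \<longleftrightarrow> i \<le> int (conjugate_part lam (nat j))"
proof (cases "i \<le> int (length lam)")
  case True
  then have "nat (i - 1) < conjugate_part lam (nat j) \<longleftrightarrow> nat j \<le> lam ! nat (i - 1)"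
    using assms by (intro less_conjugate_part_iff) auto
  then show ?thesis using True assms by (auto simp: ferrers_iff)
next
  case False
  then show ?thesis using conjugate_part_le[of lam "nat j"] by (auto simp: ferrers_iff)
qed

lemma ferrers_row_le_hd:
  assumes "is_partition lam" "(i, j) \<in> ferrers lam"
  shows "j \<le> int (hd lam)"
  using diagram_bounds(4)[OF is_partitionD(1)[OF assms(1)]] assms(2) unfolding ferrers_def .

lemma block_of_box:
  assumes part: "is_partition lam" and ij: "(i, j) \<in> ferrers lam"
  shows "strip_meet lam (lam ! nat (i - 1)) (conjugate_part lam (nat j)) \<in> blocks lam"
    "(i, j) \<in> strip_meet lam (lam ! nat (i - 1)) (conjugate_part lam (nat j))"
proof -
  have bounds: "1 \<le> i" "i \<le> int (length lam)" "1 \<le> j" "j \<le> int (hd lam)"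
    using ij ferrers_row_le_hd[OF part ij] by (auto simp: ferrers_iff)
  then show "(i, j) \<in> strip_meet lam (lam ! nat (i - 1)) (conjugate_part lam (nat j))"
    by (simp add: strip_meet_iff)
  have "strip_meet lam (lam ! nat (i - 1)) (conjugate_part lam (nat j)) \<subseteq> ferrers lam"
  proof (intro subrelI)
    fix p s assume ps: "(p, s) \<in> strip_meet lam (lam ! nat (i - 1)) (conjugate_part lam (nat j))"
    have "(i, s) \<in> ferrers lam"
      using ps bounds ij by (simp add: strip_meet_iff ferrers_column_iff[OF part])
    then show "(p, s) \<in> ferrers lam"
      using ps by (simp add: strip_meet_iff ferrers_iff)
  qed
  moreover have "lam ! nat (i - 1) \<in> set lam" using bounds by (intro nth_mem) auto
  moreover have "conjugate_part lam (nat j) \<in> conjugate_part lam ` {1..hd lam}"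
    using bounds by (intro imageI) auto
  ultimately show "strip_meet lam (lam ! nat (i - 1)) (conjugate_part lam (nat j)) \<in> blocks lam"
    unfolding blocks_def by blast
qed

lemma block_containing_box:
  assumes "D \<in> blocks lam" "(i, j) \<in> D"
  shows "D = strip_meet lam (lam ! nat (i - 1)) (conjugate_part lam (nat j))" "(i, j) \<in> ferrers lam"
proof -
  obtain r c where D: "D = strip_meet lam r c" "D \<subseteq> ferrers lam"
    using assms(1) unfolding blocks_def by blast
  show "D = strip_meet lam (lam ! nat (i - 1)) (conjugate_part lam (nat j))"
    using assms(2) unfolding D(1) strip_meet_iff by simp
  show "(i, j) \<in> ferrers lam" using assms(2) D(2) by blast
qed

text \<open>A block is a corner block if one cannot leave it within the diagram by a step to the right
  or down.\<close>

lemma corner_block_iff: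
  assumes part: "is_partition lam"
  shows "corner_block lam C \<longleftrightarrow> C \<in> blocks lam \<and> (\<forall>i j. (i, j) \<in> C \<longrightarrow>
    ((i, j + 1) \<in> ferrers lam \<longrightarrow> (i, j + 1) \<in> C) \<and> ((i + 1, j) \<in> ferrers lam \<longrightarrow> (i + 1, j) \<in> C))"
proof -
  have other: "(\<exists>D\<in>blocks lam. D \<noteq> C \<and> x \<in> D) \<longleftrightarrow> x \<in> ferrers lam \<and> x \<notin> C"
    if C: "C \<in> blocks lam" for x
  proof (cases x)
    case (Pair i j)
    show ?thesis
    proof
      assume "\<exists>D\<in>blocks lam. D \<noteq> C \<and> x \<in> D"
      then obtain D where D: "D \<in> blocks lam" "D \<noteq> C" "(i, j) \<in> D" using Pair by blast
      then have "(i, j) \<notin> C"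
        using block_containing_box(1)[OF C, of i j] block_containing_box(1)[OF D(1,3)] by metis
      then show "x \<in> ferrers lam \<and> x \<notin> C" using block_containing_box(2)[OF D(1,3)] Pair by simp
    next
      assume "x \<in> ferrers lam \<and> x \<notin> C"
      then show "\<exists>D\<in>blocks lam. D \<noteq> C \<and> x \<in> D"
        using block_of_box[OF part, of i j] Pair by (intro bexI conjI) auto
    qed
  qed
  have "corner_block lam C \<longleftrightarrow> C \<in> blocks lam \<and> (\<forall>i j. (i, j) \<in> C \<longrightarrow>
      \<not> (\<exists>D\<in>blocks lam. D \<noteq> C \<and> (i, j + 1) \<in> D) \<and> \<not> (\<exists>D\<in>blocks lam. D \<noteq> C \<and> (i + 1, j) \<in> D))"
    unfolding corner_block_def by fast
  then show ?thesis
    by (cases "C \<in> blocks lam") (simp_all only: other de_Morgan_conj not_not imp_conv_disj simp_thms)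
qed

lemma top_right_corner_block_iff:
  assumes part: "is_partition lam"
  shows "top_right_corner_block lam C \<longleftrightarrow> C = top_right_part (ferrers lam)"
proof -
  define m where "m = int (hd lam)"
  define S where "S = strip_meet lam (hd lam) (conjugate_part lam (hd lam))"
  let ?F = "ferrers lam"
  let ?r = "\<lambda>i. lam ! nat (i - 1)" and ?c = "\<lambda>j. conjugate_part lam (nat j)"
  have len: "0 < length lam" by (rule is_partitionD(2)[OF part])
  have hd: "hd lam = ?r 1" using len by (simp add: hd_conv_nth)
  have m: "1 \<le> m" using is_partitionD(4)[OF part len] hd by (simp add: m_def)
  have corner: "(1, m) \<in> ?F" using len m hd by (simp add: ferrers_iff m_def Suc_le_eq)
  have row_mono: "?r p \<le> ?r i" if "1 \<le> i" "i \<le> p" "p \<le> int (length lam)" for i p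
    using that by (intro is_partitionD(3)[OF part]) auto
  have col_mono: "?c s \<le> ?c j" if "1 \<le> j" "j \<le> s" for j s
    unfolding conjugate_part_def using that by (intro card_mono) auto
  have S_iff: "(i, j) \<in> S \<longleftrightarrow> (i, j) \<in> ?F \<and> ?r i = hd lam \<and> ?c j = ?c m" for i j
    unfolding S_def strip_meet_iff using ferrers_row_le_hd[OF part, of i j] by (auto simp: ferrers_iff m_def)
  have "(i, j) \<in> S \<longleftrightarrow> (i, j) \<in> top_right_part ?F" for i j
  proof
    assume ij: "(i, j) \<in> S"
    have rows: "(p, u) \<in> ?F \<longleftrightarrow> (i, u) \<in> ?F" if ps: "(p, s) \<in> ?F" "p \<le> i" for p s u
    proof -
      have "1 \<le> p" "i \<le> int (length lam)" using ps ij by (auto simp: S_iff ferrers_iff)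
      then have "?r i \<le> ?r p" "?r p \<le> ?r 1"
        using row_mono[of p i] row_mono[of 1 p] ps(2) by simp_all
      then have "?r p = ?r i" using ij hd by (simp add: S_iff)
      then show ?thesis using ps ij by (auto simp: S_iff ferrers_iff)
    qed
    have cols: "(u, s) \<in> ?F \<longleftrightarrow> (u, j) \<in> ?F" if ps: "(p, s) \<in> ?F" "j \<le> s" for p s u
    proof (cases "1 \<le> u")
      case True
      have j: "1 \<le> j" using ij by (simp add: S_iff ferrers_iff)
      have "?c s \<le> ?c j" "?c m \<le> ?c s"
        using col_mono[of j s] col_mono[of s m] j ps(2) ferrers_row_le_hd[OF part ps(1)]
        unfolding m_def by linarith+
      then have "?c s = ?c j" using ij by (simp add: S_iff)
      then show ?thesis using True j ps(2) by (simp add: ferrers_column_iff[OF part])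
    qed (simp add: ferrers_iff)
    show "(i, j) \<in> top_right_part ?F"
    proof (rule top_right_partI)
      show "(i, j) \<in> ?F" using ij by (simp add: S_iff)
    qed (erule (1) rows | erule (1) cols)+
  next
    assume "(i, j) \<in> top_right_part ?F"
    note part_ij = top_right_partD[OF this]
    note ij = part_ij(1) and row = part_ij(2) and col = part_ij(3)
    have bounds: "1 \<le> i" "i \<le> int (length lam)" "1 \<le> j" "j \<le> m"
      using ij ferrers_row_le_hd[OF part ij] by (auto simp: ferrers_iff m_def)
    have "(i, m) \<in> ?F" using row[OF corner bounds(1), of m] corner by simp
    then have "?r i = hd lam"
      using row_mono[of 1 i] bounds hd by (simp add: ferrers_iff m_def)
    moreover have cj: "1 \<le> int (?c j)" using ij bounds ferrers_column_iff[OF part, of i j] by simp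
    then have "(int (?c j), j) \<in> ?F" using bounds by (simp add: ferrers_column_iff[OF part])
    then have "(int (?c j), m) \<in> ?F" using col[OF corner bounds(4)] by simp
    then have "?c j \<le> ?c m" using ferrers_column_iff[OF part cj m] by simp
    then have "?c j = ?c m" using col_mono[of j m] bounds by simp
    ultimately show "(i, j) \<in> S" using ij by (simp add: S_iff)
  qed
  then have S: "S = top_right_part ?F" by (intro equalityI subrelI) blast+
  have "top_right_corner_block lam C \<longleftrightarrow> C = S"
  proof
    assume "top_right_corner_block lam C"
    then obtain j where C: "C \<in> blocks lam" and j: "(1, j) \<in> C"
      and right: "\<And>i j. (i, j) \<in> C \<Longrightarrow> (i, j + 1) \<in> ?F \<Longrightarrow> (i, j + 1) \<in> C"
      unfolding top_right_corner_block_def corner_block_iff[OF part] by blast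
    have j1: "1 \<le> j" "j \<le> m"
      using block_containing_box(2)[OF C j] ferrers_row_le_hd[OF part, of 1 j] by (auto simp: ferrers_iff m_def)
    have "(1, j') \<in> C" if "j \<le> j'" "j' \<le> m" for j'
      using that
    proof (induction j' rule: int_ge_induct)
      case (step k)
      have "(1, k + 1) \<in> ?F"
        using step j1 corner by (simp add: ferrers_iff)
      then show ?case using step by (intro right) auto
    qed (rule j)
    then have "(1, m) \<in> C" using j1 by simp
    then show "C = S" using block_containing_box(1)[OF C, of 1 m] hd by (simp add: S_def m_def)
  next
    assume "C = S"
    have "S \<in> blocks lam" using block_of_box(1)[OF part corner] hd by (simp add: S_def m_def)
    moreover have "(i, j + 1) \<in> S" if "(i, j) \<in> S" "(i, j + 1) \<in> ?F" for i j
    proof -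
      have "?c (j + 1) \<le> ?c j" "?c m \<le> ?c (j + 1)"
        using col_mono[of j "j + 1"] col_mono[of "j + 1" m] that(2) ferrers_row_le_hd[OF part that(2)]
          that(1)[unfolded S_iff ferrers_iff]
        unfolding m_def by linarith+
      then show ?thesis using that by (simp add: S_iff)
    qed
    moreover have "(i + 1, j) \<in> S" if "(i, j) \<in> S" "(i + 1, j) \<in> ?F" for i j
    proof -
      have j: "1 \<le> j" using that by (simp add: S_iff ferrers_iff)
      then have "(i + 1, m) \<in> ?F"
        using that m by (simp add: S_iff ferrers_column_iff[OF part, of "i + 1"] ferrers_iff[of i])
      then have "?r (i + 1) = hd lam"
        using row_mono[of 1 "i + 1"] that hd by (simp add: S_iff ferrers_iff m_def)
      then show ?thesis using that by (simp add: S_iff)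
    qed
    moreover have "(1, m) \<in> S" using corner hd by (simp add: S_iff)
    ultimately show "top_right_corner_block lam C"
      unfolding \<open>C = S\<close> top_right_corner_block_def corner_block_iff[OF part] by blast
  qed
  then show ?thesis unfolding S .
qed

lemma bottom_left_corner_block_iff:
  assumes part: "is_partition lam"
  shows "bottom_left_corner_block lam C \<longleftrightarrow> C = bottom_left_part (ferrers lam)"
proof -
  define n where "n = int (length lam)"
  let ?F = "ferrers lam"
  let ?r = "\<lambda>i. lam ! nat (i - 1)" and ?c = "\<lambda>j. conjugate_part lam (nat j)"
  define S where "S = strip_meet lam (?r n) (?c 1)"
  have len: "0 < length lam" by (rule is_partitionD(2)[OF part])
  have n: "1 \<le> n" using len unfolding n_def by linarith
  have corner: "(n, 1) \<in> ?F"
  proof -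
    have "nat (n - 1) < length lam" using n by (simp add: n_def)
    then have "1 \<le> int (?r n)" using is_partitionD(4)[OF part, of "nat (n - 1)"] by linarith
    then show ?thesis using n by (simp add: ferrers_iff n_def)
  qed
  have row_mono: "?r p \<le> ?r i" if "1 \<le> i" "i \<le> p" "p \<le> n" for i p
    using that by (intro is_partitionD(3)[OF part]) (auto simp: n_def)
  have col_mono: "?c s \<le> ?c j" if "1 \<le> j" "j \<le> s" for j s
    unfolding conjugate_part_def using that by (intro card_mono) auto
  have S_iff: "(i, j) \<in> S \<longleftrightarrow> (i, j) \<in> ?F \<and> ?r i = ?r n \<and> ?c j = ?c 1" for i j
  proof -
    have "(i, j) \<in> ?F" if "(i, j) \<in> S"
    proof -
      have b: "1 \<le> i" "i \<le> n" "1 \<le> j" "?c j = ?c 1" using that by (auto simp: S_def strip_meet_iff n_def)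
      have "n \<le> int (?c 1)" using corner n by (simp add: ferrers_column_iff[OF part])
      then show ?thesis using b by (simp add: ferrers_column_iff[OF part])
    qed
    then show ?thesis
      unfolding S_def strip_meet_iff using ferrers_row_le_hd[OF part, of i j] by (auto simp: ferrers_iff)
  qed
  have "(i, j) \<in> S \<longleftrightarrow> (i, j) \<in> bottom_left_part ?F" for i j
  proof
    assume ij: "(i, j) \<in> S"
    have rows: "(p, u) \<in> ?F \<longleftrightarrow> (i, u) \<in> ?F" if ps: "(p, s) \<in> ?F" "i \<le> p" for p s u
    proof -
      have "1 \<le> i" "p \<le> n" using ps ij by (auto simp: S_iff ferrers_iff n_def)
      then have "?r p \<le> ?r i" "?r n \<le> ?r p"
        using row_mono[of i p] row_mono[of p n] ps(2) by simp_all
      then have "?r p = ?r i" using ij by (simp add: S_iff)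
      then show ?thesis using ps ij by (auto simp: S_iff ferrers_iff)
    qed
    have cols: "(u, s) \<in> ?F \<longleftrightarrow> (u, j) \<in> ?F" if ps: "(p, s) \<in> ?F" "s \<le> j" for p s u
    proof (cases "1 \<le> u")
      case True
      have s: "1 \<le> s" using ps by (simp add: ferrers_iff)
      have "?c j \<le> ?c s" "?c s \<le> ?c 1"
        using col_mono[of s j] col_mono[of 1 s] s ps(2) by linarith+
      then have "?c s = ?c j" using ij by (simp add: S_iff)
      then show ?thesis using True s ps(2) by (simp add: ferrers_column_iff[OF part])
    qed (simp add: ferrers_iff)
    show "(i, j) \<in> bottom_left_part ?F"
    proof (rule bottom_left_partI)
      show "(i, j) \<in> ?F" using ij by (simp add: S_iff)
    qed (erule (1) rows | erule (1) cols)+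
  next
    assume "(i, j) \<in> bottom_left_part ?F"
    note part_ij = bottom_left_partD[OF this]
    note ij = part_ij(1) and row = part_ij(2) and col = part_ij(3)
    have bounds: "1 \<le> i" "i \<le> n" "1 \<le> j"
      using ij by (auto simp: ferrers_iff n_def)
    have "1 \<le> ?r i" using ij by (auto simp: ferrers_iff)
    then have "(i, int (?r i)) \<in> ?F" using bounds by (simp add: ferrers_iff n_def)
    then have "(n, int (?r i)) \<in> ?F" using row[OF corner bounds(2)] by simp
    then have "?r i = ?r n"
      using row_mono[of i n] bounds by (simp add: ferrers_iff)
    moreover have "(n, j) \<in> ?F" using col[OF corner bounds(3), of n] corner by simp
    then have "n \<le> int (?c j)" using n bounds by (simp add: ferrers_column_iff[OF part])
    then have "?c j = ?c 1"
      using col_mono[of 1 j] bounds conjugate_part_le[of lam 1] by (simp add: n_def)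
    ultimately show "(i, j) \<in> S" using ij by (simp add: S_iff)
  qed
  then have S: "S = bottom_left_part ?F" by (intro equalityI subrelI) blast+
  have "bottom_left_corner_block lam C \<longleftrightarrow> C = S"
  proof
    assume "bottom_left_corner_block lam C"
    then obtain i where C: "C \<in> blocks lam" and i: "(i, 1) \<in> C"
      and down: "\<And>i j. (i, j) \<in> C \<Longrightarrow> (i + 1, j) \<in> ?F \<Longrightarrow> (i + 1, j) \<in> C"
      unfolding bottom_left_corner_block_def corner_block_iff[OF part] by blast
    have i1: "1 \<le> i" "i \<le> n" using block_containing_box(2)[OF C i] by (auto simp: ferrers_iff n_def)
    have "(i', 1) \<in> C" if "i \<le> i'" "i' \<le> n" for i'
      using that
    proof (induction i' rule: int_ge_induct)
      case (step k)
      have "(k + 1, 1) \<in> ?F"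
        using step i1 corner n by (simp add: ferrers_column_iff[OF part])
      then show ?case using step by (intro down) auto
    qed (rule i)
    then have "(n, 1) \<in> C" using i1 by simp
    then show "C = S" using block_containing_box(1)[OF C, of n 1] by (simp add: S_def)
  next
    assume "C = S"
    have "S \<in> blocks lam" using block_of_box(1)[OF part corner] by (simp add: S_def)
    moreover have "(i, j + 1) \<in> S" if "(i, j) \<in> S" "(i, j + 1) \<in> ?F" for i j
    proof -
      have "1 \<le> j" using that by (simp add: S_iff ferrers_iff)
      moreover have "(n, j + 1) \<in> ?F" using that n by (simp add: S_iff ferrers_iff n_def)
      ultimately have "?c (j + 1) = ?c 1"
        using col_mono[of 1 "j + 1"] conjugate_part_le[of lam 1] n
        by (simp add: ferrers_column_iff[OF part] n_def)
      then show ?thesis using that by (simp add: S_iff)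
    qed
    moreover have "(i + 1, j) \<in> S" if "(i, j) \<in> S" "(i + 1, j) \<in> ?F" for i j
    proof -
      have "?r (i + 1) \<le> ?r i" "?r n \<le> ?r (i + 1)"
        using that row_mono[of i "i + 1"] row_mono[of "i + 1" n] by (auto simp: S_iff ferrers_iff n_def)
      then have "?r (i + 1) = ?r n" using that by (simp add: S_iff)
      then show ?thesis using that by (simp add: S_iff)
    qed
    moreover have "(n, 1) \<in> S" using corner by (simp add: S_iff)
    ultimately show "bottom_left_corner_block lam C"
      unfolding \<open>C = S\<close> bottom_left_corner_block_def corner_block_iff[OF part] by blast
  qed
  then show ?thesis unfolding S .
qed

text \<open>In particular the extremal blocks of a shape do not depend on the partition that represents it.\<close>

lemma extremal_block_iff:
  assumes "prime_unmixed (K :: 'k::field itself) B"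
  shows "top_right_block B C \<longleftrightarrow> C = top_right_part B"
    "bottom_left_block B C \<longleftrightarrow> C = bottom_left_part B"
proof -
  obtain lam f where lam: "is_partition lam" "shape_map f" "B = f ` ferrers lam"
  proof -
    obtain lam a b where "unmixed_partition K lam"
      "B = translate a b ` ferrers lam \<or> B = (translate a b \<circ> reflect) ` ferrers lam"
      using assms unfolding prime_unmixed_def upper_prime_unmixed_def lower_prime_unmixed_def image_comp
      by blast
    then show thesis using that unfolding unmixed_partition_def shape_map_def by blast
  qed
  show "top_right_block B C \<longleftrightarrow> C = top_right_part B"
  proof
    assume "top_right_block B C"
    then show "C = top_right_part B"
      unfolding top_right_block_def by (auto simp: top_right_corner_block_iff shape_map_parts)
  next
    assume "C = top_right_part B"
    then show "top_right_block B C"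
      unfolding top_right_block_def using lam
      by (intro exI[of _ lam] exI[of _ f] exI[of _ "top_right_part (ferrers lam)"])
        (simp add: top_right_corner_block_iff shape_map_parts)
  qed
  show "bottom_left_block B C \<longleftrightarrow> C = bottom_left_part B"
  proof
    assume "bottom_left_block B C"
    then show "C = bottom_left_part B"
      unfolding bottom_left_block_def by (auto simp: bottom_left_corner_block_iff shape_map_parts)
  next
    assume "C = bottom_left_part B"
    then show "bottom_left_block B C"
      unfolding bottom_left_block_def using lam
      by (intro exI[of _ lam] exI[of _ f] exI[of _ "bottom_left_part (ferrers lam)"])
        (simp add: bottom_left_corner_block_iff shape_map_parts)
  qed
qed

text \<open>Rows and columns before the first cut or behind the last cut do not depend on their index \<open>k\<close>.\<close>

lemma typed_cut_lines_before:
  assumes "a \<le> q" "\<forall>z\<in>X. e \<le> z" "a \<le> k" "k \<le> e" "e \<le> q"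
  shows "(k, c - v) \<in> typed_cut ty c a q X {} \<longleftrightarrow> a \<le> v \<and> v \<le> q \<and> (ty \<or> (\<forall>z\<in>X. v \<le> z))"
    "(v, c - k) \<in> typed_cut ty c a q X {} \<longleftrightarrow> a \<le> v \<and> v \<le> q \<and> (\<not> ty \<or> (\<forall>z\<in>X. v \<le> z))"
  using assms by (cases ty; fastforce simp: typed_cut_iff)+

lemma typed_cut_lines_after:
  assumes "a \<le> q" "\<forall>z\<in>X. z < b" "b \<le> k" "k \<le> q" "a \<le> b"
  shows "(k, c - v) \<in> typed_cut ty c a q X {} \<longleftrightarrow> a \<le> v \<and> v \<le> q \<and> (\<not> ty \<or> (\<forall>z\<in>X. z < v))"
    "(v, c - k) \<in> typed_cut ty c a q X {} \<longleftrightarrow> a \<le> v \<and> v \<le> q \<and> (ty \<or> (\<forall>z\<in>X. z < v))"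
  using assms by (cases ty; fastforce simp: typed_cut_iff)+

text \<open>The top-right block ends at the first cut, and the bottom-left block begins behind the last one.\<close>

lemma top_right_part_typed_cut:
  assumes aq: "a \<le> q" and X: "X \<subseteq> {a..<q}" and e: "a \<le> e" "e \<le> q" "\<forall>z\<in>X. e \<le> z" "e = q \<or> e \<in> X"
  shows "top_right_part (typed_cut ty c a q X {}) = typed_cut ty' c a e {} {}"
proof -
  let ?B = "typed_cut ty c a q X {}"
  have "(k, c - l) \<in> top_right_part ?B \<longleftrightarrow> a \<le> k \<and> k \<le> e \<and> a \<le> l \<and> l \<le> e" for k l
  proof
    assume kl: "a \<le> k \<and> k \<le> e \<and> a \<le> l \<and> l \<le> e"
    note row = typed_cut_lines_before[OF aq e(3) _ _ e(2)]
    show "(k, c - l) \<in> top_right_part ?B"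
    proof (rule top_right_partI)
      show "(k, c - l) \<in> ?B" using kl e by (subst row) auto
      show "(p, u) \<in> ?B \<longleftrightarrow> (k, u) \<in> ?B" if "(p, s) \<in> ?B" "p \<le> k" for p s u
      proof -
        have "a \<le> p" using that by (simp add: typed_cut_iff)
        then show ?thesis
          using row(1)[of p c "c - u" ty] row(1)[of k c "c - u" ty] kl that(2) by simp
      qed
      show "(u, s) \<in> ?B \<longleftrightarrow> (u, c - l) \<in> ?B" if "(p, s) \<in> ?B" "c - l \<le> s" for p s u
      proof -
        have "a \<le> c - s" using that by (simp add: typed_cut_iff)
        then show ?thesis
          using row(2)[of "c - s" u c ty] row(2)[of l u c ty] kl that(2) by simp
      qed
    qed
  next
    assume "(k, c - l) \<in> top_right_part ?B"
    note part = top_right_partD[OF this]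
    have b: "a \<le> k" "k \<le> q" "a \<le> l" "l \<le> q" using part(1) by (auto simp: typed_cut_iff)
    have diag: "(v, c - v) \<in> ?B \<longleftrightarrow> a \<le> v \<and> v \<le> q" for v by (auto simp: typed_cut_iff)
    have row: "(a, u) \<in> ?B \<longleftrightarrow> (k, u) \<in> ?B" for u using part(2)[of a "c - a"] diag[of a] aq b by simp
    have col: "(u, c - a) \<in> ?B \<longleftrightarrow> (u, c - l) \<in> ?B" for u using part(3)[of a "c - a"] diag[of a] aq b by simp
    have no: "(a, c - v) \<in> ?B \<and> (v, c - a) \<in> ?B \<Longrightarrow> False" if "e < v" "v \<le> q" for v
    proof -
      have "e \<in> X" using e(4) that by auto
      then show "(a, c - v) \<in> ?B \<and> (v, c - a) \<in> ?B \<Longrightarrow> False"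
        using that e(1) by (cases ty) (force simp: typed_cut_iff)+
    qed
    have "(a, c - k) \<in> ?B" "(k, c - a) \<in> ?B"
      using row[of "c - k"] row[of "c - a"] diag[of k] diag[of a] b aq by auto
    then have "k \<le> e" using no[of k] b by force
    have "(a, c - l) \<in> ?B" "(l, c - a) \<in> ?B"
      using col[of a] col[of l] diag[of l] diag[of a] b aq by auto
    then have "l \<le> e" using no[of l] b by force
    show "a \<le> k \<and> k \<le> e \<and> a \<le> l \<and> l \<le> e" using b \<open>k \<le> e\<close> \<open>l \<le> e\<close> by simp
  qed
  note iff = this
  have "(k, j) \<in> top_right_part ?B \<longleftrightarrow> (k, j) \<in> typed_cut ty' c a e {} {}" for k j
    using iff[of k "c - j"] by (simp add: typed_cut_iff)
  then show ?thesis by (intro equalityI subrelI) blast+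
qed

lemma bottom_left_part_typed_cut:
  assumes aq: "a \<le> q" and X: "X \<subseteq> {a..<q}" and b: "a \<le> b" "b \<le> q" "\<forall>z\<in>X. z < b" "b = a \<or> b - 1 \<in> X"
  shows "bottom_left_part (typed_cut ty c a q X {}) = typed_cut ty' c b q {} {}"
proof -
  let ?B = "typed_cut ty c a q X {}"
  have "(k, c - l) \<in> bottom_left_part ?B \<longleftrightarrow> b \<le> k \<and> k \<le> q \<and> b \<le> l \<and> l \<le> q" for k l
  proof
    assume kl: "b \<le> k \<and> k \<le> q \<and> b \<le> l \<and> l \<le> q"
    note row = typed_cut_lines_after[OF aq b(3) _ _ b(1)]
    show "(k, c - l) \<in> bottom_left_part ?B"
    proof (rule bottom_left_partI)
      show "(k, c - l) \<in> ?B" using kl b by (subst row) auto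
      show "(p, u) \<in> ?B \<longleftrightarrow> (k, u) \<in> ?B" if "(p, s) \<in> ?B" "k \<le> p" for p s u
      proof -
        have "p \<le> q" using that by (simp add: typed_cut_iff)
        then show ?thesis
          using row(1)[of p c "c - u" ty] row(1)[of k c "c - u" ty] kl that(2) by simp
      qed
      show "(u, s) \<in> ?B \<longleftrightarrow> (u, c - l) \<in> ?B" if "(p, s) \<in> ?B" "s \<le> c - l" for p s u
      proof -
        have "c - s \<le> q" using that by (simp add: typed_cut_iff)
        then show ?thesis
          using row(2)[of "c - s" u c ty] row(2)[of l u c ty] kl that(2) by simp
      qed
    qed
  next
    assume "(k, c - l) \<in> bottom_left_part ?B"
    note part = bottom_left_partD[OF this]
    have kl: "a \<le> k" "k \<le> q" "a \<le> l" "l \<le> q" using part(1) by (auto simp: typed_cut_iff)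
    have diag: "(v, c - v) \<in> ?B \<longleftrightarrow> a \<le> v \<and> v \<le> q" for v by (auto simp: typed_cut_iff)
    have row: "(q, u) \<in> ?B \<longleftrightarrow> (k, u) \<in> ?B" for u using part(2)[of q "c - q"] diag[of q] aq kl by simp
    have col: "(u, c - q) \<in> ?B \<longleftrightarrow> (u, c - l) \<in> ?B" for u using part(3)[of q "c - q"] diag[of q] aq kl by simp
    have no: "(q, c - v) \<in> ?B \<and> (v, c - q) \<in> ?B \<Longrightarrow> False" if "v < b" "a \<le> v" for v
    proof -
      have "b - 1 \<in> X" using b(4) that by auto
      moreover from this have "b - 1 < q" using X by auto
      ultimately show "(q, c - v) \<in> ?B \<and> (v, c - q) \<in> ?B \<Longrightarrow> False"
        using that by (cases ty) (force simp: typed_cut_iff)+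
    qed
    have "(q, c - k) \<in> ?B" "(k, c - q) \<in> ?B"
      using row[of "c - k"] row[of "c - q"] diag[of k] diag[of q] kl aq by auto
    then have "b \<le> k" using no[of k] kl by force
    have "(q, c - l) \<in> ?B" "(l, c - q) \<in> ?B"
      using col[of q] col[of l] diag[of l] diag[of q] kl aq by auto
    then have "b \<le> l" using no[of l] kl by force
    show "b \<le> k \<and> k \<le> q \<and> b \<le> l \<and> l \<le> q" using kl \<open>b \<le> k\<close> \<open>b \<le> l\<close> by simp
  qed
  note iff = this
  have "(k, j) \<in> bottom_left_part ?B \<longleftrightarrow> (k, j) \<in> typed_cut ty' c b q {} {}" for k j
    using iff[of k "c - j"] by (simp add: typed_cut_iff)
  then show ?thesis by (intro equalityI subrelI) blast+
qed

section \<open>Decomposing and gluing diagrams\<close>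

text \<open>Two diagrams along the same antidiagonal that overlap in the square on \<open>b, \<dots>, q\<close> form the
  diagram with all their cuts, provided the cuts at the two ends of this square are of opposite
  kinds: these two cuts remove every box whose row lies before the overlap and whose column lies behind
  it, or vice versa.\<close>

lemma typed_cut_glue:
  assumes "a \<le> b" "b \<le> q" "q \<le> q'" and X: "X \<union> Y \<subseteq> {a..<b}" "b - 1 \<in> X"
    and X': "X' \<union> Y' \<subseteq> {q..<q'}" "q \<in> X'"
  shows "typed_cut ty c a q X Y \<union> typed_cut (\<not> ty) c b q' X' Y' = typed_cut (\<not> ty) c a q' (X' \<union> Y) (Y' \<union> X)"
    (is "?B \<union> ?B' = ?D")
proof -
  have "(k, c - l) \<in> ?B \<union> ?B' \<longleftrightarrow> (k, c - l) \<in> ?D" for k l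
  proof (cases "a \<le> k \<and> k \<le> q' \<and> a \<le> l \<and> l \<le> q'")
    case False
    then show ?thesis using assms(1-3) by (auto simp: typed_cut_iff)
  next
    case kl: True
    have low: "\<And>z. z \<in> X \<union> Y \<Longrightarrow> a \<le> z \<and> z < b" and high: "\<And>z. z \<in> X' \<union> Y' \<Longrightarrow> q \<le> z \<and> z < q'"
      using X(1) X'(1) by auto
    consider "k \<le> q" "l \<le> q" | "b \<le> k" "b \<le> l" "q < k \<or> q < l" | "k < b" "q < l" | "l < b" "q < k"
      using assms(2) by linarith
    then show ?thesis
    proof cases
      case 1
      have "(k, c - l) \<in> ?B \<longleftrightarrow> (k, c - l) \<in> ?D"
        using 1 kl assms(3) high unfolding typed_cut_iff by (cases ty) fastforce+
      moreover have "(k, c - l) \<in> ?B' \<Longrightarrow> (k, c - l) \<in> ?B"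
        using 1 kl assms(1) low unfolding typed_cut_iff by (cases ty) fastforce+
      ultimately show ?thesis by blast
    next
      case 2
      have "(k, c - l) \<in> ?B' \<longleftrightarrow> (k, c - l) \<in> ?D"
        using 2 kl assms(1) low unfolding typed_cut_iff by (cases ty) fastforce+
      moreover have "(k, c - l) \<notin> ?B" using 2 unfolding typed_cut_iff by auto
      ultimately show ?thesis by blast
    next
      case 3
      have "(k, c - l) \<notin> ?B" "(k, c - l) \<notin> ?B'" using 3 by (simp_all add: typed_cut_iff)
      moreover have "(k, c - l) \<notin> ?D"
      proof
        assume "(k, c - l) \<in> ?D"
        then show False
          using 3 X(2) X'(2) assms(2) unfolding typed_cut_iff
          by (cases ty) (auto dest: bspec[of _ _ q] bspec[of _ _ "b - 1"])
      qed
      ultimately show ?thesis by blast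
    next
      case 4
      have "(k, c - l) \<notin> ?B" "(k, c - l) \<notin> ?B'" using 4 by (simp_all add: typed_cut_iff)
      moreover have "(k, c - l) \<notin> ?D"
      proof
        assume "(k, c - l) \<in> ?D"
        then show False
          using 4 X(2) X'(2) assms(2) unfolding typed_cut_iff
          by (cases ty) (auto dest: bspec[of _ _ q] bspec[of _ _ "b - 1"])
      qed
      ultimately show ?thesis by blast
    qed
  qed
  note iff = this
  have "(k, j) \<in> ?B \<union> ?B' \<longleftrightarrow> (k, j) \<in> ?D" for k j using iff[of k "c - j"] by simp
  then show ?thesis by (intro equalityI subrelI) blast+
qed

text \<open>Sequences of prime unmixed shapes as in the decomposition of a shape that is not prime.\<close>

definition nonsquare_chain :: "'k::field itself \<Rightarrow> nat \<Rightarrow> (nat \<Rightarrow> box set) \<Rightarrow> bool" where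
  "nonsquare_chain K t B \<longleftrightarrow>
    (\<forall>i\<in>{1..t}. prime_unmixed K (B i) \<and> \<not> square_shape (B i)) \<and>
    (\<forall>i\<in>{1..<t}. alternating_type K (B i) (B (i + 1)) \<and>
      bottom_left_block (B i) (B i \<inter> B (i + 1)) \<and> top_right_block (B (i + 1)) (B i \<inter> B (i + 1)))"

lemma nonsquare_chainD:
  assumes "nonsquare_chain K t B"
  shows "i \<in> {1..t} \<Longrightarrow> prime_unmixed K (B i)" "i \<in> {1..t} \<Longrightarrow> \<not> square_shape (B i)"
    "i \<in> {1..<t} \<Longrightarrow> alternating_type K (B i) (B (i + 1))"
    "i \<in> {1..<t} \<Longrightarrow> bottom_left_block (B i) (B i \<inter> B (i + 1))"
    "i \<in> {1..<t} \<Longrightarrow> top_right_block (B (i + 1)) (B i \<inter> B (i + 1))"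
  using assms unfolding nonsquare_chain_def by simp_all

lemma less_Max_plus_one: "finite A \<Longrightarrow> z \<in> A \<Longrightarrow> z < Max A + 1" for z :: int
  using Max_ge[of A z] by linarith

text \<open>The decomposition of a diagram with cuts of both types: the first shape extends up to the first
  cut of the other type, and the next one begins behind the last cut before that.\<close>

lemma decompose_typed_cut:
  assumes "a \<le> q" "X \<union> Y \<subseteq> {a..<q}" "X \<inter> Y = {}" "e \<in> X" "\<forall>z\<in>X \<union> Y. e \<le> z"
  shows "\<exists>(t::nat) B. t \<ge> 1 \<and> nonsquare_chain (K :: 'k::field itself) t B \<and>
    typed_cut ty c a q X Y = (\<Union>i\<in>{1..t}. B i) \<and>
    prime_of_type K ty (B 1) \<and> top_right_part (B 1) = typed_cut True c a e {} {}"
  using assms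
proof (induction "nat (q - a)" arbitrary: a X Y e ty rule: less_induct)
  case less
  have fin: "finite X" "finite Y" using less.prems(2) by (auto intro: finite_subset[of _ "{a..<q}"])
  have e: "a \<le> e" "e < q" using less.prems(2,4) by auto
  show ?case
  proof (cases "Y = {}")
    case True
    let ?B = "typed_cut ty c a q X {}"
    have X: "X \<subseteq> {a..<q}" using less.prems(2) by simp
    have prime: "prime_of_type K ty ?B" unfolding prime_of_type_iff using less.prems(1) X by blast
    moreover have "\<not> square_shape ?B"
      unfolding square_typed_cut_iff[OF less.prems(1) X] using less.prems(4) by blast
    moreover have "top_right_part ?B = typed_cut True c a e {} {}"
      using less.prems e by (intro top_right_part_typed_cut) auto
    ultimately show ?thesis using True
      by (intro exI[of _ 1] exI[of _ "\<lambda>_. ?B"]) (auto simp: nonsquare_chain_def prime_unmixed_iff_type)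
  next
    case False
    \<comment> \<open>The first shape has the cuts in \<open>X1\<close>; it shares the square on \<open>b, \<dots>, e'\<close> with the rest.\<close>
    define e' where "e' = Min Y"
    have e': "e' \<in> Y" "\<And>z. z \<in> Y \<Longrightarrow> e' \<le> z" unfolding e'_def using False fin by auto
    define X1 where "X1 = {z \<in> X. z < e'}"
    define X2 where "X2 = {z \<in> X. e' < z}"
    have X12: "X = X1 \<union> X2"
      using less.prems(3) e'(1) unfolding X1_def X2_def by auto
    have "e \<le> e'" "e \<noteq> e'" using less.prems(3-5) e'(1) by auto
    then have eX1: "e \<in> X1" using less.prems(4) by (simp add: X1_def)
    have fin1: "finite X1" using fin by (simp add: X1_def)
    define b where "b = Max X1 + 1"
    have b1: "b - 1 \<in> X1" unfolding b_def using Max_in[OF fin1] eX1 by auto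
    have b: "\<And>z. z \<in> X1 \<Longrightarrow> z < b" unfolding b_def by (rule less_Max_plus_one[OF fin1])
    have order: "a \<le> e" "e < b" "b \<le> e'" "e' < q"
      using e b[OF eX1] b1 e'(1) less.prems(2) by (auto simp: X1_def)
    define B1 where "B1 = typed_cut ty c a e' X1 {}"
    have X1: "X1 \<subseteq> {a..<e'}" using less.prems(2) by (auto simp: X1_def)
    have ae': "a \<le> e'" using order by simp
    have prime1: "prime_of_type K ty B1"
      unfolding prime_of_type_iff B1_def using X1 ae' by blast
    have nonsq1: "\<not> square_shape B1"
      unfolding B1_def square_typed_cut_iff[OF ae' X1] using eX1 by blast
    have tr1: "top_right_part B1 = typed_cut True c a e {} {}"
      unfolding B1_def using X1 order eX1 less.prems(5) by (intro top_right_part_typed_cut) (auto simp: X1_def)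
    have bl1: "bottom_left_part B1 = typed_cut True c b e' {} {}"
      unfolding B1_def using X1 order b1 b by (intro bottom_left_part_typed_cut) auto
    have rest: "Y \<union> X2 \<subseteq> {b..<q}" "\<forall>z\<in>Y \<union> X2. e' \<le> z"
      using e'(2) order less.prems(2) by (force simp: X2_def)+
    have "\<exists>(t::nat) B. t \<ge> 1 \<and> nonsquare_chain K t B \<and>
      typed_cut (\<not> ty) c b q Y X2 = (\<Union>i\<in>{1..t}. B i) \<and>
      prime_of_type K (\<not> ty) (B 1) \<and> top_right_part (B 1) = typed_cut True c b e' {} {}"
    proof (rule less.hyps)
      show "nat (q - b) < nat (q - a)" using order by simp
      show "Y \<inter> X2 = {}" using less.prems(3) by (auto simp: X2_def)
    qed (use rest e'(1) order in auto)
    then obtain t B where t: "(1::nat) \<le> t" and chain: "nonsquare_chain K t B"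
      and union: "typed_cut (\<not> ty) c b q Y X2 = (\<Union>i\<in>{1..t}. B i)"
      and first: "prime_of_type K (\<not> ty) (B 1)" "top_right_part (B 1) = typed_cut True c b e' {} {}"
      by blast
    have meet: "B1 \<inter> B 1 = typed_cut True c b e' {} {}"
    proof
      have "B 1 \<subseteq> typed_cut (\<not> ty) c b q Y X2" unfolding union using t by auto
      then show "B1 \<inter> B 1 \<subseteq> typed_cut True c b e' {} {}"
        unfolding B1_def by (auto simp: typed_cut_iff dest: subsetD)
      have "top_right_part (B 1) \<subseteq> B 1" "bottom_left_part B1 \<subseteq> B1"
        by (auto simp: top_right_part_def bottom_left_part_def)
      then show "typed_cut True c b e' {} {} \<subseteq> B1 \<inter> B 1" using first(2) bl1 by simp
    qed
    define B' where "B' i = (if i = 1 then B1 else B (i - 1))" for i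
    have B'1: "B' 1 = B1" and B'Suc: "\<And>i. 1 \<le> i \<Longrightarrow> B' (i + 1) = B i" by (auto simp: B'_def)
    have range: "{1..t + 1} = insert 1 ((\<lambda>i. i + 1) ` {1..t})"
      using t by (auto simp: image_iff)
    show ?thesis
    proof (intro exI[of _ "t + 1"] exI[of _ B'] conjI)
      show "1 \<le> t + 1" by simp
      have "(\<Union>i\<in>{1..t}. B' (i + 1)) = (\<Union>i\<in>{1..t}. B i)"
        using B'Suc by (intro SUP_cong) auto
      then have "(\<Union>i\<in>{1..t + 1}. B' i) = B1 \<union> typed_cut (\<not> ty) c b q Y X2"
        unfolding range union UN_insert B'1 by blast
      also have "\<dots> = typed_cut (\<not> ty) c a q (Y \<union> {}) (X2 \<union> X1)"
        unfolding B1_def using order X1 b1 b rest e' less.prems(2)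
        by (intro typed_cut_glue) (auto simp: X2_def)
      also have "\<dots> = typed_cut ty c a q X Y"
        unfolding typed_cut_not X12 by (simp add: Un_commute)
      finally show "typed_cut ty c a q X Y = (\<Union>i\<in>{1..t + 1}. B' i)" by simp
      show "nonsquare_chain K (t + 1) B'"
        unfolding nonsquare_chain_def
      proof (intro conjI ballI)
        fix i assume "i \<in> {1..t + 1}"
        then consider "i = 1" | j where "i = j + 1" "j \<in> {1..t}" unfolding range by blast
        then have "prime_unmixed K (B' i) \<and> \<not> square_shape (B' i)"
        proof cases
          case 1
          then show ?thesis unfolding 1 B'1 prime_unmixed_iff_type using prime1 nonsq1 by blast
        next
          case (2 j)
          then have "B' i = B j" using B'Suc[of j] by simp
          then show ?thesis using nonsquare_chainD(1,2)[OF chain 2(2)] by simp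
        qed
        then show "prime_unmixed K (B' i)" "\<not> square_shape (B' i)" by simp_all
      next
        fix i assume i: "i \<in> {1..<t + 1}"
        have "alternating_type K (B' i) (B' (i + 1)) \<and>
          bottom_left_block (B' i) (B' i \<inter> B' (i + 1)) \<and> top_right_block (B' (i + 1)) (B' i \<inter> B' (i + 1))"
        proof (cases "i = 1")
          case True
          have eq: "B' i = B1" "B' (i + 1) = B 1" using True B'1 B'Suc[of 1] by simp_all
          have prime: "prime_unmixed K B1" "prime_unmixed K (B 1)"
            using prime1 first(1) by (auto simp: prime_unmixed_iff_type)
          have "alternating_type K B1 (B 1)" unfolding alternating_type_iff using prime1 first(1) by blast
          then show ?thesis
            unfolding eq meet extremal_block_iff[OF prime(1)] extremal_block_iff[OF prime(2)]
            using first(2) bl1 by simp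
        next
          case False
          then obtain j where j: "i = j + 1" "j \<in> {1..<t}" using i by (cases i) auto
          then have "B' i = B j" "B' (i + 1) = B (j + 1)" using B'Suc[of j] B'Suc[of "j + 1"] by auto
          then show ?thesis using nonsquare_chainD(3-5)[OF chain j(2)] by simp
        qed
        then show "alternating_type K (B' i) (B' (i + 1))" "bottom_left_block (B' i) (B' i \<inter> B' (i + 1))"
          "top_right_block (B' (i + 1)) (B' i \<inter> B' (i + 1))"
          by simp_all
      qed
      show "prime_of_type K ty (B' 1)" "top_right_part (B' 1) = typed_cut True c a e {} {}"
        using prime1 tr1 B'1 by simp_all
    qed
  qed
qed

text \<open>Conversely, gluing the shapes one after the other yields a diagram with cuts. The induction keeps
  track of the last square on \<open>b, \<dots>, q\<close>, in which the next shape starts, and of the kind of the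
  cut before it.\<close>

lemma glue_typed_cuts:
  fixes K :: "'k::field itself" and B :: "nat \<Rightarrow> box set"
  assumes chain: "nonsquare_chain K t B"
    and i: "1 \<le> i" "i \<le> t"
  shows "\<exists>ty c a b q X Y. prime_of_type K ty (B i) \<and> (\<Union>j\<in>{1..i}. B j) = typed_cut ty c a q X Y \<and>
    a \<le> b \<and> b \<le> q \<and> X \<union> Y \<subseteq> {a..<b} \<and> b - 1 \<in> X \<and> bottom_left_part (B i) = typed_cut True c b q {} {}"
  using i
proof (induction i rule: dec_induct)
  case base
  then obtain ty where ty: "prime_of_type K ty (B 1)" and nonsq: "\<not> square_shape (B 1)"
    using nonsquare_chainD(1,2)[OF chain, of 1] i by (auto simp: prime_unmixed_iff_type)
  then obtain c a q X where B1: "a \<le> q" "X \<subseteq> {a..<q}" "B 1 = typed_cut ty c a q X {}"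
    unfolding prime_of_type_iff by blast
  have "X \<noteq> {}" using nonsq unfolding B1(3) square_typed_cut_iff[OF B1(1,2)] .
  moreover have fin: "finite X" using B1(2) by (rule finite_subset) simp
  ultimately have max: "Max X \<in> X" "\<forall>z\<in>X. z < Max X + 1"
    using less_Max_plus_one[OF fin] by auto
  define b where "b = Max X + 1"
  have b: "a \<le> b" "b \<le> q" "b - 1 \<in> X" "\<forall>z\<in>X. z < b" "X \<subseteq> {a..<b}"
    using max B1(2) unfolding b_def by force+
  have "bottom_left_part (B 1) = typed_cut True c b q {} {}"
    unfolding B1(3) using B1 b by (intro bottom_left_part_typed_cut) auto
  then have "prime_of_type K ty (B 1) \<and> (\<Union>j\<in>{1..1}. B j) = typed_cut ty c a q X {} \<and>
      a \<le> b \<and> b \<le> q \<and> X \<union> {} \<subseteq> {a..<b} \<and> b - 1 \<in> X \<and>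
      bottom_left_part (B 1) = typed_cut True c b q {} {}"
    using ty B1(3) b by simp
  then show ?case by (intro exI)
next
  case (step i)
  then obtain ty c a b q X Y where ty: "prime_of_type K ty (B i)"
    and union: "(\<Union>j\<in>{1..i}. B j) = typed_cut ty c a q X Y"
    and ab: "a \<le> b" "b \<le> q" "X \<union> Y \<subseteq> {a..<b}" "b - 1 \<in> X"
    and bl: "bottom_left_part (B i) = typed_cut True c b q {} {}"
    by auto
  have iT: "i \<in> {1..<t}" "i \<in> {1..t}" "Suc i \<in> {1..t}" using step by auto
  obtain ty' where ty': "prime_of_type K ty' (B i)" "prime_of_type K (\<not> ty') (B (Suc i))"
    using nonsquare_chainD(3)[OF chain iT(1)] unfolding alternating_type_iff by auto
  have "ty' = ty"
  proof (rule ccontr)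
    assume "ty' \<noteq> ty"
    then have "prime_of_type K (\<not> ty) (B i)" using ty'(1) by (cases ty; cases ty') auto
    then show False using prime_type_unique[OF ty] nonsquare_chainD(2)[OF chain iT(2)] by blast
  qed
  then have "prime_of_type K (\<not> ty) (B (Suc i))" using ty'(2) by simp
  then obtain c' a' q' X' where B': "a' \<le> q'" "X' \<subseteq> {a'..<q'}" "B (Suc i) = typed_cut (\<not> ty) c' a' q' X' {}"
    unfolding prime_of_type_iff by blast
  have "X' \<noteq> {}"
    using nonsquare_chainD(2)[OF chain iT(3)] unfolding B'(3) square_typed_cut_iff[OF B'(1,2)] .
  moreover have fin: "finite X'" using B'(2) by (rule finite_subset) simp
  ultimately have mm: "Max X' \<in> X'" "Min X' \<in> X'" by auto
  have bounds: "z < Max X' + 1" "Min X' \<le> z" if "z \<in> X'" for z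
    using less_Max_plus_one[OF fin that] Min_le[OF fin that] .
  have "top_right_part (B (Suc i)) = typed_cut True c' a' (Min X') {} {}"
    unfolding B'(3) using B' mm bounds by (intro top_right_part_typed_cut) force+
  moreover have "top_right_part (B (Suc i)) = bottom_left_part (B i)"
    using nonsquare_chainD(4,5)[OF chain iT(1)]
      extremal_block_iff[OF nonsquare_chainD(1)[OF chain iT(2)]]
      extremal_block_iff[OF nonsquare_chainD(1)[OF chain iT(3)]] by simp
  ultimately have eq: "typed_cut True c b q {} {} = typed_cut True c' a' (Min X') {} {}" using bl by simp
  have "a' \<le> Min X'" using mm B'(2) by auto
  note params = typed_cut_params_unique[OF eq ab(2) this]
  define b' where "b' = Max X' + 1"
  have "(\<Union>j\<in>{1..Suc i}. B j) = typed_cut ty c a q X Y \<union> typed_cut (\<not> ty) c b q' X' {}"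
    using union B'(3) params step(1) by (simp add: atLeastAtMostSuc_conv Un_commute)
  also have "\<dots> = typed_cut (\<not> ty) c a q' (X' \<union> Y) ({} \<union> X)"
    using ab params mm bounds B'(2) by (intro typed_cut_glue) force+
  finally have union': "(\<Union>j\<in>{1..Suc i}. B j) = typed_cut (\<not> ty) c a q' (X' \<union> Y) X" by simp
  have b': "q < b'" "b' \<le> q'" "b' - 1 \<in> X'" "X' \<subseteq> {a'..<b'}"
    unfolding b'_def params(3) using mm bounds B'(2) by force+
  have "bottom_left_part (B (Suc i)) = typed_cut True c b' q' {} {}"
    unfolding B'(3) params(1) using B' b' mm bounds params by (intro bottom_left_part_typed_cut) auto
  moreover have "(X' \<union> Y) \<union> X \<subseteq> {a..<b'}" using ab b' params by force
  moreover have "a \<le> b'" "b' - 1 \<in> X' \<union> Y" using ab b' by auto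
  ultimately have "prime_of_type K (\<not> ty) (B (Suc i)) \<and>
      (\<Union>j\<in>{1..Suc i}. B j) = typed_cut (\<not> ty) c a q' (X' \<union> Y) X \<and> a \<le> b' \<and> b' \<le> q' \<and>
      (X' \<union> Y) \<union> X \<subseteq> {a..<b'} \<and> b' - 1 \<in> X' \<union> Y \<and>
      bottom_left_part (B (Suc i)) = typed_cut True c b' q' {} {}"
    using \<open>prime_of_type K (\<not> ty) (B (Suc i))\<close> union' b'(2) by (intro conjI)
  then show ?case by (intro exI)
qed

section \<open>Unmixed connected skew shapes\<close>

theorem theorem1p7:
  fixes K :: "'k::field itself" and lam mu :: "nat list"
  assumes "skew_shape lam mu" and "skew_connected lam mu"
  shows "unmixed_ideal (mpoly_ring (skew_vars lam)) (skew_ferrers_ideal lam mu :: 'k mpoly set)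
    \<longleftrightarrow>
    (\<exists>(t::nat) (B :: nat \<Rightarrow> box set). t \<ge> 1 \<and>
       (\<forall>i\<in>{1..t}. prime_unmixed K (B i) \<and> (t > 1 \<longrightarrow> \<not> square_shape (B i))) \<and>
       diagram lam mu = (\<Union>i\<in>{1..t}. B i) \<and>
       (\<forall>i\<in>{1..<t}. alternating_type K (B i) (B (i + 1)) \<and>
          bottom_left_block (B i) (B i \<inter> B (i + 1)) \<and>
          top_right_block (B (i + 1)) (B i \<inter> B (i + 1))))"
    (is "?unmixed \<longleftrightarrow> ?decomposition")
proof -
  have unmixed: "?unmixed \<longleftrightarrow> well_covered (skew_vars lam) (skew_edges lam mu)"
    using skew_unmixed_iff[OF assms(1), of K] unfolding skew_unmixed_def .
  show ?thesis
  proof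
    assume ?unmixed
    define n where "n = int (length lam)"
    define U where "U = {z \<in> {1..<n}. (z + 1, n + 1 - z) \<notin> diagram lam mu}"
    define L where "L = {z \<in> {1..<n}. (z, n - z) \<notin> diagram lam mu}"
    have wc: "well_covered (skew_vars lam) (skew_edges lam mu)" using \<open>?unmixed\<close> unmixed by simp
    have cols: "\<forall>j. 1 \<le> j \<longrightarrow> j \<le> hd lam \<longrightarrow> (\<exists>i. (i, int j) \<in> diagram lam mu)"
      using connected_columns[OF assms] by blast
    have diag: "diagram lam mu = cut_diagram (n + 1) 1 n U L"
      using well_covered_imp_cut_diagram[OF assms(1) cols wc] unfolding n_def U_def L_def .
    have n: "1 \<le> n" using skew_shapeD(1)[OF assms(1)] unfolding n_def by linarith
    have sub: "U \<union> L \<subseteq> {1..<n}" by (auto simp: U_def L_def)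
    \<comment> \<open>A position that carries cuts of both types would disconnect the diagram.\<close>
    have disj: "U \<inter> L = {}"
    proof (rule ccontr)
      assume "U \<inter> L \<noteq> {}"
      then obtain z where z: "z \<in> U" "z \<in> L" by blast
      then have zn: "1 \<le> z" "z < n" by (auto simp: U_def)
      obtain j where j: "(z, j) \<in> diagram lam mu" "(z + 1, j) \<in> diagram lam mu"
        using connected_rows_overlap[OF assms] zn unfolding n_def by blast
      then show False using z unfolding diag cut_diagram_iff by force
    qed
    show ?decomposition
    proof (cases "U \<union> L = {}")
      case True
      have "diagram lam mu = typed_cut True (n + 1) 1 n {} {}" using True diag by (simp add: typed_cut_def)
      then have "prime_of_type K True (diagram lam mu)"
        unfolding prime_of_type_iff using n by (metis empty_subsetI)
      then show ?thesis
        by (intro exI[of _ 1] exI[of _ "\<lambda>_. diagram lam mu"]) (auto simp: prime_unmixed_iff_type)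
    next
      case False
      define e where "e = Min (U \<union> L)"
      have fin: "finite (U \<union> L)" using sub by (rule finite_subset) simp
      have e: "e \<in> U \<union> L" "\<forall>z\<in>U \<union> L. e \<le> z"
        unfolding e_def using Min_in[OF fin False] Min_le[OF fin] by simp_all
      define ty where "ty \<longleftrightarrow> e \<in> U"
      define X where "X = (if ty then U else L)"
      define Y where "Y = (if ty then L else U)"
      have XY: "X \<union> Y = U \<union> L" "X \<inter> Y = {}" "e \<in> X"
        using disj e(1) by (auto simp: X_def Y_def ty_def)
      have eq: "diagram lam mu = typed_cut ty (n + 1) 1 n X Y"
        unfolding diag typed_cut_def X_def Y_def by simp
      have "\<exists>(t::nat) B. t \<ge> 1 \<and> nonsquare_chain K t B \<and>
          typed_cut ty (n + 1) 1 n X Y = (\<Union>i\<in>{1..t}. B i) \<and>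
          prime_of_type K ty (B 1) \<and> top_right_part (B 1) = typed_cut True (n + 1) 1 e {} {}"
        using XY sub e(2) n by (intro decompose_typed_cut) simp_all
      then obtain t B where tB: "(1::nat) \<le> t" "nonsquare_chain K t B" "diagram lam mu = (\<Union>i\<in>{1..t}. B i)"
        unfolding eq by blast
      then show ?thesis
        using tB(2) unfolding nonsquare_chain_def by (intro exI[of _ t] exI[of _ B] conjI) simp_all
    qed
  next
    assume ?decomposition
    then obtain t B where t: "(1::nat) \<le> t"
      and prime: "\<forall>i\<in>{1..t}. prime_unmixed K (B i) \<and> (t > 1 \<longrightarrow> \<not> square_shape (B i))"
      and union: "diagram lam mu = (\<Union>i\<in>{1..t}. B i)"
      and step: "\<forall>i\<in>{1..<t}. alternating_type K (B i) (B (i + 1)) \<and>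
        bottom_left_block (B i) (B i \<inter> B (i + 1)) \<and> top_right_block (B (i + 1)) (B i \<inter> B (i + 1))"
      by (elim exE conjE)
    have "\<exists>ty c a q X Y. diagram lam mu = typed_cut ty c a q X Y"
    proof (cases "t = 1")
      case True
      then have "prime_unmixed K (diagram lam mu)" using prime union by simp
      then show ?thesis unfolding prime_unmixed_iff_type prime_of_type_iff by blast
    next
      case False
      then have "nonsquare_chain K t B" using prime step t by (simp add: nonsquare_chain_def)
      from glue_typed_cuts[OF this t order_refl] show ?thesis
        unfolding union by (elim exE conjE) (intro exI)
    qed
    then obtain ty c a q X Y where "diagram lam mu = typed_cut ty c a q X Y" by (elim exE)
    then have "diagram lam mu = cut_diagram c a q (if ty then X else Y) (if ty then Y else X)"
      by (simp add: typed_cut_def)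
    then show ?unmixed
      unfolding unmixed by (rule cut_diagram_imp_well_covered(1)[OF assms(1)])
  qed
qed

end
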